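(* Let $n\geq 2$ and let $M^n$ be a closed strictly convex hypersurface in $\mathbb{R}^{n+1}$, given by $X:M^n\to\mathbb{R}^{n+1}$, satisfying $$F^{\alpha}=\langle X,\nu\rangle,$$ where $\nu$ is the outward unit normal vector field of $M^n$, $\alpha$ is a constant, and $F=f(\kappa_1,\ldots,\kappa_n)$ is a function of the principal curvatures $\kappa_1,\ldots,\kappa_n$ of $M^n$ such that: (i) $f$ is smooth, symmetric and positive on $\Gamma_+$; (ii) $\partial f/\partial\kappa_i>0$ on $\Gamma_+$ for every $i=1,\ldots,n$; (iii) $f(k\kappa)=kf(\kappa)$ for all $k>0$ and $\kappa\in\Gamma_+$; (iv) $f$ is inverse concave. If $\alpha>1$, then $M^n$ must be a round sphere.
   Context: $\Gamma_+=\{(\kappa_1,\ldots,\kappa_n)\in\mathbb{R}^n:\kappa_i>0 \text{ for all } i\}$. The hypersurface is smooth. Strictly convex means that all principal curvatures (eigenvalues of the Weingarten matrix $\mathcal{W}=(h_i^j)$, with sign convention such that round spheres with outward normal have positive principal curvatures) are positive, so $(\kappa_1,\ldots,\kappa_n)\in\Gamma_+$ at every point. $X$ also denotes the position vector. $f$ is called inverse concave if the function $f_*(x_1,\ldots,x_n):=\dfrac{1}{f(1/x_1,\ldots,1/x_n)}$ is concave on $\Gamma_+$. *)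

theory Defs
  imports "HOL-Analysis.Analysis"
begin

section \<open>Smooth maps on open sets\<close>

text \<open>The set \<open>S\<close> is meant to be open: derivatives are taken in the full space. In finite
  dimension \<open>Ck_on k S f\<close> says that all directional derivatives of \<open>f\<close> of order at most \<open>k\<close>
  exist and are continuous on \<open>S\<close>.\<close>

primrec Ck_on ::
  "nat \<Rightarrow> 'a set \<Rightarrow> ('a::real_normed_vector \<Rightarrow> 'b::real_normed_vector) \<Rightarrow> bool" where
  "Ck_on 0 S f \<longleftrightarrow> continuous_on S f"
| "Ck_on (Suc k) S f \<longleftrightarrow>
     (\<forall>x\<in>S. f differentiable at x) \<and> (\<forall>v. Ck_on k S (\<lambda>x. frechet_derivative f (at x) v))"

definition smooth_on ::
  "'a set \<Rightarrow> ('a::real_normed_vector \<Rightarrow> 'b::real_normed_vector) \<Rightarrow> bool" where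
  "smooth_on S f \<longleftrightarrow> (\<forall>k. Ck_on k S f)"

definition partial_deriv :: "'n::finite \<Rightarrow> (real^'n \<Rightarrow> 'b::real_normed_vector) \<Rightarrow> real^'n \<Rightarrow> 'b" where
  "partial_deriv i g y = frechet_derivative g (at y) (axis i 1)"


section \<open>Closed manifolds\<close>

text \<open>An atlas is a set of local parametrizations \<open>(V, \<psi>)\<close>, where \<open>\<psi>\<close> is the inverse of a
  chart and \<open>V\<close> is the (open) image of that chart. The values of \<open>\<psi>\<close> outside \<open>V\<close> are irrelevant.\<close>

type_synonym ('m, 'n) atlas = "((real^'n) set \<times> (real^'n \<Rightarrow> 'm)) set"

definition smooth_atlas :: "'m::t2_space set \<Rightarrow> ('m, 'n::finite) atlas \<Rightarrow> bool" where
  "smooth_atlas M A \<longleftrightarrow>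
     (\<Union>(V, \<psi>)\<in>A. \<psi> ` V) = M \<and>
     (\<forall>(V, \<psi>)\<in>A. open V \<and> openin (top_of_set M) (\<psi> ` V) \<and>
                  (\<exists>\<phi>. homeomorphism V (\<psi> ` V) \<psi> \<phi>)) \<and>
     (\<forall>(V, \<psi>)\<in>A. \<forall>(V', \<psi>')\<in>A.
        smooth_on {y \<in> V. \<psi> y \<in> \<psi>' ` V'} (inv_into V' \<psi>' \<circ> \<psi>))"

text \<open>Manifolds are connected and nonempty. Second countability follows from compactness.\<close>

definition closed_manifold :: "'m::t2_space set \<Rightarrow> ('m, 'n::finite) atlas \<Rightarrow> bool" where
  "closed_manifold M A \<longleftrightarrow> compact M \<and> connected M \<and> M \<noteq> {} \<and> smooth_atlas M A"

definition smooth_map :: "('m, 'n::finite) atlas \<Rightarrow> ('m \<Rightarrow> 'a::euclidean_space) \<Rightarrow> bool" where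
  "smooth_map A g \<longleftrightarrow> (\<forall>(V, \<psi>)\<in>A. smooth_on V (g \<circ> \<psi>))"

definition smooth_immersion :: "('m, 'n::finite) atlas \<Rightarrow> ('m \<Rightarrow> 'a::euclidean_space) \<Rightarrow> bool" where
  "smooth_immersion A X \<longleftrightarrow>
     smooth_map A X \<and> (\<forall>(V, \<psi>)\<in>A. \<forall>y\<in>V. inj (frechet_derivative (X \<circ> \<psi>) (at y)))"


section \<open>Extrinsic geometry of a hypersurface\<close>

text \<open>\<open>outside (X ` M)\<close> is the union of the unbounded components of the complement of the
  hypersurface (one component, as the ambient dimension is at least two), so the last condition
  says that the normal points out of the enclosed region. A closed strictly convex immersed
  hypersurface is embedded by Hadamard's theorem, so there this is the usual outward normal.\<close>

definition outward_unit_normal ::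
  "'m set \<Rightarrow> ('m, 'n::finite) atlas \<Rightarrow> ('m \<Rightarrow> 'a::euclidean_space) \<Rightarrow> ('m \<Rightarrow> 'a) \<Rightarrow> bool" where
  "outward_unit_normal M A X \<nu> \<longleftrightarrow>
     smooth_map A \<nu> \<and>
     (\<forall>p\<in>M. norm (\<nu> p) = 1) \<and>
     (\<forall>(V, \<psi>)\<in>A. \<forall>y\<in>V. \<forall>i. partial_deriv i (X \<circ> \<psi>) y \<bullet> \<nu> (\<psi> y) = 0) \<and>
     (\<forall>p\<in>M. eventually (\<lambda>t. X p + t *\<^sub>R \<nu> p \<in> outside (X ` M)) (at_right 0))"

definition first_fundamental_form ::
  "('m \<Rightarrow> 'a::euclidean_space) \<Rightarrow> (real^'n \<Rightarrow> 'm) \<Rightarrow> real^'n \<Rightarrow> real^'n^'n::finite" where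
  "first_fundamental_form X \<psi> y =
     (\<chi> i j. partial_deriv i (X \<circ> \<psi>) y \<bullet> partial_deriv j (X \<circ> \<psi>) y)"

text \<open>The sign makes round spheres with outward normal positively curved.\<close>

definition second_fundamental_form ::
  "('m \<Rightarrow> 'a::euclidean_space) \<Rightarrow> ('m \<Rightarrow> 'a) \<Rightarrow> (real^'n \<Rightarrow> 'm) \<Rightarrow> real^'n \<Rightarrow> real^'n^'n::finite" where
  "second_fundamental_form X \<nu> \<psi> y =
     (\<chi> i j. - (partial_deriv i (partial_deriv j (X \<circ> \<psi>)) y \<bullet> \<nu> (\<psi> y)))"

text \<open>The matrix $h_i^j = \sum_k h_{ik} g^{kj}$, with row index $i$ and column index $j$.\<close>

definition weingarten_matrix ::
  "('m \<Rightarrow> 'a::euclidean_space) \<Rightarrow> ('m \<Rightarrow> 'a) \<Rightarrow> (real^'n \<Rightarrow> 'm) \<Rightarrow> real^'n \<Rightarrow> real^'n^'n::finite" where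
  "weingarten_matrix X \<nu> \<psi> y =
     second_fundamental_form X \<nu> \<psi> y ** matrix_inv (first_fundamental_form X \<psi> y)"

text \<open>The components of \<open>k\<close> are the eigenvalues of \<open>W\<close>, repeated according to multiplicity:
  they are the roots of the characteristic polynomial.\<close>

definition eigenvalue_vector :: "real^'n^'n::finite \<Rightarrow> real^'n \<Rightarrow> bool" where
  "eigenvalue_vector W k \<longleftrightarrow> (\<forall>t. det (mat t - W) = (\<Prod>i\<in>UNIV. t - k $ i))"

text \<open>\<open>\<kappa>\<close> lists, in some order at each point, the principal curvatures; they do not depend on
  the parametrization.\<close>

definition principal_curvatures ::
  "('m, 'n::finite) atlas \<Rightarrow> ('m \<Rightarrow> 'a::euclidean_space) \<Rightarrow> ('m \<Rightarrow> 'a) \<Rightarrow> ('m \<Rightarrow> real^'n) \<Rightarrow> bool" where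
  "principal_curvatures A X \<nu> \<kappa> \<longleftrightarrow>
     (\<forall>(V, \<psi>)\<in>A. \<forall>y\<in>V. eigenvalue_vector (weingarten_matrix X \<nu> \<psi> y) (\<kappa> (\<psi> y)))"


section \<open>Curvature functions\<close>

definition Gamma_plus :: "(real^'n::finite) set" where
  "Gamma_plus = {k. \<forall>i. k $ i > 0}"

definition symmetric_on_Gamma_plus :: "(real^'n::finite \<Rightarrow> real) \<Rightarrow> bool" where
  "symmetric_on_Gamma_plus f \<longleftrightarrow>
     (\<forall>\<sigma>. \<sigma> permutes UNIV \<longrightarrow> (\<forall>k\<in>Gamma_plus. f (\<chi> i. k $ \<sigma> i) = f k))"

definition inverse_concave :: "(real^'n::finite \<Rightarrow> real) \<Rightarrow> bool" where
  "inverse_concave f \<longleftrightarrow> concave_on Gamma_plus (\<lambda>x. 1 / f (\<chi> i. 1 / x $ i))"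

end

theory Submission
  imports Defs
begin

text \<open>
The Gauss map of a closed strictly convex hypersurface is a covering of the unit sphere, and the
sphere is simply connected because \<open>n \<ge> 2\<close>. So the Gauss map is a homeomorphism, and the position
vector becomes a function \<open>Y\<close> of the normal direction \<open>z\<close>, extended to all \<open>z \<noteq> 0\<close> by homogeneity of
degree 0. It is the gradient of the support function \<open>H z = Y z \<bullet> z\<close>. Its derivative \<open>T z\<close> is the
Hessian of \<open>H\<close>: a symmetric map that annihilates \<open>z\<close> and whose eigenvalues on the orthogonal
complement of a unit vector \<open>z\<close> are the radii of curvature \<open>r\<close>. Put \<open>\<beta> = 1 / \<alpha>\<close> and let \<open>\<phi>\<close> be the
function \<open>r \<mapsto> 1 / f (1 / r)\<close>, which is concave, symmetric, increasing and homogeneous of degree 1.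
The equation of the hypersurface says that \<open>\<phi> (r z) = H z powr (- \<beta>)\<close> on the unit sphere.

The proof applies the maximum principle to the function
\<open>H z * (T z v \<bullet> v) - (1 - \<beta>) / 2 * (Y z \<bullet> Y z)\<close> of a unit vector \<open>z\<close> and a unit vector \<open>v\<close> orthogonal
to \<open>z\<close>. At a maximum, \<open>v\<close> belongs to the largest radius \<open>r\<^sub>1\<close>. The second derivatives of this function
along great circles are weighted with the gradient \<open>p\<close> of \<open>\<phi>\<close>, and what the equation says to
second order is subtracted. The fourth derivatives of \<open>H\<close> cancel, and what remains says that
a sum of terms such as \<open>(1 - \<beta>) p\<^sub>k r\<^sub>k (r\<^sub>1 - r\<^sub>k)\<close> and \<open>2 \<beta> p\<^sub>k r\<^sub>k U\<^sub>k\<^sup>2 / H\<close>, all of them non-negative as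
\<open>\<beta> < 1\<close>, is at most 0; here the \<open>U\<^sub>k\<close> are the tangential components of \<open>Y z\<close>. Since \<open>n \<ge> 2\<close>, they all
vanish (\<open>max_point_inequality\<close>, \<open>tangential_part_vanishes_at_max\<close>).

Instead of second derivatives of the equation, which would bring in those of \<open>\<phi>\<close> as a function of
matrices, the proof uses the inequality \<open>H z powr (- \<beta>) \<le> (\<Sum>i. p\<^sub>i * (T z w\<^sub>i \<bullet> w\<^sub>i))\<close> for
all \<open>z\<close> and all orthonormal frames \<open>w\<close>, with equality at the eigenframe of the maximum point. It
follows from concavity and the rearrangement inequality for doubly stochastic matrices. The right
side may be evaluated in a frame that rotates while \<open>z\<close> moves, and a suitable speed of rotation, the
same for \<open>v\<close> and for the frame, replaces the second derivatives of \<open>\<phi>\<close> and of the largest eigenvalue.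

Finally the maximum principle is strong. If a direction \<open>q\<close> were not the first component of a
maximum point, then after adding a small multiple of \<open>exp (\<mu> * (z \<bullet> q))\<close> with \<open>\<mu>\<close> large the maximum
would still lie away from \<open>q\<close>, where the perturbation is strictly subharmonic for the linearised
equation, and this contradicts the same inequality. So \<open>Y z\<close> is a multiple of \<open>z\<close> for every \<open>z\<close>, which
makes \<open>H\<close> constant on the unit sphere: the hypersurface is \<open>X = \<rho> *\<^sub>R \<nu>\<close>.
\<close>

section \<open>Calculus of maps of class C^k\<close>

text \<open>The congruence hypothesis is discharged in \<open>Ck_on_Suc_intro\<close>; it is a hypothesis here
because the proof of congruence by induction on \<open>k\<close> needs this rule.\<close>

lemma Ck_on_SucI:
  fixes f :: "'a::real_normed_vector \<Rightarrow> 'b::real_normed_vector"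
  assumes "open S" "\<And>x. x \<in> S \<Longrightarrow> (f has_derivative f' x) (at x)"
    and "\<And>v. Ck_on k S (\<lambda>x. f' x v)"
    and cong: "\<And>g h :: 'a \<Rightarrow> 'b. \<forall>x\<in>S. g x = h x \<Longrightarrow> Ck_on k S g \<Longrightarrow> Ck_on k S h"
  shows "Ck_on (Suc k) S f"
proof -
  have "frechet_derivative f (at x) = f' x" if "x \<in> S" for x
    using assms(2)[OF that] frechet_derivative_at by metis
  then have "Ck_on k S (\<lambda>x. frechet_derivative f (at x) v)" for v
    by (intro cong[OF _ assms(3)[of v]]) simp
  then show ?thesis using assms(2) by (auto simp: differentiable_def)
qed

lemma Ck_on_cong:
  assumes "open S" "\<forall>x\<in>S. f x = g x" "Ck_on k S f"
  shows "Ck_on k S g"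
  using assms(2,3)
proof (induction k arbitrary: f g)
  case 0 then show ?case using continuous_on_cong by force
next
  case (Suc k)
  have d: "(g has_derivative frechet_derivative f (at x)) (at x)" if "x \<in> S" for x
  proof (rule has_derivative_transform_within_open[OF _ assms(1) that])
    show "(f has_derivative frechet_derivative f (at x)) (at x)"
      using Suc.prems that by (simp add: frechet_derivative_works[symmetric])
  qed (use Suc.prems in simp)
  show ?case
  proof (rule Ck_on_SucI[OF assms(1) d], assumption)
    show "Ck_on k S (\<lambda>x. frechet_derivative f (at x) v)" for v using Suc.prems(2) by simp
  next
    fix g h :: "'a \<Rightarrow> 'b"
    assume "\<forall>x\<in>S. g x = h x" "Ck_on k S g"
    then show "Ck_on k S h" by (rule Suc.IH)
  qed
qed

lemma Ck_on_Suc_intro: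
  assumes "open S" "\<And>x. x \<in> S \<Longrightarrow> (f has_derivative f' x) (at x)"
    and "\<And>v. Ck_on k S (\<lambda>x. f' x v)"
  shows "Ck_on (Suc k) S f"
  using Ck_on_SucI[OF assms] Ck_on_cong[OF assms(1)] by blast

lemma Ck_on_has_derivative:
  "Ck_on (Suc k) S f \<Longrightarrow> x \<in> S \<Longrightarrow> (f has_derivative frechet_derivative f (at x)) (at x)"
  by (simp add: frechet_derivative_works)

lemma Ck_on_SucD: "Ck_on (Suc k) S f \<Longrightarrow> Ck_on k S f"
proof (induction k arbitrary: f)
  case 0
  then show ?case
    by (simp add: continuous_at_imp_continuous_on differentiable_imp_continuous_within)
next
  case (Suc k)
  have "Ck_on k S (\<lambda>x. frechet_derivative f (at x) v)" for v
    using Suc.prems unfolding Ck_on.simps(2)[of "Suc k"] by (blast intro: Suc.IH)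
  then show ?case using Suc.prems by simp
qed

lemma Ck_on_local:
  assumes "\<And>x. x \<in> S \<Longrightarrow> \<exists>U. open U \<and> x \<in> U \<and> Ck_on k U f"
  shows "Ck_on k S f"
  using assms
proof (induction k arbitrary: f)
  case 0
  show ?case
    unfolding Ck_on.simps
  proof (rule continuous_at_imp_continuous_on, rule ballI)
    fix x assume "x \<in> S"
    from 0[OF this] obtain U where "open U" "x \<in> U" "continuous_on U f" by auto
    then show "isCont f x" using continuous_on_eq_continuous_at by blast
  qed
next
  case (Suc k)
  show ?case
    unfolding Ck_on.simps
  proof (intro conjI ballI allI)
    show "f differentiable at x" if "x \<in> S" for x
      using Suc.prems[OF that] by auto
    show "Ck_on k S (\<lambda>x. frechet_derivative f (at x) v)" for v
    proof (rule Suc.IH)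
      fix x assume "x \<in> S"
      from Suc.prems[OF this] obtain U where "open U" "x \<in> U" "Ck_on (Suc k) U f" by auto
      then show "\<exists>U. open U \<and> x \<in> U \<and> Ck_on k U (\<lambda>x. frechet_derivative f (at x) v)"
        unfolding Ck_on.simps by blast
    qed
  qed
qed

lemma Ck_on_const: "Ck_on k S (\<lambda>x. c)"
  by (induction k arbitrary: c) (auto simp: frechet_derivative_const)

lemma Ck_on_linear: "bounded_linear L \<Longrightarrow> Ck_on k S L"
proof (cases k)
  case 0 assume "bounded_linear L" then show ?thesis using 0 
    by (simp add: linear_continuous_on)
next
  case (Suc j)
  assume L: "bounded_linear L"
  then have "frechet_derivative L (at x) = L" for x
    using bounded_linear_imp_has_derivative frechet_derivative_at by metis
  then show ?thesis using Suc L
    by (simp add: Ck_on_const bounded_linear_imp_differentiable)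
qed

lemma Ck_on_add:
  assumes "open S" "Ck_on k S f" "Ck_on k S g"
  shows "Ck_on k S (\<lambda>x. f x + g x)"
  using assms(2,3)
proof (induction k arbitrary: f g)
  case 0 then show ?case by (simp add: continuous_on_add)
next
  case (Suc k)
  have d: "((\<lambda>x. f x + g x) has_derivative
      (\<lambda>v. frechet_derivative f (at x) v + frechet_derivative g (at x) v)) (at x)" if "x \<in> S" for x
    by (rule has_derivative_add[OF Ck_on_has_derivative[OF Suc.prems(1) that]
        Ck_on_has_derivative[OF Suc.prems(2) that]])
  have f: "Ck_on k S (\<lambda>x. frechet_derivative f (at x) v)" for v
    using Suc.prems unfolding Ck_on.simps by blast
  have g: "Ck_on k S (\<lambda>x. frechet_derivative g (at x) v)" for v
    using Suc.prems unfolding Ck_on.simps by blast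
  show ?case
    by (rule Ck_on_Suc_intro[OF assms(1) d Suc.IH[OF f g]])
qed

lemma Ck_on_sum:
  assumes "open S" "\<And>i. i \<in> I \<Longrightarrow> Ck_on k S (f i)"
  shows "Ck_on k S (\<lambda>x. \<Sum>i\<in>I. f i x)"
  using assms(2)
proof (induction I rule: infinite_finite_induct)
  case (insert i I)
  then have "Ck_on k S (\<lambda>x. f i x + (\<Sum>i\<in>I. f i x))"
    by (intro Ck_on_add[OF assms(1)]) simp_all
  then show ?case using insert by simp
qed (simp_all add: Ck_on_const)

lemma Ck_on_bilinear:
  assumes "open S" "bounded_bilinear b" "Ck_on k S f" "Ck_on k S g"
  shows "Ck_on k S (\<lambda>x. b (f x) (g x))"
  using assms(3,4)
proof (induction k arbitrary: f g)
  case 0 then show ?case using bounded_bilinear.continuous_on[OF assms(2)] by fastforce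
next
  case (Suc k)
  have d: "((\<lambda>x. b (f x) (g x)) has_derivative
      (\<lambda>v. b (f x) (frechet_derivative g (at x) v) + b (frechet_derivative f (at x) v) (g x))) (at x)"
    if "x \<in> S" for x
    by (rule bounded_bilinear.FDERIV[OF assms(2) Ck_on_has_derivative[OF Suc.prems(1) that]
        Ck_on_has_derivative[OF Suc.prems(2) that]])
  have f: "Ck_on k S (\<lambda>x. frechet_derivative f (at x) v)" for v
    using Suc.prems unfolding Ck_on.simps by blast
  have g: "Ck_on k S (\<lambda>x. frechet_derivative g (at x) v)" for v
    using Suc.prems unfolding Ck_on.simps by blast
  show ?case
    by (rule Ck_on_Suc_intro[OF assms(1) d Ck_on_add[OF assms(1)
        Suc.IH[OF Ck_on_SucD[OF Suc.prems(1)] g] Suc.IH[OF f Ck_on_SucD[OF Suc.prems(2)]]]])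
qed

lemma Ck_on_linear_compose:
  assumes "open S" "bounded_linear L" "Ck_on k S f"
  shows "Ck_on k S (\<lambda>x. L (f x))"
  using assms(3)
proof (induction k arbitrary: f)
  case 0 then show ?case using bounded_linear.continuous_on[OF assms(2)] by fastforce
next
  case (Suc k)
  have d: "((\<lambda>x. L (f x)) has_derivative (\<lambda>v. L (frechet_derivative f (at x) v))) (at x)" if "x \<in> S" for x
    by (rule bounded_linear.has_derivative[OF assms(2) Ck_on_has_derivative[OF Suc.prems that]])
  have D: "Ck_on k S (\<lambda>x. frechet_derivative f (at x) v)" for v
    using Suc.prems unfolding Ck_on.simps by blast
  show ?case
    by (rule Ck_on_Suc_intro[OF assms(1) d Suc.IH[OF D]])
qed

lemma linear_expand_Basis:
  fixes L :: "'a::euclidean_space \<Rightarrow> 'b::real_vector"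
  assumes "linear L"
  shows "L v = (\<Sum>b\<in>Basis. (v \<bullet> b) *\<^sub>R L b)"
proof -
  have "L v = L (\<Sum>b\<in>Basis. (v \<bullet> b) *\<^sub>R b)" by (simp add: euclidean_representation)
  then show ?thesis by (simp add: assms linear_sum linear_scale)
qed

text \<open>Expanded in a basis, the derivative of the composition is a sum of products of a
derivative of \<open>g\<close> with a derivative of \<open>f\<close> composed with \<open>g\<close>, and the induction hypothesis applies
to each factor.\<close>

lemma Ck_on_compose:
  fixes f :: "'b::euclidean_space \<Rightarrow> 'c::real_normed_vector" and g :: "'a::real_normed_vector \<Rightarrow> 'b"
  assumes "open S" "open T" "g ` S \<subseteq> T" "Ck_on k T f" "Ck_on k S g"
  shows "Ck_on k S (\<lambda>x. f (g x))"
  using assms(4,5)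
proof (induction k arbitrary: f)
  case 0 then show ?case using continuous_on_compose2 assms(3) by (metis Ck_on.simps(1))
next
  case (Suc k)
  have fd: "(f has_derivative frechet_derivative f (at (g x))) (at (g x))" if "x \<in> S" for x
    using Ck_on_has_derivative[OF Suc.prems(1)] that assms(3) by blast
  have d: "((\<lambda>x. f (g x)) has_derivative
      (\<lambda>v. \<Sum>b\<in>Basis. (frechet_derivative g (at x) v \<bullet> b) *\<^sub>R frechet_derivative f (at (g x)) b)) (at x)"
    if "x \<in> S" for x
    using has_derivative_compose[OF Ck_on_has_derivative[OF Suc.prems(2) that] fd[OF that]]
    by (subst (asm) linear_expand_Basis[OF has_derivative_linear[OF fd[OF that]]])
  show ?case
  proof (rule Ck_on_Suc_intro[OF assms(1) d], assumption)
    fix v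
    show "Ck_on k S (\<lambda>x. \<Sum>b\<in>Basis. (frechet_derivative g (at x) v \<bullet> b) *\<^sub>R frechet_derivative f (at (g x)) b)"
    proof (intro Ck_on_sum[OF assms(1)] Ck_on_bilinear[OF assms(1) bounded_bilinear_scaleR])
      fix b :: 'b assume "b \<in> Basis"
      show "Ck_on k S (\<lambda>x. frechet_derivative g (at x) v \<bullet> b)"
        by (rule Ck_on_linear_compose[OF assms(1) bounded_linear_inner_left]) (use Suc.prems in auto)
      show "Ck_on k S (\<lambda>x. frechet_derivative f (at (g x)) b)"
        by (rule Suc.IH) (use Suc.prems Ck_on_SucD[OF Suc.prems(2)] in auto)
    qed
  qed
qed

text \<open>A product rule with one factor only continuous: its increment is multiplied by \<open>g\<close>,
which vanishes at \<open>x\<close>, and so it contributes nothing to first order.\<close>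

lemma has_derivative_scaleR_vanishing:
  fixes g :: "'a::real_normed_vector \<Rightarrow> real" and h :: "'a \<Rightarrow> 'b::real_normed_vector"
  assumes g: "(g has_derivative g') (at x)" "g x = 0" and h: "isCont h x"
  shows "((\<lambda>y. g y *\<^sub>R h y) has_derivative (\<lambda>v. g' v *\<^sub>R h x)) (at x)"
proof -
  obtain K where K: "\<And>v. norm (g' v) \<le> norm v * K"
    using g(1) has_derivative_bounded_linear bounded_linear.bounded by blast
  define q where "q = (\<lambda>y. norm (g y - g x - g' (y - x)) / norm (y - x))"
  have q: "(q \<longlongrightarrow> 0) (at x)"
    using g(1) unfolding has_derivative_iff_norm q_def by blast
  have hl: "((\<lambda>y. norm (h y - h x)) \<longlongrightarrow> 0) (at x)"
    using h by (simp add: isCont_def LIM_zero tendsto_norm_zero)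
  have "((\<lambda>y. (q y + K) * norm (h y - h x)) \<longlongrightarrow> (0 + K) * 0) (at x)"
    by (intro tendsto_intros q hl)
  then have lim: "((\<lambda>y. (q y + K) * norm (h y - h x)) \<longlongrightarrow> 0) (at x)" by simp
  have "((\<lambda>y. g y *\<^sub>R (h y - h x)) has_derivative (\<lambda>v. 0)) (at x)"
    unfolding has_derivative_iff_norm
  proof (intro conjI bounded_linear_zero)
    show "((\<lambda>y. norm (g y *\<^sub>R (h y - h x) - g x *\<^sub>R (h x - h x) - 0) / norm (y - x)) \<longlongrightarrow> 0) (at x)"
    proof (rule tendsto_sandwich[OF _ _ tendsto_const lim])
      show "\<forall>\<^sub>F y in at x. 0 \<le> norm (g y *\<^sub>R (h y - h x) - g x *\<^sub>R (h x - h x) - 0) / norm (y - x)" by simp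
      show "\<forall>\<^sub>F y in at x. norm (g y *\<^sub>R (h y - h x) - g x *\<^sub>R (h x - h x) - 0) / norm (y - x)
          \<le> (q y + K) * norm (h y - h x)"
      proof (rule eventually_at_topological[THEN iffD2], intro exI[of _ UNIV] conjI ballI impI)
        fix y assume "y \<noteq> x"
        then have n: "norm (y - x) > 0" by simp
        have "norm (g y) \<le> norm (g y - g x - g' (y - x)) + norm (g' (y - x))"
          using norm_triangle_ineq[of "g y - g x - g' (y - x)" "g' (y - x)"] g(2) by simp
        also have "\<dots> \<le> (q y + K) * norm (y - x)"
          using K[of "y - x"] n by (simp add: q_def field_simps)
        finally have "norm (g y) / norm (y - x) \<le> q y + K" using n by (simp add: divide_le_eq)
        from mult_right_mono[OF this, of "norm (h y - h x)"]
        show "norm (g y *\<^sub>R (h y - h x) - g x *\<^sub>R (h x - h x) - 0) / norm (y - x) \<le> (q y + K) * norm (h y - h x)"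
          by simp
      qed auto
    qed
  qed
  from has_derivative_add[OF this has_derivative_scaleR_left[OF g(1), of "h x"]]
  show ?thesis by (simp add: algebra_simps)
qed

text \<open>From \<open>L y - L x = - L y (B y - B x) L x\<close> the derivative of \<open>L = B\<^sup>-\<^sup>1\<close> is \<open>- L B' L\<close>. It contains
\<open>L\<close> without derivatives, so one order of smoothness is gained at a time, starting from continuity.\<close>

lemma Ck_on_inverse_linear:
  fixes B L :: "'a::real_normed_vector \<Rightarrow> 'b::euclidean_space \<Rightarrow> 'b"
  assumes "open S" and BL: "\<And>x. x \<in> S \<Longrightarrow> linear (B x)" "\<And>x. x \<in> S \<Longrightarrow> linear (L x)"
    and inv: "\<And>x w. x \<in> S \<Longrightarrow> B x (L x w) = w" "\<And>x w. x \<in> S \<Longrightarrow> L x (B x w) = w"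
    and B: "\<And>w. Ck_on k S (\<lambda>x. B x w)"
    and cont: "\<And>w. continuous_on S (\<lambda>x. L x w)"
  shows "Ck_on k S (\<lambda>x. L x w)"
  using B
proof (induction k arbitrary: w)
  case 0 then show ?case using cont by simp
next
  case (Suc k)
  let ?D = "\<lambda>x v w. frechet_derivative (\<lambda>x. B x w) (at x) v"
  have Bexp: "B x w = (\<Sum>b\<in>Basis. (w \<bullet> b) *\<^sub>R B x b)" if "x \<in> S" for x w
    using linear_expand_Basis[OF BL(1)[OF that]] .
  have d: "((\<lambda>x. L x w) has_derivative (\<lambda>v. - (\<Sum>b\<in>Basis. (L x w \<bullet> b) *\<^sub>R
      (\<Sum>c\<in>Basis. (?D x v b \<bullet> c) *\<^sub>R L x c)))) (at x)" if x: "x \<in> S" for x w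
  proof -
    define E where "E = (\<lambda>y. B y (L x w))"
    have "((\<lambda>y. \<Sum>b\<in>Basis. (L x w \<bullet> b) *\<^sub>R B y b) has_derivative
        (\<lambda>v. \<Sum>b\<in>Basis. (L x w \<bullet> b) *\<^sub>R ?D x v b)) (at x)"
      by (intro has_derivative_sum has_derivative_scaleR_right Ck_on_has_derivative[OF Suc.prems x])
    then have E: "(E has_derivative (\<lambda>v. \<Sum>b\<in>Basis. (L x w \<bullet> b) *\<^sub>R ?D x v b)) (at x)"
      by (rule has_derivative_transform_within_open[OF _ assms(1) x]) (simp add: E_def Bexp[symmetric])
    have "((\<lambda>y. \<Sum>c\<in>Basis. ((E y - E x) \<bullet> c) *\<^sub>R L y c) has_derivative
       (\<lambda>v. \<Sum>c\<in>Basis. ((\<Sum>b\<in>Basis. (L x w \<bullet> b) *\<^sub>R ?D x v b) \<bullet> c) *\<^sub>R L x c)) (at x)"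
    proof (intro has_derivative_sum has_derivative_scaleR_vanishing)
      fix c :: 'b
      show "isCont (\<lambda>y. L y c) x" using cont assms(1) x continuous_on_eq_continuous_at by blast
      show "((\<lambda>y. (E y - E x) \<bullet> c) has_derivative (\<lambda>v. (\<Sum>b\<in>Basis. (L x w \<bullet> b) *\<^sub>R ?D x v b) \<bullet> c)) (at x)"
        using has_derivative_inner_left[OF has_derivative_diff[OF E has_derivative_const[of "E x"]], of c]
        by simp
    qed simp
    then have "((\<lambda>y. L x w - (\<Sum>c\<in>Basis. ((E y - E x) \<bullet> c) *\<^sub>R L y c)) has_derivative
       (\<lambda>v. 0 - (\<Sum>c\<in>Basis. ((\<Sum>b\<in>Basis. (L x w \<bullet> b) *\<^sub>R ?D x v b) \<bullet> c) *\<^sub>R L x c))) (at x)"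
      by (intro has_derivative_diff has_derivative_const)
    then have "((\<lambda>y. L y w) has_derivative
       (\<lambda>v. 0 - (\<Sum>c\<in>Basis. ((\<Sum>b\<in>Basis. (L x w \<bullet> b) *\<^sub>R ?D x v b) \<bullet> c) *\<^sub>R L x c))) (at x)"
    proof (rule has_derivative_transform_within_open[OF _ assms(1) x])
      fix y assume y: "y \<in> S"
      have "(\<Sum>c\<in>Basis. ((E y - E x) \<bullet> c) *\<^sub>R L y c) = L y (E y - E x)"
        using linear_expand_Basis[OF BL(2)[OF y], of "E y - E x"] by simp
      also have "\<dots> = L x w - L y w"
        using inv x y by (simp add: E_def linear_diff[OF BL(2)[OF y]])
      finally show "L x w - (\<Sum>c\<in>Basis. ((E y - E x) \<bullet> c) *\<^sub>R L y c) = L y w" by simp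
    qed
    moreover have "(\<Sum>c\<in>Basis. ((\<Sum>b\<in>Basis. (L x w \<bullet> b) *\<^sub>R ?D x v b) \<bullet> c) *\<^sub>R L x c)
       = (\<Sum>b\<in>Basis. (L x w \<bullet> b) *\<^sub>R (\<Sum>c\<in>Basis. (?D x v b \<bullet> c) *\<^sub>R L x c))" for v
      unfolding inner_sum_left scaleR_sum_left scaleR_sum_right inner_scaleR_left scaleR_scaleR
      by (rule sum.swap)
    ultimately show ?thesis by simp
  qed
  show ?case
  proof (rule Ck_on_Suc_intro[OF assms(1) d], assumption)
    fix v
    have L: "Ck_on k S (\<lambda>x. L x w)" for w by (rule Suc.IH) (use Suc.prems Ck_on_SucD in blast)
    show "Ck_on k S (\<lambda>x. - (\<Sum>b\<in>Basis. (L x w \<bullet> b) *\<^sub>R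
      (\<Sum>c\<in>Basis. (?D x v b \<bullet> c) *\<^sub>R L x c)))"
      by (intro Ck_on_linear_compose[OF assms(1) bounded_linear_minus[OF bounded_linear_ident]]
         Ck_on_linear_compose[OF assms(1) bounded_linear_inner_left]
         Ck_on_sum[OF assms(1)] Ck_on_bilinear[OF assms(1) bounded_bilinear_scaleR] L)
        (use Suc.prems in auto)
  qed
qed

section \<open>Mixed derivatives and smooth inverses\<close>

text \<open>The second difference over the parallelogram spanned by \<open>t a\<close> and \<open>t b\<close> is symmetric in
\<open>a\<close> and \<open>b\<close>. Expressing it by either mixed derivative at a nearby point is the classical proof that
mixed derivatives agree.\<close>

lemma mixed_difference_mean_value:
  fixes f :: "'a::real_normed_vector \<Rightarrow> real"
  assumes S: "ball x e \<subseteq> S" and t: "t > 0" "t * (norm a + norm b) < e"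
    and f: "\<And>y. y \<in> S \<Longrightarrow> (f has_derivative f' y) (at y)"
    and fa: "\<And>y. y \<in> S \<Longrightarrow> ((\<lambda>y. f' y a) has_derivative fa y) (at y)"
  shows "\<exists>y. dist y x \<le> t * (norm a + norm b) \<and>
    f (x + t *\<^sub>R a + t *\<^sub>R b) - f (x + t *\<^sub>R a) - f (x + t *\<^sub>R b) + f x = t\<^sup>2 * fa y b"
proof -
  have near: "dist (x + s *\<^sub>R a + r *\<^sub>R b) x \<le> t * (norm a + norm b)"
    if "0 \<le> s" "s \<le> t" "0 \<le> r" "r \<le> t" for s r
  proof -
    have "dist (x + s *\<^sub>R a + r *\<^sub>R b) x = norm (s *\<^sub>R a + r *\<^sub>R b)" by (simp add: dist_norm)
    also have "\<dots> \<le> s * norm a + r * norm b"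
      using norm_triangle_ineq[of "s *\<^sub>R a" "r *\<^sub>R b"] that by simp
    also have "\<dots> \<le> t * norm a + t * norm b"
      using that by (intro add_mono mult_right_mono) auto
    finally show ?thesis by (simp add: algebra_simps)
  qed
  then have inS: "x + s *\<^sub>R a + r *\<^sub>R b \<in> S" if "0 \<le> s" "s \<le> t" "0 \<le> r" "r \<le> t" for s r
    using S t(2) that by (force simp: dist_commute subset_iff)
  define F where "F s = f (x + s *\<^sub>R a + t *\<^sub>R b) - f (x + s *\<^sub>R a + 0 *\<^sub>R b)" for s
  have dF: "(F has_derivative (\<lambda>h. h * (f' (x + s *\<^sub>R a + t *\<^sub>R b) a - f' (x + s *\<^sub>R a + 0 *\<^sub>R b) a))) (at s within {0..t})"
    if "0 \<le> s" "s \<le> t" for s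
  proof -
    have d: "((\<lambda>s. f (x + s *\<^sub>R a + r *\<^sub>R b)) has_derivative (\<lambda>h. f' (x + s *\<^sub>R a + r *\<^sub>R b) (h *\<^sub>R a))) (at s)"
      if "0 \<le> r" "r \<le> t" for r
    proof -
      have "((\<lambda>s. x + s *\<^sub>R a + r *\<^sub>R b) has_derivative (\<lambda>h. h *\<^sub>R a)) (at s)"
        by (auto intro!: derivative_eq_intros)
      moreover have "x + s *\<^sub>R a + r *\<^sub>R b \<in> S" using that \<open>0 \<le> s\<close> \<open>s \<le> t\<close> by (intro inS) auto
      ultimately show ?thesis by (metis (no_types) f has_derivative_compose)
    qed
    have lin: "f' (x + s *\<^sub>R a + r *\<^sub>R b) (h *\<^sub>R a) = h * f' (x + s *\<^sub>R a + r *\<^sub>R b) a" if "0 \<le> r" "r \<le> t" for r h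
      using linear_scale[OF has_derivative_linear[OF f[OF inS]]] that \<open>0 \<le> s\<close> \<open>s \<le> t\<close> by simp
    show ?thesis unfolding F_def
      using has_derivative_at_withinI[OF has_derivative_diff[OF d[of t] d[of 0]], of "{0..t}"] t(1) lin[of t] lin[of 0]
      by (simp add: algebra_simps)
  qed
  obtain s where s: "0 < s" "s < t"
      "F t - F 0 = t * (f' (x + s *\<^sub>R a + t *\<^sub>R b) a - f' (x + s *\<^sub>R a + 0 *\<^sub>R b) a)"
    using mvt_simple[OF t(1) dF] by auto
  have "((\<lambda>r. f' (x + s *\<^sub>R a + r *\<^sub>R b) a) has_derivative (\<lambda>h. h * fa (x + s *\<^sub>R a + r *\<^sub>R b) b)) (at r within {0..t})"
    if r: "0 \<le> r" "r \<le> t" for r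
  proof -
    have y: "x + s *\<^sub>R a + r *\<^sub>R b \<in> S" using inS r s by auto
    have "((\<lambda>r. x + s *\<^sub>R a + r *\<^sub>R b) has_derivative (\<lambda>h. h *\<^sub>R b)) (at r)"
        by (auto intro!: derivative_eq_intros)
    from has_derivative_at_withinI[OF has_derivative_compose[OF this fa[OF y]], of "{0..t}"]
    show ?thesis using linear_scale[OF has_derivative_linear[OF fa[OF y]]] by simp
  qed
  from mvt_simple[OF t(1) this] obtain r where r: "0 < r" "r < t"
      "f' (x + s *\<^sub>R a + t *\<^sub>R b) a - f' (x + s *\<^sub>R a + 0 *\<^sub>R b) a = t * fa (x + s *\<^sub>R a + r *\<^sub>R b) b"
    by auto
  show ?thesis
  proof (intro exI conjI)
    show "dist (x + s *\<^sub>R a + r *\<^sub>R b) x \<le> t * (norm a + norm b)" using near r s by auto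
    show "f (x + t *\<^sub>R a + t *\<^sub>R b) - f (x + t *\<^sub>R a) - f (x + t *\<^sub>R b) + f x = t\<^sup>2 * fa (x + s *\<^sub>R a + r *\<^sub>R b) b"
      using s(3) r(3) by (simp add: F_def power2_eq_square)
  qed
qed

lemma mixed_derivatives_commute_real:
  fixes f :: "'a::real_normed_vector \<Rightarrow> real"
  assumes S: "open S" "x \<in> S"
    and f: "\<And>y. y \<in> S \<Longrightarrow> (f has_derivative f' y) (at y)"
    and fa: "\<And>y. y \<in> S \<Longrightarrow> ((\<lambda>y. f' y a) has_derivative fa y) (at y)"
    and fb: "\<And>y. y \<in> S \<Longrightarrow> ((\<lambda>y. f' y b) has_derivative fb y) (at y)"
    and cont: "isCont (\<lambda>y. fa y b) x" "isCont (\<lambda>y. fb y a) x"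
  shows "fa x b = fb x a"
proof (rule ccontr)
  assume ne: "fa x b \<noteq> fb x a"
  define d where "d = \<bar>fa x b - fb x a\<bar> / 2"
  have d: "d > 0" using ne by (simp add: d_def)
  obtain e where e: "e > 0" "ball x e \<subseteq> S" using S openE by blast
  obtain d1 where d1: "d1 > 0" "\<And>y. dist y x < d1 \<Longrightarrow> dist (fa y b) (fa x b) < d"
    using cont(1) d unfolding continuous_at_eps_delta by blast
  obtain d2 where d2: "d2 > 0" "\<And>y. dist y x < d2 \<Longrightarrow> dist (fb y a) (fb x a) < d"
    using cont(2) d unfolding continuous_at_eps_delta by blast
  define m where "m = min e (min d1 d2)"
  define t where "t = m / (2 * (norm a + norm b + 1))"
  have m: "m > 0" "m \<le> e" "m \<le> d1" "m \<le> d2" using e d1 d2 by (auto simp: m_def)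
  have n: "norm a + norm b + 1 > 0" by (simp add: add_nonneg_pos)
  have t: "t > 0" using m n by (simp add: t_def)
  have "t * (norm a + norm b) \<le> t * (norm a + norm b + 1)" using t by simp
  also have "\<dots> = m / 2" using n by (simp add: t_def field_simps)
  finally have tm: "t * (norm a + norm b) < m" using m by simp
  obtain y1 where y1: "dist y1 x \<le> t * (norm a + norm b)"
      "f (x + t *\<^sub>R a + t *\<^sub>R b) - f (x + t *\<^sub>R a) - f (x + t *\<^sub>R b) + f x = t\<^sup>2 * fa y1 b"
    using mixed_difference_mean_value[OF e(2) t _ f fa, of b] tm m by fastforce
  obtain y2 where y2: "dist y2 x \<le> t * (norm b + norm a)"
      "f (x + t *\<^sub>R b + t *\<^sub>R a) - f (x + t *\<^sub>R b) - f (x + t *\<^sub>R a) + f x = t\<^sup>2 * fb y2 a"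
    using mixed_difference_mean_value[OF e(2) t _ f fb, of a] tm m by (fastforce simp: add.commute)
  have "f (x + t *\<^sub>R b + t *\<^sub>R a) = f (x + t *\<^sub>R a + t *\<^sub>R b)" by (simp add: add_ac)
  then have "t\<^sup>2 * fa y1 b = t\<^sup>2 * fb y2 a" unfolding y1(2)[symmetric] y2(2)[symmetric] by simp
  then have eq: "fa y1 b = fb y2 a" using t by simp
  have "dist (fa y1 b) (fa x b) < d" by (rule d1(2)) (use y1 tm m in linarith)
  moreover have "dist (fb y2 a) (fb x a) < d" by (rule d2(2)) (use y2 tm m in \<open>simp add: add.commute\<close>)
  ultimately show False using eq by (simp add: d_def dist_real_def abs_if split: if_splits)
qed

lemma mixed_derivatives_commute:
  fixes f :: "'a::real_normed_vector \<Rightarrow> 'b::euclidean_space"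
  assumes S: "open S" "x \<in> S"
    and f: "\<And>y. y \<in> S \<Longrightarrow> (f has_derivative f' y) (at y)"
    and fa: "\<And>y. y \<in> S \<Longrightarrow> ((\<lambda>y. f' y a) has_derivative fa y) (at y)"
    and fb: "\<And>y. y \<in> S \<Longrightarrow> ((\<lambda>y. f' y b) has_derivative fb y) (at y)"
    and cont: "isCont (\<lambda>y. fa y b) x" "isCont (\<lambda>y. fb y a) x"
  shows "fa x b = fb x a"
proof (rule euclidean_eqI)
  fix i :: 'b
  show "fa x b \<bullet> i = fb x a \<bullet> i"
    by (rule mixed_derivatives_commute_real[OF S has_derivative_inner_left[OF f]
          has_derivative_inner_left[OF fa] has_derivative_inner_left[OF fb]])
       (use cont in \<open>auto intro!: continuous_intros\<close>)
qed

lemma Ck_on_second_derivative_commute: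
  fixes f :: "'a::real_normed_vector \<Rightarrow> 'b::euclidean_space"
  assumes "open S" "x \<in> S" "Ck_on (Suc (Suc 0)) S f"
  shows "frechet_derivative (\<lambda>y. frechet_derivative f (at y) a) (at x) b
       = frechet_derivative (\<lambda>y. frechet_derivative f (at y) b) (at x) a"
proof -
  have D: "Ck_on (Suc 0) S (\<lambda>y. frechet_derivative f (at y) v)" for v
    using assms(3) by simp
  have F: "(f has_derivative frechet_derivative f (at y)) (at y)" if "y \<in> S" for y
    by (rule Ck_on_has_derivative[OF assms(3) that])
  have FD: "((\<lambda>y. frechet_derivative f (at y) v) has_derivative
     frechet_derivative (\<lambda>y. frechet_derivative f (at y) v) (at y)) (at y)" if "y \<in> S" for y v
    by (rule Ck_on_has_derivative[OF D that])
  have C: "isCont (\<lambda>y. frechet_derivative (\<lambda>y. frechet_derivative f (at y) v) (at y) w) x" for v w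
  proof -
    have "continuous_on S (\<lambda>y. frechet_derivative (\<lambda>y. frechet_derivative f (at y) v) (at y) w)"
      using D[of v] by simp
    then show ?thesis using assms(1,2) continuous_on_eq_continuous_at by blast
  qed
  show ?thesis by (rule mixed_derivatives_commute[OF assms(1,2) F FD FD C C])
qed

text \<open>If \<open>m\<close> bounds the norm of \<open>L x\<close>, then \<open>L y\<close> has norm at most \<open>2 m\<close> as soon as \<open>B y\<close> and \<open>B x\<close> differ
by less than \<open>1 / (2 m)\<close>; with this bound, continuity of \<open>B\<close> passes to \<open>L\<close>.\<close>

lemma continuous_inverse_linear:
  fixes B L :: "'a::topological_space \<Rightarrow> 'b::euclidean_space \<Rightarrow> 'b"
  assumes BL: "\<And>x. x \<in> S \<Longrightarrow> linear (B x)" "\<And>x. x \<in> S \<Longrightarrow> linear (L x)"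
    and inv: "\<And>x w. x \<in> S \<Longrightarrow> B x (L x w) = w" "\<And>x w. x \<in> S \<Longrightarrow> L x (B x w) = w"
    and B: "\<And>w. continuous_on S (\<lambda>x. B x w)"
  shows "continuous_on S (\<lambda>x. L x w)"
  unfolding continuous_on_def
proof
  fix x assume x: "x \<in> S"
  obtain m where m: "m > 0" "\<And>v. norm (L x v) \<le> m * norm v"
    using linear_bounded_pos[OF BL(2)[OF x]] by blast
  define \<delta> where "\<delta> y = (\<Sum>b\<in>Basis. norm (B y b - B x b))" for y
  have Bt: "((\<lambda>y. B y w) \<longlongrightarrow> B x w) (at x within S)" for w
    using B x by (simp add: continuous_on_def)
  have "(\<delta> \<longlongrightarrow> (\<Sum>b\<in>Basis. norm (B x b - B x b))) (at x within S)"
    unfolding \<delta>_def by (intro tendsto_intros Bt)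
  then have "(\<delta> \<longlongrightarrow> 0) (at x within S)" by simp
  then have small: "\<forall>\<^sub>F y in at x within S. \<delta> y < 1 / (2 * m)"
    using m(1) by (simp add: order_tendstoD(2))
  have inS: "\<forall>\<^sub>F y in at x within S. y \<in> S" by (simp add: eventually_at_filter)
  have lin: "norm (B y v - B x v) \<le> \<delta> y * norm v" if y: "y \<in> S" for y v
  proof -
    have "B y v - B x v = (\<Sum>b\<in>Basis. (v \<bullet> b) *\<^sub>R (B y b - B x b))"
      using linear_expand_Basis[OF BL(1)[OF y], of v] linear_expand_Basis[OF BL(1)[OF x], of v]
      by (simp add: sum_subtractf scaleR_diff_right)
    also have "norm \<dots> \<le> (\<Sum>b\<in>Basis. norm v * norm (B y b - B x b))"
      by (rule order_trans[OF norm_sum]) (auto intro!: sum_mono mult_right_mono Basis_le_norm)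
    also have "\<dots> = \<delta> y * norm v" by (simp add: \<delta>_def sum_distrib_left[symmetric] mult.commute)
    finally show ?thesis .
  qed
  have "((\<lambda>y. 2 * m * norm (B y (L x w) - B x (L x w))) \<longlongrightarrow> 2 * m * norm (B x (L x w) - B x (L x w))) (at x within S)"
    by (intro tendsto_intros Bt)
  then have lim: "((\<lambda>y. 2 * m * norm (B y (L x w) - B x (L x w))) \<longlongrightarrow> 0) (at x within S)" by simp
  have "\<forall>\<^sub>F y in at x within S. norm (L y w - L x w) \<le> 2 * m * norm (B y (L x w) - B x (L x w))"
    using small inS
  proof (eventually_elim)
    case (elim y)
    then have y: "y \<in> S" by simp
    define u where "u = L y w - L x w"
    have Bu: "B y u = - (B y (L x w) - B x (L x w))"
      using inv x y by (simp add: u_def linear_diff[OF BL(1)[OF y]])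
    have "norm u = norm (L x (B x u))" using inv x by simp
    also have "\<dots> \<le> m * norm (B x u)" by (rule m(2))
    also have "norm (B x u) \<le> norm (B y u) + norm (B y u - B x u)"
      using norm_triangle_ineq4[of "B y u" "B y u - B x u"] by simp
    also have "\<dots> \<le> norm (B y u) + (1 / (2 * m)) * norm u"
      by (intro add_left_mono order_trans[OF lin[OF y] mult_right_mono]) (use elim in auto)
    finally have "norm u \<le> m * norm (B y u) + norm u / 2" using m(1) by (simp add: distrib_left)
    then show ?case using Bu by (simp add: u_def norm_minus_commute)
  qed
  then have "((\<lambda>y. L y w - L x w) \<longlongrightarrow> 0) (at x within S)"
    by (rule Lim_null_comparison[OF _ lim])
  then show "((\<lambda>y. L y w) \<longlongrightarrow> L x w) (at x within S)" by (simp add: LIM_zero_cancel)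
qed

text \<open>The inverse function theorem for continuously differentiable maps gives a local inverse
\<open>h\<close> whose derivative at \<open>y\<close> is inverse to the derivative of \<open>g\<close> at \<open>h y\<close>. If \<open>h\<close> is of class \<open>C^k\<close>, so is
this inverse linear map, and \<open>h\<close> is of class \<open>C^(k+1)\<close>.\<close>

lemma smooth_local_inverse:
  fixes g :: "'a::euclidean_space \<Rightarrow> 'a"
  assumes U: "open U" "x0 \<in> U" and g: "smooth_on U g" and inj: "inj (frechet_derivative g (at x0))"
  obtains U' V h where "open U'" "U' \<subseteq> U" "x0 \<in> U'" "open V" "homeomorphism U' V g h" "smooth_on V h"
proof -
  let ?D = "\<lambda>x. frechet_derivative g (at x)"
  have gk: "Ck_on k U g" for k using g by (simp add: smooth_on_def)
  have Dg: "(g has_derivative ?D x) (at x)" if "x \<in> U" for x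
    by (rule Ck_on_has_derivative[OF gk that])
  have Dk: "Ck_on k U (\<lambda>x. ?D x v)" for k v using gk[of "Suc k"] by simp
  define f' where "f' x = Blinfun (?D x)" for x
  have f'[simp]: "blinfun_apply (f' x) = ?D x" if "x \<in> U" for x
    unfolding f'_def using Dg[OF that] by (simp add: bounded_linear_Blinfun_apply has_derivative_bounded_linear)
  have derf: "(g has_derivative blinfun_apply (f' x)) (at x)" if "x \<in> U" for x
    using Dg[OF that] that by simp
  have contf: "continuous_on U f'"
  proof (rule continuous_on_blinfun_componentwise)
    fix i :: 'a assume "i \<in> Basis"
    have "continuous_on U (\<lambda>x. ?D x i)" using Dk[of 0 i] by simp
    then show "continuous_on U (\<lambda>x. blinfun_apply (f' x) i)"
      by (rule continuous_on_eq) (simp add: f')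
  qed
  have lin0: "linear (?D x0)" using Dg[OF U(2)] has_derivative_linear by blast
  obtain k0 where k0: "linear k0" "k0 \<circ> ?D x0 = id"
    using linear_injective_left_inverse[OF lin0 inj] by blast
  have invf: "Blinfun k0 o\<^sub>L f' x0 = id_blinfun"
    by (rule blinfun_eqI) (use k0 U in \<open>simp add: bounded_linear_Blinfun_apply linear_conv_bounded_linear[symmetric] fun_eq_iff\<close>)
  show ?thesis
  proof (rule inverse_function_theorem[OF U(1) derf contf U(2) invf])
    fix U' V h h'
    assume h: "open U'" "U' \<subseteq> U" "x0 \<in> U'" "open V" "g x0 \<in> V" "homeomorphism U' V g h"
      "\<And>y. y \<in> V \<Longrightarrow> (h has_derivative (h' y)) (at y)"
      "\<And>y. y \<in> V \<Longrightarrow> h' y = inv (blinfun_apply (f'(h y)))"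
      "\<And>y. y \<in> V \<Longrightarrow> bij (blinfun_apply (f'(h y)))"
    have hU: "h y \<in> U" if "y \<in> V" for y
      using that h(2,6) homeomorphism_image2 by blast
    have bij: "bij (?D (h y))" if "y \<in> V" for y using h(9)[OF that] hU[OF that] by simp
    have h': "h' y = inv (?D (h y))" if "y \<in> V" for y using h(8)[OF that] hU[OF that] by simp
    have linB: "linear (?D (h y))" if "y \<in> V" for y
      using Dg[OF hU[OF that]] has_derivative_linear by blast
    have linL: "linear (h' y)" if "y \<in> V" for y
      using h(7)[OF that] has_derivative_linear by blast
    have i1: "?D (h y) (h' y w) = w" if "y \<in> V" for y w
      using bij[OF that] h'[OF that] by (simp add: bij_is_surj surj_f_inv_f)
    have i2: "h' y (?D (h y) w) = w" if "y \<in> V" for y w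
      using bij[OF that] h'[OF that] by (simp add: bij_is_inj)
    have hc: "continuous_on V h" using h(6) by (simp add: homeomorphism_def)
    have cB: "continuous_on V (\<lambda>y. ?D (h y) w)" for w
      using continuous_on_compose2[OF _ hc, of U "\<lambda>x. ?D x w"] Dk[of 0 w] hU unfolding Ck_on.simps by blast
    have cL: "continuous_on V (\<lambda>y. h' y w)" for w
      by (rule continuous_inverse_linear[OF linB linL i1 i2 cB])
    have "Ck_on k V h" for k
    proof (induction k)
      case 0 then show ?case using hc by simp
    next
      case (Suc k)
      have "Ck_on k V (\<lambda>y. ?D (h y) w)" for w
        by (rule Ck_on_compose[OF h(4) U(1) _ Dk Suc]) (use hU in auto)
      from Ck_on_inverse_linear[OF h(4) linB linL i1 i2 this cL]
      have "Ck_on k V (\<lambda>y. h' y w)" for w .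
      from Ck_on_Suc_intro[OF h(4) h(7) this] show ?case .
    qed
    then have "smooth_on V h" by (simp add: smooth_on_def)
    with h that show ?thesis by blast
  qed
qed

section \<open>Local homeomorphisms of compact spaces\<close>

definition local_homeomorphism_on :: "'a::topological_space set \<Rightarrow> ('a \<Rightarrow> 'b::topological_space) \<Rightarrow> 'b set \<Rightarrow> bool" where
  "local_homeomorphism_on M p S \<longleftrightarrow> (\<forall>x\<in>M. \<exists>U q. x \<in> U \<and> openin (top_of_set M) U \<and>
      openin (top_of_set S) (p ` U) \<and> homeomorphism U (p ` U) p q)"

lemma separating_neighbourhoods:
  fixes F :: "'a::t2_space set"
  assumes "finite F"
  obtains N where "\<And>y. y \<in> F \<Longrightarrow> open (N y) \<and> y \<in> N y"
    "\<And>y y'. y \<in> F \<Longrightarrow> y' \<in> F \<Longrightarrow> y \<noteq> y' \<Longrightarrow> N y \<inter> N y' = {}"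
proof -
  have "\<forall>y y'. \<exists>P. y \<noteq> y' \<longrightarrow> open (fst P) \<and> open (snd P) \<and> y \<in> fst P \<and> y' \<in> snd P \<and> fst P \<inter> snd P = ({} :: 'a set)"
    using hausdorff by (metis fst_conv snd_conv)
  then obtain P where P: "\<And>y y'. y \<noteq> y' \<Longrightarrow> open (fst (P y y')) \<and> open (snd (P y y')) \<and> y \<in> fst (P y y')
      \<and> y' \<in> snd (P y y') \<and> fst (P y y') \<inter> snd (P y y') = ({} :: 'a set)"
    by metis
  define N where "N y = (\<Inter>y'\<in>F - {y}. fst (P y y')) \<inter> (\<Inter>y'\<in>F - {y}. snd (P y' y))" for y
  show ?thesis
  proof
    fix y assume "y \<in> F"
    have "open (fst (P y y'))" "open (snd (P y' y))" "y \<in> fst (P y y')" "y \<in> snd (P y' y)"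
      if "y' \<in> F - {y}" for y'
      using that P[of y y'] P[of y' y] by auto
    then show "open (N y) \<and> y \<in> N y"
      using assms unfolding N_def by (intro conjI open_Int open_INT) auto
  next
    fix y y' assume "y \<in> F" "y' \<in> F" "y \<noteq> y'"
    then have "N y \<subseteq> fst (P y y')" "N y' \<subseteq> snd (P y y')" by (auto simp: N_def)
    then show "N y \<inter> N y' = {}" using P[OF \<open>y \<noteq> y'\<close>] by blast
  qed
qed

text \<open>The fibre over \<open>x\<close> is compact and discrete, so finite, and its points have disjoint
neighbourhoods on which \<open>p\<close> is a homeomorphism. The rest of \<open>M\<close> is compact and its image misses \<open>x\<close>;
removing this image leaves a neighbourhood of \<open>x\<close> that is evenly covered.\<close>

lemma compact_local_homeomorphism_covering:
  fixes M :: "'a::t2_space set" and p :: "'a \<Rightarrow> 'b::t2_space"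
  assumes M: "compact M" and cont: "continuous_on M p" and onto: "p ` M = S"
    and loc: "local_homeomorphism_on M p S"
  shows "covering_space M p S"
proof
  fix x assume x: "x \<in> S"
  define F where "F = M \<inter> p -` {x}"
  have FM: "F \<subseteq> M" by (auto simp: F_def)
  have "\<forall>y\<in>M. \<exists>U q. y \<in> U \<and> openin (top_of_set M) U \<and>
      openin (top_of_set S) (p ` U) \<and> homeomorphism U (p ` U) p q"
    using loc by (simp add: local_homeomorphism_on_def)
  then obtain U q where U: "\<And>y. y \<in> M \<Longrightarrow> y \<in> U y" "\<And>y. y \<in> M \<Longrightarrow> openin (top_of_set M) (U y)"
      "\<And>y. y \<in> M \<Longrightarrow> openin (top_of_set S) (p ` U y)" "\<And>y. y \<in> M \<Longrightarrow> homeomorphism (U y) (p ` U y) p (q y)"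
    by metis
  have "\<forall>y\<in>M. \<exists>A. open A \<and> U y = M \<inter> A" using U(2) by (simp add: openin_open)
  then obtain A where A: "\<And>y. y \<in> M \<Longrightarrow> open (A y)" "\<And>y. y \<in> M \<Longrightarrow> U y = M \<inter> A y" by metis
  have Fc: "compact F"
  proof -
    have "closedin (top_of_set M) F"
      unfolding F_def by (rule continuous_closedin_preimage[OF cont]) simp
    then show ?thesis using M closedin_compact_eq by blast
  qed
  have inj: "z = y" if "z \<in> F" "y \<in> F" "z \<in> U y" for y z
  proof -
    have "q y (p z) = z" "q y (p y) = y"
      using U(4)[of y] U(1)[of y] that FM by (auto simp: homeomorphism_def)
    then show ?thesis using that by (auto simp: F_def)
  qed
  have Ffin: "finite F"
  proof (rule compactE_image[OF Fc, of F A])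
    show "open (A y)" if "y \<in> F" for y using A that FM by blast
    show "F \<subseteq> (\<Union>y\<in>F. A y)" using U(1) A FM by blast
    fix F' assume F': "F' \<subseteq> F" "finite F'" "F \<subseteq> (\<Union>y\<in>F'. A y)"
    have "F \<subseteq> F'"
    proof
      fix z assume z: "z \<in> F"
      then obtain y where y: "y \<in> F'" "z \<in> A y" using F' by blast
      then have "z = y" using inj[OF z, of y] A(2)[of y] z F' FM by blast
      then show "z \<in> F'" using y by simp
    qed
    then show ?thesis using F'(2) finite_subset by blast
  qed
  obtain N where N: "\<And>y. y \<in> F \<Longrightarrow> open (N y) \<and> y \<in> N y"
    "\<And>y y'. y \<in> F \<Longrightarrow> y' \<in> F \<Longrightarrow> y \<noteq> y' \<Longrightarrow> N y \<inter> N y' = {}"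
    using separating_neighbourhoods[OF Ffin] by blast
  define V where "V y = U y \<inter> N y" for y
  have Vo: "openin (top_of_set M) (V y)" if "y \<in> F" for y
    unfolding V_def using U(2) N(1) that FM by (intro openin_Int_open) auto
  have pVo: "openin (top_of_set S) (p ` V y)" if y: "y \<in> F" for y
  proof -
    have "openin (top_of_set (U y)) (V y)"
      unfolding V_def using N(1)[OF y] by (simp add: openin_open_Int)
    from homeomorphism_imp_open_map[OF U(4) this] show ?thesis
      using U(3) openin_trans y FM by blast
  qed
  have Fne: "F \<noteq> {}" using x onto by (auto simp: F_def)
  define R where "R = M - (\<Union>y\<in>F. V y)"
  have "openin (top_of_set M) (\<Union>y\<in>F. V y)" using Vo by blast
  then have "closedin (top_of_set M) R" unfolding R_def by (simp add: closedin_diff)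
  then have "compact R" using M closedin_compact_eq by blast
  moreover have "R \<subseteq> M" by (auto simp: R_def)
  ultimately have Rcl: "closed (p ` R)"
    using compact_continuous_image[OF continuous_on_subset[OF cont]] compact_imp_closed by blast
  define T where "T = (\<Inter>y\<in>F. p ` V y) - p ` R"
  have To: "openin (top_of_set S) T"
  proof -
    have "openin (top_of_set S) (\<Inter>y\<in>F. p ` V y)"
      by (rule openin_INT2[OF Ffin Fne pVo])
    moreover have "T = (\<Inter>y\<in>F. p ` V y) \<inter> (- p ` R)" by (auto simp: T_def)
    ultimately show ?thesis using Rcl by (simp add: openin_Int_open open_Compl)
  qed
  have xT: "x \<in> T"
  proof -
    have "x \<in> p ` V y" if "y \<in> F" for y
    proof -
      have "y \<in> V y" using that FM U(1) N(1) by (auto simp: V_def)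
      then show ?thesis using that by (auto simp: F_def)
    qed
    moreover have "x \<notin> p ` R"
    proof
      assume "x \<in> p ` R"
      then obtain z where z: "z \<in> R" "x = p z" by blast
      then have "z \<in> F" by (simp add: F_def R_def)
      then have "z \<in> V z" using FM U(1) N(1) by (auto simp: V_def)
      then show False using z \<open>z \<in> F\<close> by (auto simp: R_def)
    qed
    ultimately show ?thesis by (simp add: T_def)
  qed
  show "\<exists>T. x \<in> T \<and> openin (top_of_set S) T \<and>
        (\<exists>v. \<Union> v = M \<inter> p -` T \<and> (\<forall>u\<in>v. openin (top_of_set M) u) \<and>
             pairwise disjnt v \<and> (\<forall>u\<in>v. \<exists>q. homeomorphism u T p q))"
  proof (intro exI conjI)
    show "x \<in> T" by (rule xT)
    show "openin (top_of_set S) T" by (rule To)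
    let ?v = "(\<lambda>y. V y \<inter> p -` T) ` F"
    have VM: "V y \<subseteq> M" if "y \<in> F" for y using Vo[OF that] openin_imp_subset by blast
    show "\<Union> ?v = M \<inter> p -` T"
    proof (intro equalityI subsetI)
      fix z assume "z \<in> M \<inter> p -` T"
      then have z: "z \<in> M" "p z \<in> T" by auto
      then have "z \<notin> R" by (auto simp: T_def)
      then obtain y where "y \<in> F" "z \<in> V y" using z by (auto simp: R_def)
      then show "z \<in> \<Union> ?v" using z by blast
    qed (use VM in blast)
    show "\<forall>u\<in>?v. openin (top_of_set M) u"
    proof
      fix u assume "u \<in> ?v"
      then obtain y where y: "y \<in> F" "u = V y \<inter> p -` T" by blast
      have "openin (top_of_set M) (M \<inter> p -` T)"
        using continuous_openin_preimage[OF cont _ To] onto by blast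
      then have "openin (top_of_set M) (V y \<inter> (M \<inter> p -` T))" using Vo[OF y(1)] by blast
      moreover have "V y \<inter> (M \<inter> p -` T) = u" using VM y by blast
      ultimately show "openin (top_of_set M) u" by simp
    qed
    show "pairwise disjnt ?v"
    proof (rule pairwiseI)
      fix u u' assume "u \<in> ?v" "u' \<in> ?v" "u \<noteq> u'"
      then obtain y y' where y: "y \<in> F" "y' \<in> F" "u = V y \<inter> p -` T" "u' = V y' \<inter> p -` T" by blast
      then have "y \<noteq> y'" using \<open>u \<noteq> u'\<close> by blast
      then show "disjnt u u'" using N(2)[OF y(1,2)] y by (auto simp: disjnt_def V_def)
    qed
    show "\<forall>u\<in>?v. \<exists>q. homeomorphism u T p q"
    proof
      fix u assume "u \<in> ?v"
      then obtain y where y: "y \<in> F" "u = V y \<inter> p -` T" by blast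
      then have yM: "y \<in> M" using FM by blast
      have "homeomorphism u T p (q y)"
      proof (rule homeomorphism_of_subsets[OF U(4)[OF yM]])
        show "u \<subseteq> U y" using y by (auto simp: V_def)
        show "T \<subseteq> p ` U y" using y by (auto simp: T_def V_def)
        have "T \<subseteq> p ` V y" using y by (auto simp: T_def)
        then show "p ` u = T" using y(2) by blast
      qed
      then show "\<exists>q. homeomorphism u T p q" by blast
    qed
  qed
qed (use assms in auto)

text \<open>Infinitely many independent vectors in one normed space: the number of coordinates that
an embedding of a compact space requires depends on the space.\<close>

definition coordinate_bcontfun :: "nat \<Rightarrow> (nat \<Rightarrow>\<^sub>C real)" where
  "coordinate_bcontfun i = Bcontfun (\<lambda>j. if j = i then 1 else 0)"

lemma apply_coordinate_bcontfun: "apply_bcontfun (coordinate_bcontfun i) j = (if j = i then 1 else 0)"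
proof -
  have "(\<lambda>j::nat. if j = i then 1 else 0 :: real) \<in> bcontfun"
    by (auto simp: bcontfun_def bounded_iff intro!: exI[of _ 1])
  then show ?thesis by (simp add: coordinate_bcontfun_def Bcontfun_inverse)
qed

lemma apply_bcontfun_sum:
  "apply_bcontfun (\<Sum>i\<in>I. (c i :: real) *\<^sub>R coordinate_bcontfun i) j = (if finite I \<and> j \<in> I then c j else 0)"
proof (cases "finite I")
  case True
  then show ?thesis
    by (induction I rule: finite_induct)
       (auto simp: plus_bcontfun.rep_eq scaleR_bcontfun.rep_eq zero_bcontfun.rep_eq apply_coordinate_bcontfun)
qed (simp add: zero_bcontfun.rep_eq)

text \<open>A covering of a simply connected space has a section, and by uniqueness of lifts the
section inverts the covering on both sides. To lift in a normed space:
finitely many Urysohn functions, one for each member of a finite cover of \<open>M\<close> by sets on which \<open>p\<close> is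
injective, together with \<open>p\<close> separate points. They embed \<open>M\<close> into a normed space in which the covering
is the projection to the first factor.\<close>

lemma compact_local_homeomorphism_simply_connected_inj:
  fixes M :: "'m::t2_space set" and p :: "'m \<Rightarrow> 'b::real_normed_vector"
  assumes M: "compact M" "connected M" "M \<noteq> {}" and cont: "continuous_on M p" and onto: "p ` M = S"
    and loc: "local_homeomorphism_on M p S"
    and S: "simply_connected S" "locally path_connected S"
  shows "inj_on p M"
proof -
  have "\<forall>y\<in>M. \<exists>U q. y \<in> U \<and> openin (top_of_set M) U \<and>
      openin (top_of_set S) (p ` U) \<and> homeomorphism U (p ` U) p q"
    using loc by (simp add: local_homeomorphism_on_def)
  then obtain U q where U: "\<And>y. y \<in> M \<Longrightarrow> y \<in> U y" "\<And>y. y \<in> M \<Longrightarrow> openin (top_of_set M) (U y)"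
      "\<And>y. y \<in> M \<Longrightarrow> openin (top_of_set S) (p ` U y)" "\<And>y. y \<in> M \<Longrightarrow> homeomorphism (U y) (p ` U y) p (q y)"
    by metis
  have UM: "U y \<subseteq> M" if "y \<in> M" for y using U(2)[OF that] openin_imp_subset by blast
  have normal: "normal_space (top_of_set M)"
  proof (rule compact_Hausdorff_or_regular_imp_normal_space)
    show "compact_space (top_of_set M)" using M(1) by (simp add: compact_space_subtopology)
    show "Hausdorff_space (top_of_set M) \<or> regular_space (top_of_set M)"
    proof (intro disjI1 Hausdorff_space_subtopology)
      show "Hausdorff_space (euclidean :: 'm topology)"
        unfolding Hausdorff_space_def disjnt_def using hausdorff by (metis open_openin)
    qed
  qed
  have "\<exists>b :: 'm \<Rightarrow> real. continuous_on M b \<and> b y = 1 \<and> (\<forall>z\<in>M - U y. b z = 0)" if y: "y \<in> M" for y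
  proof -
    have 1: "closedin (top_of_set M) (M - U y)" using U(2)[OF y] by (simp add: closedin_diff)
    have 2: "closedin (top_of_set M) {y}" using y by (simp add: closed_subset)
    have 3: "disjnt (M - U y) {y}" using U(1)[OF y] by simp
    obtain b where "continuous_map (top_of_set M) euclideanreal b" "b ` (M - U y) \<subseteq> {0}" "b ` {y} \<subseteq> {1}"
      using Urysohn_lemma_alt[OF normal 1 2 3] by blast
    then show ?thesis by auto
  qed
  then obtain b :: "'m \<Rightarrow> 'm \<Rightarrow> real" where b: "\<And>y. y \<in> M \<Longrightarrow> continuous_on M (b y)"
    "\<And>y. y \<in> M \<Longrightarrow> b y y = 1" "\<And>y z. y \<in> M \<Longrightarrow> z \<in> M \<Longrightarrow> z \<notin> U y \<Longrightarrow> b y z = 0"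
    by (metis DiffI)
  have "\<exists>A. open A \<and> M \<inter> b y -` (- {0}) = M \<inter> A" if "y \<in> M" for y
    using continuous_openin_preimage_gen[OF b(1)[OF that], of "- {0}"] by (auto simp: openin_open)
  then obtain A where A: "\<And>y. y \<in> M \<Longrightarrow> open (A y)" "\<And>y. y \<in> M \<Longrightarrow> M \<inter> b y -` (- {0}) = M \<inter> A y"
    by metis
  have "M \<subseteq> (\<Union>y\<in>M. A y)" using A(2) b(2) by fastforce
  then obtain F where F: "F \<subseteq> M" "finite F" "M \<subseteq> (\<Union>y\<in>F. A y)"
    using compactE_image[OF M(1), of M A] A(1) by blast
  obtain g and n :: nat where g: "F = g ` {i. i < n}" "inj_on g {i. i < n}"
    using F(2) finite_imp_nat_seg_image_inj_on by blast
  define e where "e y = (p y, \<Sum>i | i < n. b (g i) y *\<^sub>R coordinate_bcontfun i)" for y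
  have gM: "g i \<in> M" if "i < n" for i using that g F by blast
  have econt: "continuous_on M e"
    unfolding e_def using gM b(1) by (intro continuous_intros cont) auto
  have einj: "inj_on e M"
  proof (rule inj_onI)
    fix y z assume yz: "y \<in> M" "z \<in> M" "e y = e z"
    then have pe: "p y = p z" by (simp add: e_def)
    have be: "b (g i) y = b (g i) z" if "i < n" for i
    proof -
      have "apply_bcontfun (snd (e y)) i = apply_bcontfun (snd (e z)) i" using yz by simp
      then show ?thesis using that by (simp add: e_def apply_bcontfun_sum)
    qed
    obtain i where i: "i < n" "y \<in> A (g i)" using F(3) g yz by blast
    then have "b (g i) y \<noteq> 0" using A(2)[OF gM] yz by blast
    then have "y \<in> U (g i)" "z \<in> U (g i)" using b(3) gM i yz be by metis+
    then show "y = z" using U(4)[OF gM[OF i(1)]] pe by (metis homeomorphism_apply1)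
  qed
  define C where "C = e ` M"
  obtain k where k: "homeomorphism M C e k"
    using homeomorphism_compact[OF M(1) econt _ einj] by (auto simp: C_def)
  have fe: "fst (e y) = p y" for y by (simp add: e_def)
  have Cc: "compact C" "connected C" "C \<noteq> {}" unfolding C_def
    using M econt by (auto intro: compact_continuous_image connected_continuous_image)
  have Cont: "continuous_on C fst" by (intro continuous_intros)
  have Conto: "fst ` C = S" using onto fe by (force simp: C_def)
  have Cloc: "local_homeomorphism_on C fst S"
    unfolding local_homeomorphism_on_def
  proof
    fix c assume "c \<in> C"
    then obtain y where y: "y \<in> M" "c = e y" by (auto simp: C_def)
    have fU: "fst ` e ` U y = p ` U y" by (simp add: image_image fe)
    have h1: "homeomorphism (e ` U y) (U y) k e"
      using homeomorphism_of_subsets[OF k UM[OF y(1)]] C_def UM[OF y(1)] homeomorphism_sym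
      by (metis image_mono)
    have h2: "homeomorphism (e ` U y) (p ` U y) (p \<circ> k) (e \<circ> q y)"
      by (rule homeomorphism_compose[OF h1 U(4)[OF y(1)]])
    have "homeomorphism (e ` U y) (p ` U y) fst (e \<circ> q y)"
      by (rule homeomorphism_cong[OF h2]) (use UM[OF y(1)] homeomorphism_apply1[OF k] in \<open>auto simp: fe\<close>)
    then show "\<exists>U q. c \<in> U \<and> openin (top_of_set C) U \<and> openin (top_of_set S) (fst ` U) \<and> homeomorphism U (fst ` U) fst q"
      using y U(1,3) fU homeomorphism_imp_open_map[OF k U(2)[OF y(1)]] by (metis imageI)
  qed
  have cov: "covering_space C fst S"
    by (rule compact_local_homeomorphism_covering[OF Cc(1) Cont Conto Cloc])
  obtain h where h: "continuous_on S h" "h \<in> S \<rightarrow> C" "\<And>y. y \<in> S \<Longrightarrow> fst (h y) = y"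
    using covering_space_lift[OF cov S, of "\<lambda>x. x"] by (auto simp: continuous_on_id)
  obtain x0 where x0: "x0 \<in> S" using onto M(3) by blast
  have fC: "fst \<in> C \<rightarrow> S" using Conto by blast
  have hC: "continuous_on C (\<lambda>c. h (fst c))" "(\<lambda>c. h (fst c)) \<in> C \<rightarrow> C"
    using continuous_on_compose2[OF h(1) Cont] Conto h(2) fC by auto
  have lift: "h (fst c) = c" if c: "c \<in> C" for c
    by (rule covering_space_lift_unique[OF cov, of "\<lambda>c. h (fst c)" "h x0" "\<lambda>c. c" C fst])
       (use Cont fC hC h x0 c Cc in \<open>auto simp: continuous_on_id Pi_iff\<close>)
  show ?thesis
  proof (rule inj_onI)
    fix y z assume yz: "y \<in> M" "z \<in> M" "p y = p z"
    then have "e y = e z" using lift[of "e y"] lift[of "e z"] fe by (metis C_def imageI)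
    then show "y = z" using einj yz by (simp add: inj_on_def)
  qed
qed

section \<open>Rearrangement and the dual curvature function\<close>

text \<open>A sum \<open>\<Sum>i j. p i * D i j * r j\<close> over a doubly stochastic \<open>D\<close> is at least its value at some
permutation. The largest \<open>p i0\<close> is paired with the smallest \<open>r j0\<close>. Removing the row and the column of this
pair and redistributing their mass in proportion to its products lowers the sum by a combination of
terms \<open>(p i0 - p i) * (r j - r j0)\<close> with non-negative coefficients. If \<open>D i0 j0 = 1\<close> there is no mass
to redistribute, and the division by \<open>1 - D i0 j0 = 0\<close> yields the value 0 that is needed.\<close>

lemma doubly_stochastic_assignment:
  fixes p :: "'i \<Rightarrow> real" and r :: "'j \<Rightarrow> real" and D :: "'i \<Rightarrow> 'j \<Rightarrow> real"
  assumes "finite I" "finite J" "card I = card J"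
    and "\<And>i j. i \<in> I \<Longrightarrow> j \<in> J \<Longrightarrow> D i j \<ge> 0"
    and "\<And>i. i \<in> I \<Longrightarrow> (\<Sum>j\<in>J. D i j) = 1" "\<And>j. j \<in> J \<Longrightarrow> (\<Sum>i\<in>I. D i j) = 1"
  shows "\<exists>\<sigma>. bij_betw \<sigma> I J \<and> (\<Sum>i\<in>I. p i * r (\<sigma> i)) \<le> (\<Sum>i\<in>I. \<Sum>j\<in>J. p i * D i j * r j)"
  using assms
proof (induction "card I" arbitrary: I J D)
  case 0
  then have "I = {}" "J = {}" by auto
  then show ?case by (auto simp: bij_betw_def)
next
  case (Suc n)
  note fin = Suc.prems(1,2)
  have "I \<noteq> {}" "J \<noteq> {}" using Suc.hyps(2) Suc.prems(3) by auto
  then have "Max (p ` I) \<in> p ` I" "Min (r ` J) \<in> r ` J" using fin by (auto intro!: Max_in Min_in)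
  then obtain i0 j0 where i0: "i0 \<in> I" "Max (p ` I) = p i0" and j0: "j0 \<in> J" "Min (r ` J) = r j0"
    by blast
  have i0_max: "p i \<le> p i0" if "i \<in> I" for i using that fin i0(2)[symmetric] by simp
  have j0_min: "r j0 \<le> r j" if "j \<in> J" for j using that fin j0(2)[symmetric] by simp
  define I' J' d where "I' = I - {i0}" and "J' = J - {j0}" and "d = D i0 j0"
  define a where "a i = D i j0" for i
  define b where "b j = D i0 j" for j
  have fin': "finite I'" "finite J'" using fin by (auto simp: I'_def J'_def)
  have I: "(\<Sum>i\<in>I. g i) = g i0 + (\<Sum>i\<in>I'. g i)" for g :: "'i \<Rightarrow> real"
    using sum.remove[OF fin(1) i0(1)] by (simp add: I'_def)
  have J: "(\<Sum>j\<in>J. g j) = g j0 + (\<Sum>j\<in>J'. g j)" for g :: "'j \<Rightarrow> real"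
    using sum.remove[OF fin(2) j0(1)] by (simp add: J'_def)
  have a0: "a i \<ge> 0" if "i \<in> I'" for i using that Suc.prems(4) j0 by (auto simp: a_def I'_def)
  have b0: "b j \<ge> 0" if "j \<in> J'" for j using that Suc.prems(4) i0 by (auto simp: b_def J'_def)
  have suma: "(\<Sum>i\<in>I'. a i) = 1 - d" using Suc.prems(6)[OF j0(1)] I by (simp add: a_def d_def)
  have sumb: "(\<Sum>j\<in>J'. b j) = 1 - d" using Suc.prems(5)[OF i0(1)] J by (simp add: b_def d_def)
  have d1: "d \<le> 1" using sum_nonneg[of I' a] a0 suma by simp
  have az: "a i = 0" if "d = 1" "i \<in> I'" for i
    using suma that a0 fin' by (simp add: sum_nonneg_eq_0_iff)
  have bz: "b j = 0" if "d = 1" "j \<in> J'" for j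
    using sumb that b0 fin' by (simp add: sum_nonneg_eq_0_iff)
  define E where "E i j = D i j + a i * b j / (1 - d)" for i j
  have "\<exists>\<sigma>. bij_betw \<sigma> I' J' \<and> (\<Sum>i\<in>I'. p i * r (\<sigma> i)) \<le> (\<Sum>i\<in>I'. \<Sum>j\<in>J'. p i * E i j * r j)"
  proof (rule Suc.hyps(1))
    show "n = card I'" using Suc.hyps(2) i0 fin by (simp add: I'_def)
    show "card I' = card J'" using Suc.prems(3) i0 j0 fin by (simp add: I'_def J'_def)
    show "E i j \<ge> 0" if "i \<in> I'" "j \<in> J'" for i j
      using a0[OF that(1)] b0[OF that(2)] d1 Suc.prems(4) that by (auto simp: E_def I'_def J'_def)
    show "(\<Sum>j\<in>J'. E i j) = 1" if i: "i \<in> I'" for i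
    proof -
      have "(\<Sum>j\<in>J'. D i j) = 1 - a i" using Suc.prems(5)[of i] i J[of "D i"] by (simp add: a_def I'_def)
      moreover have "(\<Sum>j\<in>J'. a i * b j / (1 - d)) = a i"
        using az[OF _ i] by (cases "d = 1") (simp_all add: sum_distrib_left[symmetric] sum_divide_distrib[symmetric] sumb)
      ultimately show ?thesis by (simp add: E_def sum.distrib)
    qed
    show "(\<Sum>i\<in>I'. E i j) = 1" if j: "j \<in> J'" for j
    proof -
      have "(\<Sum>i\<in>I'. D i j) = 1 - b j" using Suc.prems(6)[of j] j I[of "\<lambda>i. D i j"] by (simp add: b_def J'_def)
      moreover have "(\<Sum>i\<in>I'. a i * b j / (1 - d)) = b j"
        using bz[OF _ j] by (cases "d = 1") (simp_all add: sum_distrib_right[symmetric] sum_divide_distrib[symmetric] suma)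
      ultimately show ?thesis by (simp add: E_def sum.distrib)
    qed
  qed (use fin' in auto)
  then obtain \<sigma> where \<sigma>: "bij_betw \<sigma> I' J'" "(\<Sum>i\<in>I'. p i * r (\<sigma> i)) \<le> (\<Sum>i\<in>I'. \<Sum>j\<in>J'. p i * E i j * r j)"
    by blast
  define \<tau> where "\<tau> = \<sigma>(i0 := j0)"
  have "bij_betw \<tau> I' J'" using \<sigma>(1) by (subst bij_betw_cong[of _ _ \<sigma>]) (auto simp: \<tau>_def I'_def)
  then have "bij_betw \<tau> (I' \<union> {i0}) (J' \<union> {\<tau> i0})"
    by (intro notIn_Un_bij_betw) (auto simp: I'_def J'_def \<tau>_def)
  moreover have "I' \<union> {i0} = I" "J' \<union> {\<tau> i0} = J" using i0 j0 by (auto simp: I'_def J'_def \<tau>_def)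
  ultimately have bij: "bij_betw \<tau> I J" by simp
  have nonneg: "0 \<le> (\<Sum>i\<in>I'. \<Sum>j\<in>J'. a i * b j / (1 - d) * ((p i0 - p i) * (r j - r j0)))"
    using a0 b0 d1 i0_max j0_min by (intro sum_nonneg mult_nonneg_nonneg divide_nonneg_nonneg) (auto simp: I'_def J'_def)
  define SA SB S0 where "SA = (\<Sum>i\<in>I'. a i * p i)" and "SB = (\<Sum>j\<in>J'. b j * r j)"
    and "S0 = (\<Sum>i\<in>I'. \<Sum>j\<in>J'. p i * D i j * r j)"
  have prod: "(\<Sum>i\<in>I'. \<Sum>j\<in>J'. u i * v j * c) = sum u I' * sum v J' * c" for u v and c :: real
    by (subst sum_product) (simp add: sum_distrib_right)
  have "(\<Sum>i\<in>I'. \<Sum>j\<in>J'. a i * b j / (1 - d) * ((p i0 - p i) * (r j - r j0)))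
      = (\<Sum>i\<in>I'. \<Sum>j\<in>J'. a i * (b j * r j) * (p i0 / (1 - d)))
        - (\<Sum>i\<in>I'. \<Sum>j\<in>J'. a i * b j * (p i0 * r j0 / (1 - d)))
        - (\<Sum>i\<in>I'. \<Sum>j\<in>J'. (a i * p i) * (b j * r j) * (1 / (1 - d)))
        + (\<Sum>i\<in>I'. \<Sum>j\<in>J'. (a i * p i) * b j * (r j0 / (1 - d)))"
    unfolding sum_subtractf[symmetric] sum.distrib[symmetric]
    by (intro sum.cong refl) (simp add: algebra_simps diff_divide_distrib add_divide_distrib)
  then have N: "0 \<le> (1 - d) * SB * (p i0 / (1 - d)) - (1 - d) * (1 - d) * (p i0 * r j0 / (1 - d))
      - SA * SB * (1 / (1 - d)) + SA * (1 - d) * (r j0 / (1 - d))"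
    using nonneg unfolding prod suma sumb SA_def SB_def by simp
  have E: "(\<Sum>i\<in>I'. \<Sum>j\<in>J'. p i * E i j * r j) = S0 + SA * SB * (1 / (1 - d))"
    unfolding S0_def SA_def SB_def prod[symmetric] sum.distrib[symmetric] E_def
    by (intro sum.cong refl) (simp add: algebra_simps)
  have tot: "(\<Sum>i\<in>I. \<Sum>j\<in>J. p i * D i j * r j) = p i0 * d * r j0 + p i0 * SB + r j0 * SA + S0"
    unfolding I J S0_def SA_def SB_def
    by (simp add: sum.distrib sum_distrib_left a_def b_def d_def algebra_simps)
  have "p i0 * r j0 + (S0 + SA * SB * (1 / (1 - d))) \<le> p i0 * d * r j0 + p i0 * SB + r j0 * SA + S0"
  proof (cases "d = 1")
    case True
    then have "SA = 0" "SB = 0" using az bz by (auto simp: SA_def SB_def)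
    then show ?thesis using True by simp
  next
    case False
    then have "1 - d \<noteq> 0" by simp
    then have "0 \<le> SB * p i0 - (1 - d) * (p i0 * r j0) - SA * SB * (1 / (1 - d)) + SA * r j0"
      using N by simp
    then show ?thesis by (simp add: algebra_simps)
  qed
  moreover have "(\<Sum>i\<in>I. p i * r (\<tau> i)) = p i0 * r j0 + (\<Sum>i\<in>I'. p i * r (\<sigma> i))"
    unfolding I by (auto simp: \<tau>_def I'_def intro!: sum.cong)
  ultimately have "(\<Sum>i\<in>I. p i * r (\<tau> i)) \<le> (\<Sum>i\<in>I. \<Sum>j\<in>J. p i * D i j * r j)"
    using \<sigma>(2) unfolding E tot by linarith
  then show ?case using bij by blast
qed

text \<open>Inverse concavity of \<open>f\<close> is concavity of this function of the radii of curvature.\<close>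

definition dual_fun :: "(real^'n::finite \<Rightarrow> real) \<Rightarrow> real^'n \<Rightarrow> real" where
  "dual_fun f x = 1 / f (\<chi> i. 1 / x $ i)"

text \<open>The gradient of \<open>dual_fun f\<close>, written out with the chain rule.\<close>

definition dual_grad :: "(real^'n::finite \<Rightarrow> real) \<Rightarrow> real^'n \<Rightarrow> 'n \<Rightarrow> real" where
  "dual_grad f x i = partial_deriv i f (\<chi> i. 1 / x $ i) / ((x $ i)\<^sup>2 * (f (\<chi> i. 1 / x $ i))\<^sup>2)"

lemma Gamma_plus_simps:
  "x \<in> Gamma_plus \<Longrightarrow> (\<chi> i. 1 / x $ i) \<in> Gamma_plus"
  "x \<in> Gamma_plus \<Longrightarrow> y \<in> Gamma_plus \<Longrightarrow> x + y \<in> Gamma_plus"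
  "x \<in> Gamma_plus \<Longrightarrow> c > 0 \<Longrightarrow> c *\<^sub>R x \<in> Gamma_plus"
  by (auto simp: Gamma_plus_def add_pos_pos)

lemma frechet_partial_deriv:
  fixes f :: "real^'n::finite \<Rightarrow> real"
  assumes "f differentiable at x"
  shows "(f has_derivative (\<lambda>v. \<Sum>i\<in>UNIV. v $ i * partial_deriv i f x)) (at x)"
proof -
  have lin: "linear (frechet_derivative f (at x))" by (rule linear_frechet_derivative[OF assms])
  have "frechet_derivative f (at x) v = (\<Sum>i\<in>UNIV. v $ i * partial_deriv i f x)" for v
  proof -
    have "frechet_derivative f (at x) v = frechet_derivative f (at x) (\<Sum>i\<in>UNIV. v $ i *\<^sub>R axis i 1)"
      using basis_expansion[of v] by (simp add: scalar_mult_eq_scaleR)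
    then show ?thesis using lin by (simp add: linear_sum linear_scale partial_deriv_def)
  qed
  then show ?thesis using assms frechet_derivative_works by (metis (no_types, lifting) ext)
qed

locale curvature_function =
  fixes f :: "real^'n::finite \<Rightarrow> real"
  assumes f_smooth: "smooth_on Gamma_plus f"
    and f_symmetric: "symmetric_on_Gamma_plus f"
    and f_pos: "\<forall>k\<in>Gamma_plus. f k > 0"
    and f_increasing: "\<forall>k\<in>Gamma_plus. \<forall>i. partial_deriv i f k > 0"
    and f_homogeneous: "\<forall>c>0. \<forall>k\<in>Gamma_plus. f (c *\<^sub>R k) = c * f k"
    and f_inverse_concave: "inverse_concave f"
begin

lemma f_differentiable: "x \<in> Gamma_plus \<Longrightarrow> f differentiable at x"
proof -
  have "Ck_on (Suc 0) Gamma_plus f" using f_smooth unfolding smooth_on_def by blast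
  then show "x \<in> Gamma_plus \<Longrightarrow> f differentiable at x" by simp
qed

lemma continuous_partial_deriv: "continuous_on Gamma_plus (partial_deriv i f)"
proof -
  have "Ck_on (Suc 0) Gamma_plus f" using f_smooth unfolding smooth_on_def by blast
  then have "continuous_on Gamma_plus (\<lambda>x. frechet_derivative f (at x) (axis i 1))" by simp
  then show ?thesis by (simp add: partial_deriv_def[abs_def])
qed

lemma dual_fun_homogeneous:
  assumes "c > 0" "x \<in> Gamma_plus"
  shows "dual_fun f (c *\<^sub>R x) = c * dual_fun f x"
proof -
  have "(\<chi> i. 1 / (c *\<^sub>R x) $ i) = (1 / c) *\<^sub>R (\<chi> i. 1 / x $ i)" by (simp add: vec_eq_iff)
  then have "dual_fun f (c *\<^sub>R x) = 1 / ((1 / c) * f (\<chi> i. 1 / x $ i))"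
    unfolding dual_fun_def using assms f_homogeneous Gamma_plus_simps(1)[OF assms(2)] by simp
  then show ?thesis by (simp add: dual_fun_def)
qed

lemma dual_fun_symmetric:
  assumes "\<sigma> permutes UNIV" "x \<in> Gamma_plus"
  shows "dual_fun f (\<chi> i. x $ \<sigma> i) = dual_fun f x"
proof -
  have "f (\<chi> i. (\<chi> i. 1 / x $ i) $ \<sigma> i) = f (\<chi> i. 1 / x $ i)"
    using f_symmetric assms Gamma_plus_simps(1) unfolding symmetric_on_Gamma_plus_def by blast
  then show ?thesis by (simp add: dual_fun_def)
qed

lemma dual_fun_superadditive:
  assumes "x \<in> Gamma_plus" "y \<in> Gamma_plus"
  shows "dual_fun f (x + y) \<ge> dual_fun f x + dual_fun f y"
proof -
  have "concave_on Gamma_plus (dual_fun f)"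
    using f_inverse_concave by (simp add: inverse_concave_def dual_fun_def[abs_def])
  then have "\<forall>x\<in>Gamma_plus. \<forall>y\<in>Gamma_plus. \<forall>u\<ge>0. \<forall>v\<ge>0. u + v = 1 \<longrightarrow>
      u * dual_fun f x + v * dual_fun f y \<le> dual_fun f (u *\<^sub>R x + v *\<^sub>R y)"
    by (simp add: concave_on_iff)
  from this[rule_format, OF assms, of "1/2" "1/2"]
  have "dual_fun f ((1/2) *\<^sub>R x + (1/2) *\<^sub>R y) \<ge> (1/2) * dual_fun f x + (1/2) * dual_fun f y"
    by simp
  moreover have "(1/2) *\<^sub>R x + (1/2) *\<^sub>R y = (1/2) *\<^sub>R (x + y)" by (simp add: scaleR_right_distrib)
  ultimately show ?thesis
    using dual_fun_homogeneous[of "1/2" "x + y"] Gamma_plus_simps(2)[OF assms] by simp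
qed

text \<open>Derivatives along lines suffice for the two consequences of homogeneity and concavity below.\<close>

lemma dual_fun_has_derivative:
  assumes "x \<in> Gamma_plus"
  shows "((\<lambda>t. dual_fun f (x + t *\<^sub>R v)) has_real_derivative (\<Sum>i\<in>UNIV. dual_grad f x i * v $ i)) (at 0)"
proof -
  let ?k = "\<chi> i. 1 / x $ i"
  have k: "?k \<in> Gamma_plus" by (rule Gamma_plus_simps(1)[OF assms])
  have xi: "x $ i > 0" for i using assms by (simp add: Gamma_plus_def)
  have "((\<lambda>t. 1 / (x $ i + t * v $ i)) has_derivative (\<lambda>h. - (h * v $ i) / (x $ i)\<^sup>2)) (at 0)" for i
    using xi[of i] by (auto intro!: derivative_eq_intros simp: power2_eq_square divide_simps)
  then have "((\<lambda>t. \<chi> i. 1 / (x $ i + t * v $ i)) has_derivative (\<lambda>h. \<chi> i. - (h * v $ i) / (x $ i)\<^sup>2)) (at 0)"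
    by (subst has_derivative_componentwise_within) (auto simp: Basis_vec_def inner_axis)
  moreover have "(f has_derivative (\<lambda>v. \<Sum>i\<in>UNIV. v $ i * partial_deriv i f ?k)) (at (\<chi> i. 1 / (x $ i + 0 * v $ i)))"
    using frechet_partial_deriv[OF f_differentiable[OF k]] by simp
  ultimately have "((\<lambda>t. f (\<chi> i. 1 / (x $ i + t * v $ i))) has_derivative
      (\<lambda>h. \<Sum>i\<in>UNIV. (\<chi> i. - (h * v $ i) / (x $ i)\<^sup>2) $ i * partial_deriv i f ?k)) (at 0)"
    by (rule has_derivative_compose)
  moreover have "(\<lambda>h. \<Sum>i\<in>UNIV. (\<chi> i. - (h * v $ i) / (x $ i)\<^sup>2) $ i * partial_deriv i f ?k)
     = (*) (- (\<Sum>i\<in>UNIV. partial_deriv i f ?k / (x $ i)\<^sup>2 * v $ i))"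
    by (rule ext) (simp add: sum_distrib_left sum_negf[symmetric] sum_distrib_right mult_ac)
  ultimately have d: "((\<lambda>t. f (\<chi> i. 1 / (x $ i + t * v $ i))) has_real_derivative
      - (\<Sum>i\<in>UNIV. partial_deriv i f ?k / (x $ i)\<^sup>2 * v $ i)) (at 0)"
    by (simp add: has_field_derivative_def)
  have ne: "f (\<chi> i. 1 / (x $ i + 0 * v $ i)) \<noteq> 0" using f_pos k by force
  have "((\<lambda>t. 1 / f (\<chi> i. 1 / (x $ i + t * v $ i))) has_real_derivative
     (\<Sum>i\<in>UNIV. partial_deriv i f ?k / (x $ i)\<^sup>2 * v $ i) / (f ?k * f ?k)) (at 0)"
    using DERIV_divide[OF DERIV_const[of 1] d ne] by simp
  moreover have "(\<Sum>i\<in>UNIV. partial_deriv i f ?k / (x $ i)\<^sup>2 * v $ i) / (f ?k * f ?k) = (\<Sum>i\<in>UNIV. dual_grad f x i * v $ i)"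
    unfolding sum_divide_distrib by (intro sum.cong refl) (simp add: dual_grad_def power2_eq_square)
  ultimately show ?thesis by (simp add: dual_fun_def)
qed

text \<open>Euler's identity for a function that is homogeneous of degree 1.\<close>

lemma dual_grad_euler:
  assumes "x \<in> Gamma_plus" shows "(\<Sum>i\<in>UNIV. dual_grad f x i * x $ i) = dual_fun f x"
proof -
  have "((\<lambda>t. (1 + t) * dual_fun f x) has_real_derivative dual_fun f x) (at 0)"
    by (auto intro!: derivative_eq_intros)
  moreover have "\<forall>\<^sub>F t in nhds 0. (1 + t) * dual_fun f x = dual_fun f (x + t *\<^sub>R x)"
  proof -
    have "\<forall>\<^sub>F t in nhds (0::real). t > -1" by (rule eventually_nhds_in_open[of "{-1<..}", simplified]) auto
    then show ?thesis
    proof eventually_elim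
      case (elim t)
      have "x + t *\<^sub>R x = (1 + t) *\<^sub>R x" by (simp add: scaleR_left_distrib)
      then show ?case using dual_fun_homogeneous[OF _ assms, of "1 + t"] elim by simp
    qed
  qed
  ultimately have "((\<lambda>t. dual_fun f (x + t *\<^sub>R x)) has_real_derivative dual_fun f x) (at 0)"
    by (subst (asm) DERIV_cong_ev[OF refl _ refl]) auto
  then show ?thesis using dual_fun_has_derivative[OF assms] DERIV_unique by blast
qed

text \<open>Superadditivity gives \<open>dual_fun f (x + t y) \<ge> dual_fun f x + t * dual_fun f y\<close>; subtract, divide
by \<open>t\<close> and let \<open>t\<close> tend to 0. By Euler's identity this is the tangent plane inequality at \<open>x\<close>.\<close>

lemma dual_fun_le_gradient:
  assumes "x \<in> Gamma_plus" "y \<in> Gamma_plus"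
  shows "dual_fun f y \<le> (\<Sum>i\<in>UNIV. dual_grad f x i * y $ i)"
proof (rule tendsto_lowerbound)
  show "((\<lambda>t. (dual_fun f (x + (0 + t) *\<^sub>R y) - dual_fun f (x + 0 *\<^sub>R y)) / t) \<longlongrightarrow> (\<Sum>i\<in>UNIV. dual_grad f x i * y $ i)) (at_right 0)"
    using dual_fun_has_derivative[OF assms(1), of y] unfolding DERIV_def
    by (rule filterlim_mono) (auto intro: at_le)
  show "\<forall>\<^sub>F t in at_right 0. dual_fun f y \<le> (dual_fun f (x + (0 + t) *\<^sub>R y) - dual_fun f (x + 0 *\<^sub>R y)) / t"
    using eventually_at_right_less
  proof (eventually_elim)
    case (elim t)
    then have "dual_fun f (x + t *\<^sub>R y) \<ge> dual_fun f x + t * dual_fun f y"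
      using dual_fun_superadditive[OF assms(1) Gamma_plus_simps(3)[OF assms(2), of t]] dual_fun_homogeneous[OF _ assms(2), of t]
      by simp
    then show ?case using elim by (simp add: field_simps)
  qed
qed simp

lemma dual_grad_pos: "x \<in> Gamma_plus \<Longrightarrow> dual_grad f x i > 0"
proof -
  assume x: "x \<in> Gamma_plus"
  then have "x $ i > 0" by (simp add: Gamma_plus_def)
  then show "dual_grad f x i > 0"
    using f_pos f_increasing Gamma_plus_simps(1)[OF x] by (auto simp: dual_grad_def intro!: divide_pos_pos mult_pos_pos)
qed

lemma continuous_on_dual_grad: "continuous_on Gamma_plus (\<lambda>x. dual_grad f x i)"
proof -
  have pos: "x \<in> Gamma_plus \<Longrightarrow> x $ i > 0" for x :: "real^'n" and i by (simp add: Gamma_plus_def)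
  have inv: "continuous_on Gamma_plus (\<lambda>x :: real^'n. \<chi> i. 1 / x $ i)"
  proof (intro continuous_on_vec_lambda continuous_intros ballI)
    show "x $ i \<noteq> 0" if "x \<in> Gamma_plus" for x :: "real^'n" and i using pos[OF that, of i] by simp
  qed
  have fc: "continuous_on Gamma_plus f"
    using f_differentiable by (meson continuous_at_imp_continuous_on differentiable_imp_continuous_within)
  have img: "(\<lambda>x :: real^'n. \<chi> i. 1 / x $ i) ` Gamma_plus \<subseteq> Gamma_plus" using Gamma_plus_simps(1) by blast
  have 1: "continuous_on Gamma_plus (\<lambda>x. f (\<chi> i. 1 / x $ i))"
    by (rule continuous_on_compose2[OF fc inv img])
  have 2: "continuous_on Gamma_plus (\<lambda>x. partial_deriv i f (\<chi> i. 1 / x $ i))"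
    by (rule continuous_on_compose2[OF continuous_partial_deriv inv img])
  show ?thesis unfolding dual_grad_def
  proof (intro continuous_intros 1 2 ballI)
    fix x :: "real^'n" assume "x \<in> Gamma_plus"
    then show "(x $ i)\<^sup>2 * (f (\<chi> i. 1 / x $ i))\<^sup>2 \<noteq> 0" using pos[of x i] f_pos Gamma_plus_simps(1)[of x] by fastforce
  qed
qed

end

section \<open>Eigenframes and characteristic polynomials\<close>

text \<open>A unit vector that maximises the quadratic form on \<open>V\<close> is an eigenvector: the first
variation in each direction orthogonal to it vanishes.\<close>

lemma symmetric_max_eigenvector:
  fixes T :: "'a::euclidean_space \<Rightarrow> 'a"
  assumes lin: "linear T" and sym: "\<And>v w. T v \<bullet> w = v \<bullet> T w"
    and V: "subspace V" "\<And>v. v \<in> V \<Longrightarrow> T v \<in> V" "V \<noteq> {0}"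
  shows "\<exists>v \<mu>. v \<in> V \<and> norm v = 1 \<and> T v = \<mu> *\<^sub>R v"
proof -
  let ?K = "V \<inter> sphere 0 1"
  have Kc: "compact ?K" using closed_subspace[OF V(1)] by (simp add: closed_Int_compact)
  obtain x where x: "x \<in> V" "x \<noteq> 0" using V(1,3) subspace_0 by blast
  then have "(1 / norm x) *\<^sub>R x \<in> ?K" using V(1) by (simp add: subspace_scale)
  then have Kne: "?K \<noteq> {}" by blast
  have "continuous_on ?K (\<lambda>v. T v \<bullet> v)"
    using lin by (intro continuous_intros linear_continuous_on) (simp add: linear_conv_bounded_linear)
  then obtain v where v: "v \<in> ?K" "\<And>w. w \<in> ?K \<Longrightarrow> T w \<bullet> w \<le> T v \<bullet> v"
    using continuous_attains_sup[OF Kc Kne] by blast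
  define \<mu> where "\<mu> = T v \<bullet> v"
  have vv: "v \<bullet> v = 1" "v \<in> V" using v(1) by (auto simp: norm_eq_1)
  have le: "T w \<bullet> w \<le> \<mu> * (w \<bullet> w)" if w: "w \<in> V" for w
  proof (cases "w = 0")
    case True then show ?thesis using lin by (simp add: linear_0)
  next
    case False
    then have "(1 / norm w) *\<^sub>R w \<in> ?K" using w V(1) by (simp add: subspace_scale)
    from v(2)[OF this] have "T w \<bullet> w / (norm w * norm w) \<le> \<mu>"
      using lin by (simp add: linear_scale \<mu>_def)
    then show ?thesis using False by (simp add: divide_le_eq dot_square_norm power2_eq_square)
  qed
  have orth: "T v \<bullet> w = 0" if w: "w \<in> V" "w \<bullet> v = 0" for w
  proof -
    have q: "2 * t * (T v \<bullet> w) + t\<^sup>2 * (T w \<bullet> w - \<mu> * (w \<bullet> w)) \<le> 0" for t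
    proof -
      have "T (v + t *\<^sub>R w) \<bullet> (v + t *\<^sub>R w) \<le> \<mu> * ((v + t *\<^sub>R w) \<bullet> (v + t *\<^sub>R w))"
        using V(1) w vv by (intro le) (simp add: subspace_add subspace_scale)
      moreover have "T w \<bullet> v = T v \<bullet> w" using sym by (metis inner_commute)
      ultimately show ?thesis
        using lin w vv by (simp add: linear_add linear_scale inner_left_distrib inner_right_distrib \<mu>_def[symmetric]
            power2_eq_square algebra_simps inner_commute[of v w])
    qed
    define c where "c = \<mu> * (w \<bullet> w) - T w \<bullet> w"
    have c: "c \<ge> 0" using le[OF w(1)] by (simp add: c_def)
    show ?thesis
    proof (rule ccontr)
      assume ne: "T v \<bullet> w \<noteq> 0"
      \<comment> \<open>The quadratic polynomial of \<open>q\<close> is positive here; \<open>c + 1\<close> replaces \<open>c\<close>, which may be 0.\<close>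
      define t where "t = (T v \<bullet> w) / (c + 1)"
      have "2 * t * (T v \<bullet> w) - t\<^sup>2 * c \<le> 0" using q[of t] by (simp add: c_def algebra_simps)
      moreover have "2 * t * (T v \<bullet> w) - t\<^sup>2 * c = (T v \<bullet> w)\<^sup>2 * (c + 2) / (c + 1)\<^sup>2"
      proof -
        have "c + 1 \<noteq> 0" using c by simp
        then show ?thesis by (simp add: t_def power2_eq_square divide_simps) (simp add: algebra_simps)
      qed
      moreover have "(T v \<bullet> w)\<^sup>2 * (c + 2) / (c + 1)\<^sup>2 > 0" using ne c by simp
      ultimately show False by simp
    qed
  qed
  define w where "w = T v - \<mu> *\<^sub>R v"
  have wV: "w \<in> V" using V vv by (simp add: w_def subspace_diff subspace_scale)
  have wv: "w \<bullet> v = 0" using vv by (simp add: w_def inner_diff_left \<mu>_def)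
  have "w \<bullet> w = 0"
    using orth[OF wV wv] wv by (simp add: w_def[of] inner_diff_left inner_commute)
  then have "T v = \<mu> *\<^sub>R v" by (simp add: w_def)
  then show ?thesis using vv v(1) by auto
qed

lemma orthonormal_independent:
  assumes "pairwise orthogonal B" "\<And>b. b \<in> B \<Longrightarrow> norm b = 1"
  shows "independent B"
  by (rule pairwise_orthogonal_independent[OF assms(1)]) (use assms(2) in force)

text \<open>A largest orthonormal set of eigenvectors spans \<open>V\<close>, because its orthogonal complement in
\<open>V\<close> is invariant and would otherwise contain one more eigenvector.\<close>

lemma symmetric_eigenbasis:
  fixes T :: "'a::euclidean_space \<Rightarrow> 'a"
  assumes lin: "linear T" and sym: "\<And>v w. T v \<bullet> w = v \<bullet> T w"
    and V: "subspace V" "\<And>v. v \<in> V \<Longrightarrow> T v \<in> V"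
  shows "\<exists>B. B \<subseteq> V \<and> finite B \<and> pairwise orthogonal B \<and> (\<forall>b\<in>B. norm b = 1) \<and> card B = dim V
    \<and> (\<forall>b\<in>B. \<exists>\<mu>. T b = \<mu> *\<^sub>R b)"
proof -
  define P where "P B \<longleftrightarrow> B \<subseteq> V \<and> pairwise orthogonal B \<and> (\<forall>b\<in>B. norm b = 1) \<and> (\<forall>b\<in>B. \<exists>\<mu>. T b = \<mu> *\<^sub>R b)" for B
  have ind: "independent B" if "P B" for B
    using that orthonormal_independent[of B] by (simp add: P_def)
  have "P {}" by (simp add: P_def)
  moreover have "\<forall>B. P B \<longrightarrow> card B < Suc (DIM('a))"
    using ind independent_bound by (metis less_Suc_eq_le)
  ultimately obtain B where B: "P B" "\<And>B'. P B' \<Longrightarrow> card B' \<le> card B"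
    using Lattices_Big.ex_has_greatest_nat[of P "{}" card "Suc (DIM('a))"] by (metis order_less_imp_le)
  have fin: "finite B" using ind[OF B(1)] independent_bound by blast
  define V' where "V' = {v \<in> V. \<forall>b\<in>B. v \<bullet> b = 0}"
  have sV': "subspace V'"
    using V(1) by (auto simp: V'_def subspace_def inner_left_distrib)
  have TV': "T v \<in> V'" if v: "v \<in> V'" for v
  proof -
    have "T v \<bullet> b = 0" if b: "b \<in> B" for b
    proof -
      obtain \<mu> where "T b = \<mu> *\<^sub>R b" using B(1) b unfolding P_def by blast
      then show ?thesis using sym[of v b] v b by (simp add: V'_def)
    qed
    then show ?thesis using v V(2) by (simp add: V'_def)
  qed
  have V'0: "V' = {0}"
  proof (rule ccontr)
    assume "V' \<noteq> {0}"
    then obtain v \<mu> where v: "v \<in> V'" "norm v = 1" "T v = \<mu> *\<^sub>R v"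
      using symmetric_max_eigenvector[OF lin sym sV' TV'] by blast
    have nb: "v \<notin> B" using v by (auto simp: V'_def norm_eq_1)
    have "P (insert v B)"
      using B(1) v by (auto simp: P_def V'_def pairwise_insert orthogonal_def inner_commute)
    from B(2)[OF this] show False using nb fin by simp
  qed
  have "V \<subseteq> span B"
  proof
    fix v assume v: "v \<in> V"
    define w where "w = (\<Sum>b\<in>B. (v \<bullet> b) *\<^sub>R b)"
    have wV: "w \<in> V" unfolding w_def using B(1) V(1) by (intro subspace_sum subspace_scale) (auto simp: P_def)
    have wb: "w \<bullet> b = v \<bullet> b" if b: "b \<in> B" for b
    proof -
      have "w \<bullet> b = (\<Sum>c\<in>B. if c = b then v \<bullet> b else 0)"
        unfolding w_def inner_sum_left using B(1) b
        by (intro sum.cong refl) (auto simp: P_def pairwise_def orthogonal_def norm_eq_1)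
      then show ?thesis using fin b by simp
    qed
    have "v - w \<in> V'" using v wV wb V(1) by (auto simp: V'_def subspace_diff inner_diff_left)
    then have "v = w" using V'0 by simp
    moreover have "w \<in> span B" unfolding w_def by (intro span_sum span_scale span_base)
    ultimately show "v \<in> span B" by simp
  qed
  moreover have "B \<subseteq> V" using B(1) by (simp add: P_def)
  ultimately have "card B = dim V" using ind[OF B(1)] basis_card_eq_dim by blast
  then show ?thesis using B(1) fin by (auto simp: P_def intro!: exI[of _ B])
qed

text \<open>When \<open>z\<close> is a unit vector and the ambient dimension is \<open>CARD('n) + 1\<close>, such a family is an
orthonormal basis of the tangent space of the unit sphere at \<open>z\<close>.\<close>

definition orthonormal_frame :: "'a::euclidean_space \<Rightarrow> ('n::finite \<Rightarrow> 'a) \<Rightarrow> bool" where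
  "orthonormal_frame z e \<longleftrightarrow> (\<forall>i j. e i \<bullet> e j = (if i = j then 1 else 0)) \<and> (\<forall>i. e i \<bullet> z = 0)"

lemma dim_orthogonal_complement_unit:
  assumes "norm (z :: 'a::euclidean_space) = 1"
  shows "dim {v. v \<bullet> z = 0} = DIM('a) - 1"
proof -
  have "z \<noteq> 0" using assms by auto
  then show ?thesis using dim_hyperplane[of z] by (simp add: inner_commute)
qed

lemma symmetric_eigenframe:
  fixes T :: "'a::euclidean_space \<Rightarrow> 'a"
  assumes dim: "DIM('a) = CARD('n::finite) + 1" and z: "norm z = 1"
    and lin: "linear T" and sym: "\<And>v w. T v \<bullet> w = v \<bullet> T w" and Tz: "T z = 0"
  shows "\<exists>(e :: 'n \<Rightarrow> 'a) r. orthonormal_frame z e \<and> (\<forall>i. T (e i) = r i *\<^sub>R e i)"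
proof -
  let ?V = "{v. v \<bullet> z = 0}"
  have sV: "subspace ?V" by (auto simp: subspace_def inner_left_distrib)
  have TV: "T v \<in> ?V" for v using sym[of v z] Tz by simp
  obtain B where B: "B \<subseteq> ?V" "finite B" "pairwise orthogonal B" "\<forall>b\<in>B. norm b = 1" "card B = dim ?V"
      "\<forall>b\<in>B. \<exists>\<mu>. T b = \<mu> *\<^sub>R b"
    using symmetric_eigenbasis[OF lin sym sV TV] by blast
  have "card B = card (UNIV :: 'n set)" using B(5) dim dim_orthogonal_complement_unit[OF z] by simp
  then obtain e where e: "bij_betw e (UNIV :: 'n set) B"
    using finite_same_card_bij[of "UNIV :: 'n set" B] B(2) by auto
  have eB: "e i \<in> B" for i using e by (auto simp: bij_betw_def)
  have einj: "e i = e j \<longleftrightarrow> i = j" for i j using e by (auto simp: bij_betw_def inj_on_def)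
  have "orthonormal_frame z e"
    using B eB subsetD[OF B(1) eB] einj
    by (auto simp: orthonormal_frame_def pairwise_def orthogonal_def norm_eq_1)
  moreover have "\<forall>i. \<exists>r. T (e i) = r *\<^sub>R e i" using B(6) eB by blast
  then have "\<exists>r. \<forall>i. T (e i) = r i *\<^sub>R e i" by (rule choice)
  ultimately show ?thesis by blast
qed

lemma orthonormal_frame_expansion:
  fixes e :: "'n::finite \<Rightarrow> 'a::euclidean_space"
  assumes dim: "DIM('a) = CARD('n) + 1" and z: "norm z = 1" and e: "orthonormal_frame z e"
  shows "x = (x \<bullet> z) *\<^sub>R z + (\<Sum>i\<in>UNIV. (x \<bullet> e i) *\<^sub>R e i)"
proof -
  let ?B = "insert z (range e)"
  have ee: "e i \<bullet> e j = (if i = j then 1 else 0)" "e i \<bullet> z = 0" for i j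
    using e by (simp_all add: orthonormal_frame_def)
  have inj: "inj e"
  proof (rule injI, rule ccontr)
    fix i j assume "e i = e j" "i \<noteq> j"
    then show False using ee(1)[of i i] ee(1)[of i j] by simp
  qed
  have zz: "z \<bullet> z = 1" using z by (simp add: norm_eq_1)
  have nz: "z \<notin> range e" using ee(2) zz by auto
  have B: "pairwise orthogonal ?B" "\<And>b. b \<in> ?B \<Longrightarrow> norm b = 1"
    using e z by (auto simp: pairwise_def orthogonal_def orthonormal_frame_def norm_eq_1 inner_commute split: if_splits)
  have card: "card ?B = DIM('a)" using nz inj dim by (simp add: card_image)
  have "span ?B = UNIV"
    using card_eq_dim[of ?B UNIV] orthonormal_independent[OF B] card by auto
  then have "x = (\<Sum>b\<in>?B. (x \<bullet> b) *\<^sub>R b)"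
    using orthonormal_basis_expand[OF B, of x] by simp
  also have "\<dots> = (x \<bullet> z) *\<^sub>R z + (\<Sum>i\<in>UNIV. (x \<bullet> e i) *\<^sub>R e i)"
    using nz inj by (simp add: sum.reindex)
  finally show ?thesis .
qed

text \<open>The roots of a product of linear factors, counted with multiplicity, determine the
factors up to order; one common factor is cancelled at a time.\<close>

lemma prod_linear_factors_bij:
  fixes a :: "'i \<Rightarrow> real" and b :: "'j \<Rightarrow> real"
  assumes "finite I" "finite J" "(\<Prod>i\<in>I. [:- a i, 1:]) = (\<Prod>j\<in>J. [:- b j, 1:])"
  shows "\<exists>\<sigma>. bij_betw \<sigma> I J \<and> (\<forall>i\<in>I. b (\<sigma> i) = a i)"
  using assms
proof (induction I arbitrary: J rule: finite_induct)
  case empty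
  have "J = {}"
  proof (rule ccontr)
    assume "J \<noteq> {}"
    then obtain j where j: "j \<in> J" by blast
    have "poly (\<Prod>k\<in>J. [:- b k, 1:]) (b j) = (\<Prod>k\<in>J. b j - b k)" by (simp add: poly_prod)
    also have "\<dots> = 0" using j empty(1) by (intro prod_zero) auto
    finally show False unfolding empty(2)[symmetric] by simp
  qed
  then show ?case by (auto simp: bij_betw_def)
next
  case (insert i I)
  have "poly (\<Prod>j\<in>J. [:- b j, 1:]) (a i) = poly (\<Prod>i\<in>insert i I. [:- a i, 1:]) (a i)"
    using insert.prems by simp
  also have "\<dots> = 0" using insert.hyps by (simp add: poly_prod)
  finally obtain j where j: "j \<in> J" "b j = a i" using insert.prems(1) by (auto simp: poly_prod prod_zero_iff)
  have "[:- a i, 1:] * (\<Prod>i\<in>I. [:- a i, 1:]) = [:- b j, 1:] * (\<Prod>j\<in>J - {j}. [:- b j, 1:])"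
    using insert.prems insert.hyps prod.remove[OF insert.prems(1) j(1), of "\<lambda>j. [:- b j, 1:]"] by simp
  then have "(\<Prod>i\<in>I. [:- a i, 1:]) = (\<Prod>j\<in>J - {j}. [:- b j, 1:])"
    unfolding j(2) by (subst (asm) mult_left_cancel) simp_all
  then obtain \<sigma> where \<sigma>: "bij_betw \<sigma> I (J - {j})" "\<forall>i\<in>I. b (\<sigma> i) = a i"
    using insert.IH[of "J - {j}"] insert.prems(1) by blast
  define \<tau> where "\<tau> = \<sigma>(i := j)"
  have "bij_betw \<tau> I (J - {j})"
    using \<sigma>(1) insert.hyps by (subst bij_betw_cong[of _ _ \<sigma>]) (auto simp: \<tau>_def)
  then have "bij_betw \<tau> (I \<union> {i}) ((J - {j}) \<union> {\<tau> i})"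
    using insert.hyps by (intro notIn_Un_bij_betw) (auto simp: \<tau>_def)
  moreover have "(J - {j}) \<union> {\<tau> i} = J" using j by (auto simp: \<tau>_def)
  ultimately have "bij_betw \<tau> (insert i I) J" by simp
  moreover have "\<forall>k\<in>insert i I. b (\<tau> k) = a k" using \<sigma>(2) j insert.hyps by (auto simp: \<tau>_def)
  ultimately show ?case by blast
qed

lemma equal_linear_products_permutes:
  fixes a b :: "'n::finite \<Rightarrow> real"
  assumes "\<And>t. (\<Prod>i\<in>UNIV. t - a i) = (\<Prod>i\<in>UNIV. t - b i)"
  shows "\<exists>\<sigma>. \<sigma> permutes UNIV \<and> (\<forall>i. b (\<sigma> i) = a i)"
proof -
  have "poly (\<Prod>i\<in>UNIV. [:- a i, 1:]) t = poly (\<Prod>i\<in>UNIV. [:- b i, 1:]) t" for t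
    using assms[of t] by (simp add: poly_prod)
  then have "(\<Prod>i\<in>UNIV. [:- a i, 1:]) = (\<Prod>i\<in>UNIV. [:- b i, 1:])"
    by (simp add: poly_eq_poly_eq_iff[symmetric] ext)
  from prod_linear_factors_bij[OF _ _ this] show ?thesis
    by (metis UNIV_I bij_imp_permutes finite)
qed

section \<open>Rotations and derivatives of the support function\<close>

lemma second_derivative_nonpos_at_max:
  fixes w :: "real \<Rightarrow> real"
  assumes w: "\<And>t. (w has_real_derivative w' t) (at t)" and w': "(w' has_real_derivative c) (at 0)"
    and max: "\<And>t. w t \<le> w 0"
  shows "w' 0 = 0" "c \<le> 0"
proof -
  show 0: "w' 0 = 0" by (rule DERIV_local_max[OF w[of 0], of 1]) (use max in auto)
  show "c \<le> 0"
  proof (rule ccontr)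
    assume "\<not> c \<le> 0"
    then obtain d where d: "d > 0" "\<And>h. h > 0 \<Longrightarrow> h < d \<Longrightarrow> w' 0 < w' (0 + h)"
      using DERIV_pos_inc_right[OF w'] by auto
    obtain s where s: "0 < s" "s < d / 2" "w (d / 2) - w 0 = (d / 2 - 0) * w' s"
      using MVT2[of 0 "d / 2" w w'] d(1) w by auto
    have "w' s > 0" using d(2)[of s] s d(1) 0 by simp
    then have "(d / 2 - 0) * w' s > 0" using d(1) by simp
    then show False using max[of "d / 2"] unfolding s(3)[symmetric] by simp
  qed
qed

text \<open>For a unit vector \<open>e\<close> orthogonal to \<open>y \<noteq> 0\<close> this is the rotation in the plane of \<open>e\<close> and \<open>y\<close> by the
angle \<open>norm y * t\<close>. The length of \<open>y\<close> serves as angular speed, so that no square root appears in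
\<open>rotation_gen\<close>, the derivative at \<open>t = 0\<close>.\<close>

definition rotation :: "'a::euclidean_space \<Rightarrow> 'a \<Rightarrow> real \<Rightarrow> 'a \<Rightarrow> 'a" where
  "rotation e y t x = x + (cos (norm y * t) - 1) *\<^sub>R ((x \<bullet> e) *\<^sub>R e + ((x \<bullet> y) / (norm y)\<^sup>2) *\<^sub>R y)
     + sin (norm y * t) *\<^sub>R (((x \<bullet> y) / norm y) *\<^sub>R e - ((x \<bullet> e) / norm y) *\<^sub>R y)"

definition rotation_deriv :: "'a::euclidean_space \<Rightarrow> 'a \<Rightarrow> real \<Rightarrow> 'a \<Rightarrow> 'a" where
  "rotation_deriv e y t x = (- norm y * sin (norm y * t)) *\<^sub>R ((x \<bullet> e) *\<^sub>R e + ((x \<bullet> y) / (norm y)\<^sup>2) *\<^sub>R y)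
     + (norm y * cos (norm y * t)) *\<^sub>R (((x \<bullet> y) / norm y) *\<^sub>R e - ((x \<bullet> e) / norm y) *\<^sub>R y)"

definition rotation_gen :: "'a::euclidean_space \<Rightarrow> 'a \<Rightarrow> 'a \<Rightarrow> 'a" where
  "rotation_gen e y x = (x \<bullet> y) *\<^sub>R e - (x \<bullet> e) *\<^sub>R y"

lemma rotation_0: "rotation e y 0 x = x"
  by (simp add: rotation_def)

lemma rotation_deriv_0: "y \<noteq> 0 \<Longrightarrow> rotation_deriv e y 0 x = rotation_gen e y x"
  by (simp add: rotation_deriv_def rotation_gen_def scaleR_diff_right)

lemma rotation_has_vector_derivative:
  "((\<lambda>t. rotation e y t x) has_vector_derivative rotation_deriv e y t x) (at t)"
proof -
  have "((\<lambda>t. cos (norm y * t) - 1) has_real_derivative - norm y * sin (norm y * t)) (at t)"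
    "((\<lambda>t. sin (norm y * t)) has_real_derivative norm y * cos (norm y * t)) (at t)"
    by (auto intro!: derivative_eq_intros)
  then show ?thesis
    unfolding rotation_def rotation_deriv_def
    by (auto intro!: derivative_eq_intros simp: has_real_derivative_iff_has_vector_derivative mult.commute)
qed

lemma rotation_deriv_has_vector_derivative:
  assumes "norm e = 1" "e \<bullet> y = 0" "y \<noteq> 0"
  shows "((\<lambda>t. rotation_deriv e y t x) has_vector_derivative rotation_gen e y (rotation_gen e y x)) (at 0)"
proof -
  have "((\<lambda>t. - norm y * sin (norm y * t)) has_real_derivative - (norm y)\<^sup>2) (at 0)"
    "((\<lambda>t. norm y * cos (norm y * t)) has_real_derivative 0) (at 0)"
    by (auto intro!: derivative_eq_intros simp: power2_eq_square)
  then have "((\<lambda>t. rotation_deriv e y t x) has_vector_derivative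
     - (norm y)\<^sup>2 *\<^sub>R ((x \<bullet> e) *\<^sub>R e + ((x \<bullet> y) / (norm y)\<^sup>2) *\<^sub>R y)) (at 0)"
    unfolding rotation_deriv_def
    by (auto intro!: derivative_eq_intros simp: has_real_derivative_iff_has_vector_derivative mult.commute power2_eq_square)
  moreover have "- (norm y)\<^sup>2 *\<^sub>R ((x \<bullet> e) *\<^sub>R e + ((x \<bullet> y) / (norm y)\<^sup>2) *\<^sub>R y) = rotation_gen e y (rotation_gen e y x)"
    using assms by (simp add: rotation_gen_def norm_eq_1 inner_diff_left inner_commute[of y e]
        scaleR_add_right dot_square_norm[symmetric])
  ultimately show ?thesis by simp
qed

lemma rotation_inner:
  assumes "norm e = 1" "e \<bullet> y = 0" "y \<noteq> 0"
  shows "rotation e y t x \<bullet> rotation e y t x' = x \<bullet> x'"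
proof -
  define \<omega> C s where "\<omega> = 1 / norm y" and "C = cos (norm y * t) - 1" and "s = sin (norm y * t)"
  define U where "U x = (x \<bullet> e) *\<^sub>R e + ((x \<bullet> y) * \<omega>\<^sup>2) *\<^sub>R y" for x
  define J where "J x = ((x \<bullet> y) * \<omega>) *\<^sub>R e - ((x \<bullet> e) * \<omega>) *\<^sub>R y" for x
  have "y \<bullet> y = (norm y)\<^sup>2" by (simp add: dot_square_norm)
  then have om: "(y \<bullet> y) * \<omega>\<^sup>2 = 1" using assms(3) by (simp add: \<omega>_def power_divide)
  have ee: "e \<bullet> e = 1" "e \<bullet> y = 0" "y \<bullet> e = 0" using assms by (auto simp: norm_eq_1 inner_commute)
  define g where "g = (x \<bullet> e) * (x' \<bullet> e) + (x \<bullet> y) * (x' \<bullet> y) * \<omega>\<^sup>2"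
  note expand = U_def J_def g_def inner_add_left inner_add_right inner_diff_left inner_diff_right
    inner_scaleR_left inner_scaleR_right ee inner_commute[of e x] inner_commute[of y x]
    inner_commute[of e x'] inner_commute[of y x']
  have e1: "U x \<bullet> x' = g" "x \<bullet> U x' = g" "J x \<bullet> x' = - (x \<bullet> J x')" unfolding expand by algebra+
  have e2: "U x \<bullet> U x' = g" unfolding expand using om by algebra
  have e3: "J x \<bullet> J x' = g" unfolding expand using om by algebra
  have e4: "U x \<bullet> J x' = x \<bullet> J x'" unfolding expand using om by algebra
  have e5: "J x \<bullet> U x' = - (x \<bullet> J x')" unfolding expand using om by algebra
  note eqs = e1 e2 e3 e4 e5
  have R: "rotation e y t x = x + C *\<^sub>R U x + s *\<^sub>R J x" for x
    by (simp add: rotation_def U_def J_def \<omega>_def C_def s_def power_divide)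
  have cs: "C\<^sup>2 + 2 * C + s\<^sup>2 = 0"
    using sin_cos_squared_add[of "norm y * t"] by (simp add: C_def s_def power2_eq_square algebra_simps)
  have "rotation e y t x \<bullet> rotation e y t x' = x \<bullet> x' + (C\<^sup>2 + 2 * C + s\<^sup>2) * g"
    unfolding R by (simp add: inner_add_left inner_add_right eqs power2_eq_square algebra_simps)
  then show ?thesis using cs by simp
qed

text \<open>The gradient \<open>Y\<close> of a function that is homogeneous of degree 1, and its derivatives up to
third order: \<open>T z\<close>, \<open>D3 z\<close> and \<open>D4 z\<close> are the second, third and fourth derivatives of \<open>H z = Y z \<bullet> z\<close>. The
last slot is always that of the most recent differentiation.\<close>

locale support_map =
  fixes Y :: "'a::euclidean_space \<Rightarrow> 'a" and T :: "'a \<Rightarrow> 'a \<Rightarrow> 'a"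
    and D3 :: "'a \<Rightarrow> 'a \<Rightarrow> 'a \<Rightarrow> 'a" and D4 :: "'a \<Rightarrow> 'a \<Rightarrow> 'a \<Rightarrow> 'a \<Rightarrow> 'a"
  assumes dY: "z \<noteq> 0 \<Longrightarrow> (Y has_derivative T z) (at z)"
    and dT: "z \<noteq> 0 \<Longrightarrow> ((\<lambda>z. T z a) has_derivative D3 z a) (at z)"
    and dD3: "z \<noteq> 0 \<Longrightarrow> ((\<lambda>z. D3 z a b) has_derivative D4 z a b) (at z)"
    and D3_commute: "z \<noteq> 0 \<Longrightarrow> D3 z a b = D3 z b a"
    and D4_commute: "z \<noteq> 0 \<Longrightarrow> D4 z a b c = D4 z a c b"
    and T_sym: "z \<noteq> 0 \<Longrightarrow> T z a \<bullet> b = a \<bullet> T z b"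
    and T_radial: "z \<noteq> 0 \<Longrightarrow> T z z = 0"
begin

lemma linear_T: "z \<noteq> 0 \<Longrightarrow> linear (T z)"
  using dY has_derivative_linear by blast

lemma linear_D3: "z \<noteq> 0 \<Longrightarrow> linear (D3 z a)"
  using dT has_derivative_linear by blast

lemma linear_D3_left: "z \<noteq> 0 \<Longrightarrow> linear (\<lambda>a. D3 z a b)"
  using linear_D3[of z b] D3_commute[of z _ b] by (simp add: linear_iff)

lemma open_nonzero: "open (- {0 :: 'a})"
  by (simp add: open_Compl)

lemma D4_swap: "z \<noteq> 0 \<Longrightarrow> D4 z a b c = D4 z b a c"
proof -
  assume z: "z \<noteq> 0"
  have "((\<lambda>z. D3 z a b) has_derivative D4 z b a) (at z)"
    by (rule has_derivative_transform_within_open[OF dD3[OF z] open_nonzero]) (use z D3_commute in auto)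
  from fun_cong[OF has_derivative_unique[OF dD3[OF z] this], of c] show "D4 z a b c = D4 z b a c" .
qed

lemma D3_sym: "z \<noteq> 0 \<Longrightarrow> D3 z a c \<bullet> b = D3 z b c \<bullet> a"
proof -
  assume z: "z \<noteq> 0"
  have 1: "((\<lambda>z. T z a \<bullet> b) has_derivative (\<lambda>c. D3 z a c \<bullet> b)) (at z)"
    by (rule has_derivative_inner_left[OF dT[OF z]])
  have 2: "((\<lambda>z. T z b \<bullet> a) has_derivative (\<lambda>c. D3 z b c \<bullet> a)) (at z)"
    by (rule has_derivative_inner_left[OF dT[OF z]])
  have "((\<lambda>z. T z a \<bullet> b) has_derivative (\<lambda>c. D3 z b c \<bullet> a)) (at z)"
    by (rule has_derivative_transform_within_open[OF 2 open_nonzero]) (use z T_sym in \<open>auto simp: inner_commute\<close>)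
  from fun_cong[OF has_derivative_unique[OF 1 this], of c] show "D3 z a c \<bullet> b = D3 z b c \<bullet> a" .
qed

lemma D4_sym: "z \<noteq> 0 \<Longrightarrow> D4 z a b c \<bullet> d = D4 z d b c \<bullet> a"
proof -
  assume z: "z \<noteq> 0"
  have 1: "((\<lambda>z. D3 z a b \<bullet> d) has_derivative (\<lambda>c. D4 z a b c \<bullet> d)) (at z)"
    by (rule has_derivative_inner_left[OF dD3[OF z]])
  have 2: "((\<lambda>z. D3 z d b \<bullet> a) has_derivative (\<lambda>c. D4 z d b c \<bullet> a)) (at z)"
    by (rule has_derivative_inner_left[OF dD3[OF z]])
  have "((\<lambda>z. D3 z a b \<bullet> d) has_derivative (\<lambda>c. D4 z d b c \<bullet> a)) (at z)"
    by (rule has_derivative_transform_within_open[OF 2 open_nonzero]) (use z D3_sym in auto)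
  from fun_cong[OF has_derivative_unique[OF 1 this], of c] show "D4 z a b c \<bullet> d = D4 z d b c \<bullet> a" .
qed

text \<open>Both sides are the fourth derivative of the support function in the directions
\<open>a, a, b, b\<close>. This symmetry makes the terms of highest order cancel in the maximum principle.\<close>

lemma D4_exchange: "z \<noteq> 0 \<Longrightarrow> D4 z a b b \<bullet> a = D4 z b a a \<bullet> b"
proof -
  assume z: "z \<noteq> 0"
  have "D4 z a b b = D4 z b a b" by (rule D4_swap[OF z])
  also have "\<dots> = D4 z b b a" by (rule D4_commute[OF z])
  finally have "D4 z a b b \<bullet> a = D4 z b b a \<bullet> a" by simp
  also have "\<dots> = D4 z a b a \<bullet> b" by (rule D4_sym[OF z])
  also have "D4 z a b a = D4 z b a a" by (rule D4_swap[OF z])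
  finally show ?thesis .
qed

lemma T_apply_has_derivative:
  fixes z v :: "'c::real_normed_vector \<Rightarrow> 'a"
  assumes z: "(z has_derivative z') (at x)" and v: "(v has_derivative v') (at x)"
    and S: "open S" "x \<in> S" "\<And>y. y \<in> S \<Longrightarrow> z y \<noteq> 0"
  shows "((\<lambda>x. T (z x) (v x)) has_derivative (\<lambda>h. D3 (z x) (v x) (z' h) + T (z x) (v' h))) (at x)"
proof -
  have zx: "z x \<noteq> 0" using S by blast
  have "((\<lambda>x. \<Sum>b\<in>Basis. (v x \<bullet> b) *\<^sub>R T (z x) b) has_derivative
     (\<lambda>h. \<Sum>b\<in>Basis. (v x \<bullet> b) *\<^sub>R D3 (z x) b (z' h) + (v' h \<bullet> b) *\<^sub>R T (z x) b)) (at x)"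
  proof (intro has_derivative_sum has_derivative_scaleR)
    fix b :: 'a
    show "((\<lambda>x. v x \<bullet> b) has_derivative (\<lambda>h. v' h \<bullet> b)) (at x)" by (rule has_derivative_inner_left[OF v])
    show "((\<lambda>x. T (z x) b) has_derivative (\<lambda>h. D3 (z x) b (z' h))) (at x)"
      by (rule has_derivative_compose[OF z dT[OF zx]])
  qed
  moreover have "(\<Sum>b\<in>Basis. (v x \<bullet> b) *\<^sub>R D3 (z x) b (z' h) + (v' h \<bullet> b) *\<^sub>R T (z x) b)
      = D3 (z x) (v x) (z' h) + T (z x) (v' h)" for h
    using linear_expand_Basis[OF linear_D3_left[OF zx], of "v x" "z' h"] linear_expand_Basis[OF linear_T[OF zx], of "v' h"]
    by (simp add: sum.distrib)
  ultimately have "((\<lambda>x. \<Sum>b\<in>Basis. (v x \<bullet> b) *\<^sub>R T (z x) b) has_derivative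
     (\<lambda>h. D3 (z x) (v x) (z' h) + T (z x) (v' h))) (at x)" by simp
  then show ?thesis
    by (rule has_derivative_transform_within_open[OF _ S(1,2)])
       (use linear_expand_Basis[OF linear_T[OF S(3)]] in auto)
qed

text \<open>Differentiate \<open>T z z = 0\<close>.\<close>

lemma D3_radial: "z \<noteq> 0 \<Longrightarrow> D3 z z a = - T z a"
proof -
  assume z: "z \<noteq> 0"
  have "((\<lambda>z. T z z) has_derivative (\<lambda>h. D3 z z h + T z h)) (at z)"
    by (rule T_apply_has_derivative[OF has_derivative_ident has_derivative_ident open_nonzero]) (use z in auto)
  moreover have "((\<lambda>z. T z z) has_derivative (\<lambda>h. 0)) (at z)"
    by (rule has_derivative_transform_within_open[OF has_derivative_const[of 0] open_nonzero]) (use z T_radial in auto)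
  ultimately have "D3 z z a + T z a = 0" by (metis (no_types) has_derivative_unique)
  then show "D3 z z a = - T z a" by (simp add: eq_neg_iff_add_eq_0)
qed

lemma T_curve:
  assumes z: "(z has_vector_derivative z') (at t)" and v: "(v has_vector_derivative v') (at t)"
    and nz: "\<And>s. z s \<noteq> 0"
  shows "((\<lambda>t. T (z t) (v t)) has_vector_derivative D3 (z t) (v t) z' + T (z t) v') (at t)"
proof -
  have "((\<lambda>t. T (z t) (v t)) has_derivative (\<lambda>h. D3 (z t) (v t) (h *\<^sub>R z') + T (z t) (h *\<^sub>R v'))) (at t)"
    by (rule T_apply_has_derivative[where S = UNIV]) (use assms in \<open>auto simp: has_vector_derivative_def\<close>)
  then show ?thesis
    by (simp add: has_vector_derivative_def linear_scale[OF linear_T[OF nz]] linear_scale[OF linear_D3[OF nz]] scaleR_add_right)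
qed

lemma D3_curve:
  assumes z: "(z has_vector_derivative z') (at t)" and v: "(v has_vector_derivative v') (at t)"
    and w: "(w has_vector_derivative w') (at t)" and nz: "\<And>s. z s \<noteq> 0"
  shows "((\<lambda>t. D3 (z t) (v t) (w t)) has_vector_derivative
     D4 (z t) (v t) (w t) z' + D3 (z t) v' (w t) + D3 (z t) (v t) w') (at t)"
proof -
  note zt = nz[of t]
  have D3exp: "D3 (z s) a b = (\<Sum>c\<in>Basis. \<Sum>d\<in>Basis. ((a \<bullet> c) * (b \<bullet> d)) *\<^sub>R D3 (z s) c d)" for s a b
  proof -
    have "D3 (z s) a b = (\<Sum>c\<in>Basis. (a \<bullet> c) *\<^sub>R D3 (z s) c b)"
      by (rule linear_expand_Basis[OF linear_D3_left[OF nz]])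
    also have "\<dots> = (\<Sum>c\<in>Basis. \<Sum>d\<in>Basis. ((a \<bullet> c) * (b \<bullet> d)) *\<^sub>R D3 (z s) c d)"
      by (subst linear_expand_Basis[OF linear_D3[OF nz], of _ _ b]) (simp add: scaleR_sum_right)
    finally show ?thesis .
  qed
  have lin4: "linear (D4 (z t) a b)" for a b using dD3[OF zt] has_derivative_linear by blast
  have D4exp: "D4 (z t) a b z' = (\<Sum>c\<in>Basis. \<Sum>d\<in>Basis. ((a \<bullet> c) * (b \<bullet> d)) *\<^sub>R D4 (z t) c d z')" for a b
  proof -
    have "((\<lambda>s. \<Sum>c\<in>Basis. \<Sum>d\<in>Basis. ((a \<bullet> c) * (b \<bullet> d)) *\<^sub>R D3 s c d) has_derivative
       (\<lambda>h. \<Sum>c\<in>Basis. \<Sum>d\<in>Basis. ((a \<bullet> c) * (b \<bullet> d)) *\<^sub>R D4 (z t) c d h)) (at (z t))"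
      by (intro has_derivative_sum has_derivative_scaleR_right dD3 zt)
    then have "((\<lambda>s. D3 s a b) has_derivative
       (\<lambda>h. \<Sum>c\<in>Basis. \<Sum>d\<in>Basis. ((a \<bullet> c) * (b \<bullet> d)) *\<^sub>R D4 (z t) c d h)) (at (z t))"
    proof (rule has_derivative_transform_within_open[OF _ open_nonzero])
      fix s :: 'a assume "s \<in> - {0}"
      then have s: "s \<noteq> 0" by simp
      have "D3 s a b = (\<Sum>c\<in>Basis. (a \<bullet> c) *\<^sub>R D3 s c b)"
        by (rule linear_expand_Basis[OF linear_D3_left[OF s]])
      also have "\<dots> = (\<Sum>c\<in>Basis. \<Sum>d\<in>Basis. ((a \<bullet> c) * (b \<bullet> d)) *\<^sub>R D3 s c d)"
        by (subst linear_expand_Basis[OF linear_D3[OF s], of _ b]) (simp add: scaleR_sum_right)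
      finally show "(\<Sum>c\<in>Basis. \<Sum>d\<in>Basis. ((a \<bullet> c) * (b \<bullet> d)) *\<^sub>R D3 s c d) = D3 s a b" by simp
    qed (use zt in simp)
    from fun_cong[OF has_derivative_unique[OF dD3[OF zt] this], of z'] show ?thesis .
  qed
  have comp: "((\<lambda>s. D3 (z s) c d) has_vector_derivative D4 (z t) c d z') (at t)" for c d
    using has_derivative_compose[OF z[unfolded has_vector_derivative_def] dD3[OF zt]]
    by (simp add: has_vector_derivative_def linear_scale[OF lin4])
  have vc: "((\<lambda>s. v s \<bullet> c) has_vector_derivative v' \<bullet> c) (at t)" for c
    using has_derivative_inner_left[OF v[unfolded has_vector_derivative_def], of c]
    by (simp add: has_vector_derivative_def)
  have wc: "((\<lambda>s. w s \<bullet> c) has_vector_derivative w' \<bullet> c) (at t)" for c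
    using has_derivative_inner_left[OF w[unfolded has_vector_derivative_def], of c]
    by (simp add: has_vector_derivative_def)
  have "((\<lambda>s. \<Sum>c\<in>Basis. \<Sum>d\<in>Basis. ((v s \<bullet> c) * (w s \<bullet> d)) *\<^sub>R D3 (z s) c d) has_vector_derivative
     (\<Sum>c\<in>Basis. \<Sum>d\<in>Basis. ((v t \<bullet> c) * (w t \<bullet> d)) *\<^sub>R D4 (z t) c d z'
        + ((v t \<bullet> c) * (w' \<bullet> d) + (v' \<bullet> c) * (w t \<bullet> d)) *\<^sub>R D3 (z t) c d)) (at t)"
  proof (intro has_vector_derivative_sum has_vector_derivative_scaleR comp)
    fix c d :: 'a
    show "((\<lambda>s. v s \<bullet> c * (w s \<bullet> d)) has_real_derivative v t \<bullet> c * (w' \<bullet> d) + v' \<bullet> c * (w t \<bullet> d)) (at t)"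
      unfolding has_real_derivative_iff_has_vector_derivative
      by (rule has_vector_derivative_mult[OF vc wc])
  qed
  then have "((\<lambda>s. D3 (z s) (v s) (w s)) has_vector_derivative
     (\<Sum>c\<in>Basis. \<Sum>d\<in>Basis. ((v t \<bullet> c) * (w t \<bullet> d)) *\<^sub>R D4 (z t) c d z'
        + ((v t \<bullet> c) * (w' \<bullet> d) + (v' \<bullet> c) * (w t \<bullet> d)) *\<^sub>R D3 (z t) c d)) (at t)"
    by (simp only: D3exp[symmetric])
  moreover have "(\<Sum>c\<in>Basis. \<Sum>d\<in>Basis. ((v t \<bullet> c) * (w t \<bullet> d)) *\<^sub>R D4 (z t) c d z'
        + ((v t \<bullet> c) * (w' \<bullet> d) + (v' \<bullet> c) * (w t \<bullet> d)) *\<^sub>R D3 (z t) c d)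
     = D4 (z t) (v t) (w t) z' + D3 (z t) (v t) w' + D3 (z t) v' (w t)"
    by (subst D4exp, subst D3exp[of t "v t"], subst D3exp[of t v'])
       (simp only: sum.distrib scaleR_left_distrib add.assoc)
  ultimately show ?thesis by (simp add: add_ac)
qed

lemma inner_curve:
  fixes f g :: "real \<Rightarrow> 'a"
  assumes "(f has_vector_derivative f') (at t)" "(g has_vector_derivative g') (at t)"
  shows "((\<lambda>t. f t \<bullet> g t) has_real_derivative (f t \<bullet> g' + f' \<bullet> g t)) (at t)"
proof -
  have "(\<lambda>h. f t \<bullet> h *\<^sub>R g' + (h *\<^sub>R f') \<bullet> g t) = (*) (f t \<bullet> g' + f' \<bullet> g t)"
    by (rule ext) (simp add: algebra_simps)
  then show ?thesis
    using has_derivative_inner[OF assms[unfolded has_vector_derivative_def]]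
    by (simp only: has_field_derivative_def)
qed

lemma quadratic_curve:
  assumes z: "(z has_vector_derivative z') (at t)" and v: "(v has_vector_derivative v') (at t)"
    and nz: "\<And>s. z s \<noteq> 0"
  shows "((\<lambda>t. T (z t) (v t) \<bullet> v t) has_real_derivative
     D3 (z t) (v t) z' \<bullet> v t + 2 * (T (z t) (v t) \<bullet> v')) (at t)"
  using inner_curve[OF T_curve[OF z v nz] v] T_sym[OF nz, of t v' "v t"]
  by (simp add: inner_add_left inner_commute[of v'] algebra_simps)

text \<open>The terms with one derivative of \<open>v\<close> and one of \<open>z\<close> agree by the symmetry of \<open>D3\<close>, which
accounts for the factor 4.\<close>

lemma quadratic_curve2:
  assumes z: "(z has_vector_derivative zd t) (at t)" and v: "(v has_vector_derivative vd t) (at t)"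
    and z2: "(zd has_vector_derivative zdd) (at t)" and v2: "(vd has_vector_derivative vdd) (at t)"
    and nz: "\<And>s. z s \<noteq> 0"
  shows "((\<lambda>t. D3 (z t) (v t) (zd t) \<bullet> v t + 2 * (T (z t) (v t) \<bullet> vd t)) has_real_derivative
     D4 (z t) (v t) (zd t) (zd t) \<bullet> v t + 4 * (D3 (z t) (v t) (zd t) \<bullet> vd t) + D3 (z t) (v t) zdd \<bullet> v t
      + 2 * (T (z t) (vd t) \<bullet> vd t) + 2 * (T (z t) (v t) \<bullet> vdd)) (at t)"
proof -
  have "((\<lambda>t. D3 (z t) (v t) (zd t) \<bullet> v t + 2 * (T (z t) (v t) \<bullet> vd t)) has_real_derivative
    (D3 (z t) (v t) (zd t) \<bullet> vd t + (D4 (z t) (v t) (zd t) (zd t) + D3 (z t) (vd t) (zd t) + D3 (z t) (v t) zdd) \<bullet> v t)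
     + 2 * (T (z t) (v t) \<bullet> vdd + (D3 (z t) (v t) (zd t) + T (z t) (vd t)) \<bullet> vd t)) (at t)"
    by (intro DERIV_add DERIV_cmult inner_curve D3_curve T_curve z v z2 v2 nz)
  moreover have "D3 (z t) (vd t) (zd t) \<bullet> v t = D3 (z t) (v t) (zd t) \<bullet> vd t" by (rule D3_sym[OF nz])
  ultimately show ?thesis by (simp add: inner_add_left algebra_simps)
qed

lemma Y_curve:
  assumes "(z has_vector_derivative z') (at t)" and nz: "z t \<noteq> 0"
  shows "((\<lambda>t. Y (z t)) has_vector_derivative T (z t) z') (at t)"
  using has_derivative_compose[OF assms(1)[unfolded has_vector_derivative_def] dY[OF nz]]
  by (simp add: has_vector_derivative_def linear_scale[OF linear_T[OF nz]])

lemma support_curve: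
  assumes z: "(z has_vector_derivative z') (at t)" and nz: "z t \<noteq> 0"
  shows "((\<lambda>t. Y (z t) \<bullet> z t) has_real_derivative Y (z t) \<bullet> z') (at t)"
  using inner_curve[OF Y_curve[OF z nz] z] T_sym[OF nz, of z' "z t"] T_radial[OF nz] by simp

lemma eigenframe:
  assumes dim: "DIM('a) = CARD('n::finite) + 1" and z: "norm z = 1"
  shows "\<exists>(e :: 'n \<Rightarrow> 'a) x. orthonormal_frame z e \<and> (\<forall>i. T z (e i) = x $ i *\<^sub>R e i)"
proof -
  have z0: "z \<noteq> 0" using z by force
  obtain e :: "'n \<Rightarrow> 'a" and r where "orthonormal_frame z e" "\<forall>i. T z (e i) = r i *\<^sub>R e i"
    using symmetric_eigenframe[OF dim z linear_T[OF z0] T_sym[OF z0] T_radial[OF z0]] by blast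
  then show ?thesis by (intro exI[of _ e] exI[of _ "\<chi> i. r i"]) simp
qed

lemma quadratic_form_eigenframe:
  fixes e :: "'n::finite \<Rightarrow> 'a"
  assumes dim: "DIM('a) = CARD('n) + 1" and z: "norm z = 1"
    and e: "orthonormal_frame z e" "\<And>i. T z (e i) = x $ i *\<^sub>R e i"
    and v: "v \<bullet> z = 0"
  shows "T z v \<bullet> v = (\<Sum>i\<in>UNIV. x $ i * (v \<bullet> e i)\<^sup>2)" "v \<bullet> v = (\<Sum>i\<in>UNIV. (v \<bullet> e i)\<^sup>2)"
proof -
  have z0: "z \<noteq> 0" using z by force
  have exp: "v = (\<Sum>i\<in>UNIV. (v \<bullet> e i) *\<^sub>R e i)"
    using orthonormal_frame_expansion[OF dim z e(1), of v] v by simp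
  have "T z v = (\<Sum>i\<in>UNIV. (v \<bullet> e i * x $ i) *\<^sub>R e i)"
    by (subst exp) (simp add: linear_sum[OF linear_T[OF z0]] linear_scale[OF linear_T[OF z0]] e(2))
  then show "T z v \<bullet> v = (\<Sum>i\<in>UNIV. x $ i * (v \<bullet> e i)\<^sup>2)"
    by (simp add: inner_sum_left inner_sum_right inner_commute power2_eq_square mult_ac)
  have "v \<bullet> v = (\<Sum>i\<in>UNIV. (v \<bullet> e i) *\<^sub>R e i) \<bullet> v" using arg_cong[OF exp, of "\<lambda>w. w \<bullet> v"] .
  then show "v \<bullet> v = (\<Sum>i\<in>UNIV. (v \<bullet> e i)\<^sup>2)"
    by (simp add: inner_sum_left inner_sum_right inner_commute power2_eq_square)
qed

end

section \<open>Algebra of the maximum principle\<close>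

text \<open>In the application, \<open>r\<close> are the radii of curvature at a maximum point, \<open>r i0\<close> is the largest
of them, \<open>p\<close> is the gradient of the dual curvature function, \<open>u\<close> the value of the support function,
\<open>\<phi> = u powr (- \<beta>)\<close>, and \<open>U\<close> are the tangential components of the position vector. The families \<open>A\<close>, \<open>B\<close>, \<open>X\<close>
are third derivatives of the support function, \<open>D\<close> are fourth derivatives, and \<open>z1\<close>, \<open>z2\<close> come
from the perturbation. The hypotheses \<open>w1\<close>, \<open>w2\<close>, \<open>w20\<close> are the first and second order conditions at the
maximum, and \<open>b1\<close>, \<open>bX\<close>, \<open>b2\<close> those for the equation, with a frame that rotates with speeds \<open>s\<close>.

The proof adds \<open>p k\<close> times \<open>w2\<close>, \<open>p i0\<close> times \<open>w20\<close> and subtracts \<open>u\<close> times \<open>b2\<close>. The fourth derivatives and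
all terms with \<open>p i0 * (s k)\<^sup>2\<close> cancel. The speed that minimises what remains has the denominator
\<open>r i0 - r k\<close>, which may be 0; the choice \<open>s k = - U k / u\<close> avoids it and still leaves the non-negative term
\<open>2 * \<beta> / u * (p k * r k * (U k)\<^sup>2)\<close>.\<close>

lemma variation_algebra:
  fixes p r U A D X B z1 z2 s :: "'n::finite \<Rightarrow> real" and u \<beta> \<epsilon> \<phi> :: real and i0 :: 'n
  defines "N \<equiv> - {i0}"
  assumes u: "u > 0" and p: "\<And>k. p k > 0" and s: "\<And>k. k \<in> N \<Longrightarrow> s k = - U k / u"
    and w1: "\<And>k. U k * r i0 + u * A k - (1 - \<beta>) * (r k * U k) + \<epsilon> * z1 k = 0"
    and w2: "\<And>k. k \<in> N \<Longrightarrow> (r k - u) * r i0 + 2 * U k * A k + u * (D k + r i0)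
        - (1 - \<beta>) * ((r k)\<^sup>2 + X k) + \<epsilon> * z2 k \<le> 0"
    and w20: "(r i0 - u + (\<Sum>k\<in>N. s k * U k)) * r i0 + 2 * U i0 * A i0
        + u * (D i0 + 3 * r i0 + 5 * (\<Sum>k\<in>N. s k * A k) + 2 * (\<Sum>k\<in>N. (s k)\<^sup>2 * r k) - 2 * r i0 * (\<Sum>k\<in>N. (s k)\<^sup>2))
        - (1 - \<beta>) * ((r i0)\<^sup>2 + X i0 + (\<Sum>k\<in>N. s k * (r k * U k)))
        + \<epsilon> * (z2 i0 + (\<Sum>k\<in>N. s k * z1 k)) \<le> 0"
    and b2: "p i0 * (D i0 + 3 * r i0 + 5 * (\<Sum>k\<in>N. s k * A k) + 2 * (\<Sum>k\<in>N. (s k)\<^sup>2 * r k) - 2 * r i0 * (\<Sum>k\<in>N. (s k)\<^sup>2))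
        + (\<Sum>k\<in>N. p k * (D k + r k + B k - 4 * s k * A k + 2 * (s k)\<^sup>2 * r i0 - 2 * (s k)\<^sup>2 * r k))
        + \<beta> * \<phi> / u * (r i0 - u + (\<Sum>k\<in>N. s k * U k)) - \<beta> * (\<beta> + 1) * \<phi> / u\<^sup>2 * (U i0)\<^sup>2 \<ge> 0"
    and b1: "p i0 * (\<Sum>k\<in>N. s k * A k) + (\<Sum>k\<in>N. p k * B k) = - \<beta> * \<phi> / u * (\<Sum>k\<in>N. s k * U k)"
    and bX: "p i0 * X i0 + (\<Sum>k\<in>N. p k * X k) = - \<beta> * \<phi> / u * ((U i0)\<^sup>2 + (\<Sum>k\<in>N. (U k)\<^sup>2)) - u * \<phi>"
    and \<phi>: "\<phi> = p i0 * r i0 + (\<Sum>k\<in>N. p k * r k)"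
  shows "(1 - \<beta>) * (\<Sum>k\<in>N. p k * r k * (r i0 - r k))
     + 2 * \<beta> / u * ((\<Sum>k\<in>N. p k * r k * (U k)\<^sup>2) + (U i0)\<^sup>2 * (\<Sum>k\<in>N. p k * r k))
     + (1 - \<beta>) * \<beta> * \<phi> / u * (\<Sum>k\<in>N. (U k)\<^sup>2)
     + \<epsilon> * (p i0 * z2 i0 + (\<Sum>k\<in>N. p k * z2 k) + 2 / u * ((\<Sum>k\<in>N. p k * z1 k * U k) - p i0 * z1 i0 * U i0)) \<le> 0"
proof -
  define c where "c = 1 / u"
  have uc: "u * c = 1" using u by (simp add: c_def)
  have A: "A k = c * ((1 - \<beta>) * (r k * U k) - U k * r i0 - \<epsilon> * z1 k)" for k
    using w1[of k] u by (simp add: c_def field_simps)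
  define SU SA SS SrU Sz where "SU = (\<Sum>k\<in>N. s k * U k)" and "SA = (\<Sum>k\<in>N. s k * A k)"
    and "SS = 2 * (\<Sum>k\<in>N. (s k)\<^sup>2 * r k) - 2 * r i0 * (\<Sum>k\<in>N. (s k)\<^sup>2)"
    and "SrU = (\<Sum>k\<in>N. s k * (r k * U k))" and "Sz = (\<Sum>k\<in>N. s k * z1 k)"
  define PB PX Pr Prr PrU P2 PzU UU where "PB = (\<Sum>k\<in>N. p k * B k)" and "PX = (\<Sum>k\<in>N. p k * X k)"
    and "Pr = (\<Sum>k\<in>N. p k * r k)" and "Prr = (\<Sum>k\<in>N. p k * (r k)\<^sup>2)"
    and "PrU = (\<Sum>k\<in>N. p k * r k * (U k)\<^sup>2)" and "P2 = (\<Sum>k\<in>N. p k * z2 k)"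
    and "PzU = (\<Sum>k\<in>N. p k * z1 k * U k)" and "UU = (\<Sum>k\<in>N. (U k)\<^sup>2)"
  define H where "H k = p k * (D k + r k + B k - 4 * s k * A k + 2 * (s k)\<^sup>2 * r i0 - 2 * (s k)\<^sup>2 * r k)" for k
  have SA: "SA = c * ((1 - \<beta>) * SrU - SU * r i0 - \<epsilon> * Sz)"
    unfolding SA_def SrU_def SU_def Sz_def A
    by (simp add: sum_distrib_left sum_distrib_right sum_subtractf right_diff_distrib mult_ac)
  have "(\<Sum>k\<in>N. r i0 * (p k * r k) - (1 - \<beta>) * (p k * (r k)\<^sup>2) - (1 - \<beta>) * (p k * X k) - u * (p k * r k)
      - u * (p k * B k) + 2 * \<beta> * c * (p k * r k * (U k)\<^sup>2) + \<epsilon> * (p k * z2 k) + \<epsilon> * (2 * c) * (p k * z1 k * U k))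
      \<le> (\<Sum>k\<in>N. - (u * H k))"
  proof (rule sum_mono)
    fix k assume k: "k \<in> N"
    have sk: "s k = - c * U k" using s[OF k] by (simp add: c_def)
    have "p k * ((r k - u) * r i0 + 2 * U k * A k + u * (D k + r i0)
        - (1 - \<beta>) * ((r k)\<^sup>2 + X k) + \<epsilon> * z2 k) \<le> 0"
      using w2[OF k] p[of k] by (simp add: mult_nonneg_nonpos)
    moreover have "p k * ((r k - u) * r i0 + 2 * U k * A k + u * (D k + r i0)
        - (1 - \<beta>) * ((r k)\<^sup>2 + X k) + \<epsilon> * z2 k) - u * H k
      = r i0 * (p k * r k) - (1 - \<beta>) * (p k * (r k)\<^sup>2) - (1 - \<beta>) * (p k * X k) - u * (p k * r k)
      - u * (p k * B k) + 2 * \<beta> * c * (p k * r k * (U k)\<^sup>2) + \<epsilon> * (p k * z2 k) + \<epsilon> * (2 * c) * (p k * z1 k * U k)"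
      unfolding H_def sk A using uc by algebra
    moreover have "x \<le> 0 \<Longrightarrow> x - y = z \<Longrightarrow> z \<le> - y" for x y z :: real by linarith
    ultimately show "r i0 * (p k * r k) - (1 - \<beta>) * (p k * (r k)\<^sup>2) - (1 - \<beta>) * (p k * X k) - u * (p k * r k)
      - u * (p k * B k) + 2 * \<beta> * c * (p k * r k * (U k)\<^sup>2) + \<epsilon> * (p k * z2 k) + \<epsilon> * (2 * c) * (p k * z1 k * U k)
      \<le> - (u * H k)" by blast
  qed
  then have sumN: "r i0 * Pr - (1 - \<beta>) * Prr - (1 - \<beta>) * PX - u * Pr - u * PB + 2 * \<beta> * c * PrU + \<epsilon> * P2
      + \<epsilon> * (2 * c) * PzU \<le> - (u * sum H N)"
    unfolding Pr_def Prr_def PX_def PB_def PrU_def P2_def PzU_def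
    by (simp only: sum.distrib sum_subtractf sum_distrib_left sum_negf)
  define G0 where "G0 = D i0 + 3 * r i0 + 5 * SA + SS"
  have w0: "p i0 * ((r i0 - u + SU) * r i0 + 2 * U i0 * A i0 + u * G0
        - (1 - \<beta>) * ((r i0)\<^sup>2 + X i0 + SrU) + \<epsilon> * (z2 i0 + Sz)) \<le> 0"
    using w20 p[of i0] unfolding SU_def SA_def SS_def SrU_def Sz_def G0_def
    by (intro mult_nonneg_nonpos) (auto simp: algebra_simps)
  have b2': "u * (p i0 * G0 + sum H N + \<beta> * \<phi> * c * (r i0 - u + SU) - \<beta> * (\<beta> + 1) * \<phi> * c\<^sup>2 * (U i0)\<^sup>2) \<ge> 0"
    using b2 u unfolding SU_def SA_def SS_def G0_def H_def c_def
    by (intro mult_nonneg_nonneg) (simp_all add: power_divide add_diff_eq)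
  have b1': "p i0 * SA + PB = - \<beta> * \<phi> * c * SU" using b1 by (simp add: SA_def PB_def SU_def c_def)
  have bX': "p i0 * X i0 + PX = - \<beta> * \<phi> * c * ((U i0)\<^sup>2 + UU) - u * \<phi>"
    using bX by (simp add: PX_def UU_def c_def)
  have \<phi>': "\<phi> = p i0 * r i0 + Pr" using \<phi> by (simp add: Pr_def)
  have le: "r i0 * Pr - (1 - \<beta>) * Prr - (1 - \<beta>) * PX - u * Pr - u * PB + 2 * \<beta> * c * PrU + \<epsilon> * P2
      + \<epsilon> * (2 * c) * PzU
      + p i0 * ((r i0 - u + SU) * r i0 + 2 * U i0 * A i0 - (1 - \<beta>) * ((r i0)\<^sup>2 + X i0 + SrU) + \<epsilon> * (z2 i0 + Sz))
      - u * (\<beta> * \<phi> * c * (r i0 - u + SU) - \<beta> * (\<beta> + 1) * \<phi> * c\<^sup>2 * (U i0)\<^sup>2) \<le> 0"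
    using sumN w0 b2' by (simp add: algebra_simps)
  have eq: "r i0 * Pr - (1 - \<beta>) * Prr - (1 - \<beta>) * PX - u * Pr - u * PB + 2 * \<beta> * c * PrU + \<epsilon> * P2
      + \<epsilon> * (2 * c) * PzU
      + p i0 * ((r i0 - u + SU) * r i0 + 2 * U i0 * A i0 - (1 - \<beta>) * ((r i0)\<^sup>2 + X i0 + SrU) + \<epsilon> * (z2 i0 + Sz))
      - u * (\<beta> * \<phi> * c * (r i0 - u + SU) - \<beta> * (\<beta> + 1) * \<phi> * c\<^sup>2 * (U i0)\<^sup>2)
    = (1 - \<beta>) * (r i0 * Pr - Prr) + 2 * \<beta> * c * (PrU + (U i0)\<^sup>2 * Pr) + (1 - \<beta>) * \<beta> * \<phi> * c * UU
      + \<epsilon> * (p i0 * z2 i0 + P2 + 2 * c * (PzU - p i0 * z1 i0 * U i0))"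
  proof -
    have PX: "PX = - \<beta> * \<phi> * c * ((U i0)\<^sup>2 + UU) - u * \<phi> - p i0 * X i0" using bX' by linarith
    have PB: "PB = - \<beta> * \<phi> * c * SU - p i0 * SA" using b1' by linarith
    have Pr: "Pr = \<phi> - p i0 * r i0" using \<phi>' by linarith
    show ?thesis unfolding PX PB Pr SA A[of i0] using uc by algebra
  qed
  have "(\<Sum>k\<in>N. p k * r k * (r i0 - r k)) = r i0 * Pr - Prr"
    unfolding Pr_def Prr_def by (simp add: sum_distrib_left sum_subtractf[symmetric] algebra_simps power2_eq_square)
  then show ?thesis using le unfolding eq
    by (simp add: c_def Pr_def PrU_def UU_def P2_def PzU_def)
qed

text \<open>The sum is, up to a positive factor, the linearised operator applied to \<open>exp (\<mu> * (z \<bullet> q))\<close>,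
with \<open>t = z \<bullet> q\<close> and \<open>q k\<close> the tangential components of \<open>q\<close> at \<open>z\<close>. The inequality of Young absorbs the
gradient terms in half of the leading term. If \<open>z\<close> is near \<open>- q\<close>, the term \<open>- t\<close> is positive; elsewhere
the squares \<open>(q k)\<^sup>2\<close> add up to a definite amount and the leading term wins for large \<open>\<mu>\<close>.\<close>

lemma hopf_barrier_positive:
  fixes p q U :: "'n::finite \<Rightarrow> real" and lo hi t \<delta> C \<mu> :: real
  assumes p: "\<And>k. lo \<le> p k" "\<And>k. p k \<le> hi" "lo > 0"
    and t: "(\<Sum>k\<in>UNIV. (q k)\<^sup>2) = 1 - t\<^sup>2" "t \<le> 1 - \<delta>" "0 < \<delta>"
    and U: "\<And>k. \<bar>U k\<bar> \<le> C" "C \<ge> 0"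
    and \<mu>: "\<mu> \<ge> 4 * C\<^sup>2 + 1" "\<mu> * lo * \<delta> > 6 * CARD('n) * hi"
  shows "(\<Sum>k\<in>UNIV. p k * (\<mu> * (q k)\<^sup>2 - t - 2 * \<bar>q k\<bar> * \<bar>U k\<bar>)) > 0"
proof -
  have \<mu>0: "\<mu> > 0" using \<mu>(1) zero_le_power2[of C] by linarith
  have pk: "p k > 0" for k using p(1)[of k] p(3) by simp
  have hi: "hi > 0" using p(2)[of undefined] pk[of undefined] by simp
  have half: "2 * C\<^sup>2 / \<mu> < 1 / 2" using \<mu>(1) \<mu>0 by (simp add: divide_simps)
  have young: "2 * \<bar>q k\<bar> * \<bar>U k\<bar> \<le> \<mu> / 2 * (q k)\<^sup>2 + 2 * C\<^sup>2 / \<mu>" for k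
  proof -
    have "0 \<le> (\<mu> * \<bar>q k\<bar> - 2 * C)\<^sup>2" by simp
    then have "4 * \<mu> * C * \<bar>q k\<bar> \<le> \<mu>\<^sup>2 * (q k)\<^sup>2 + 4 * C\<^sup>2"
      by (simp add: power2_diff power_mult_distrib mult_ac)
    then have "2 * C * \<bar>q k\<bar> \<le> (\<mu>\<^sup>2 * (q k)\<^sup>2 + 4 * C\<^sup>2) / (2 * \<mu>)"
      using \<mu>0 by (simp add: pos_le_divide_eq mult_ac)
    also have "\<dots> = \<mu> / 2 * (q k)\<^sup>2 + 2 * C\<^sup>2 / \<mu>"
      using \<mu>0 by (simp add: field_simps power2_eq_square)
    finally have "2 * C * \<bar>q k\<bar> \<le> \<mu> / 2 * (q k)\<^sup>2 + 2 * C\<^sup>2 / \<mu>" .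
    moreover have "2 * \<bar>q k\<bar> * \<bar>U k\<bar> \<le> 2 * \<bar>q k\<bar> * C" using U(1)[of k] by (intro mult_left_mono) auto
    ultimately show ?thesis by (simp add: mult_ac)
  qed
  have le: "(\<Sum>k\<in>UNIV. p k * (\<mu> / 2 * (q k)\<^sup>2 - t - 2 * C\<^sup>2 / \<mu>))
      \<le> (\<Sum>k\<in>UNIV. p k * (\<mu> * (q k)\<^sup>2 - t - 2 * \<bar>q k\<bar> * \<bar>U k\<bar>))"
  proof (intro sum_mono mult_left_mono)
    show "\<mu> / 2 * (q k)\<^sup>2 - t - 2 * C\<^sup>2 / \<mu> \<le> \<mu> * (q k)\<^sup>2 - t - 2 * \<bar>q k\<bar> * \<bar>U k\<bar>" for k
    proof -
      have "\<mu> * (q k)\<^sup>2 = \<mu> / 2 * (q k)\<^sup>2 + \<mu> / 2 * (q k)\<^sup>2" by simp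
      then show ?thesis using young[of k] by linarith
    qed
  qed (use pk in \<open>simp add: less_imp_le\<close>)
  have "(\<Sum>k\<in>UNIV. p k * (\<mu> / 2 * (q k)\<^sup>2 - t - 2 * C\<^sup>2 / \<mu>)) > 0"
  proof (cases "t < - (1 / 2)")
    case True
    show ?thesis
    proof (rule sum_pos)
      fix k
      have "\<mu> / 2 * (q k)\<^sup>2 \<ge> 0" using \<mu>0 by simp
      then have "\<mu> / 2 * (q k)\<^sup>2 - t - 2 * C\<^sup>2 / \<mu> > 0" using True half by linarith
      then show "p k * (\<mu> / 2 * (q k)\<^sup>2 - t - 2 * C\<^sup>2 / \<mu>) > 0" using pk by simp
    qed auto
  next
    case False
    have "(1 - t) * (1 + t) \<ge> \<delta> * (1 / 2)"
      using False t(2,3) by (intro mult_mono) auto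
    then have sq: "(\<Sum>k\<in>UNIV. (q k)\<^sup>2) \<ge> \<delta> / 2"
      unfolding t(1) by (simp add: algebra_simps power2_eq_square)
    have "(\<Sum>k\<in>UNIV. p k * (\<mu> / 2 * (q k)\<^sup>2)) \<ge> (\<Sum>k\<in>UNIV. lo * (\<mu> / 2 * (q k)\<^sup>2))"
      using p(1) \<mu>0 by (intro sum_mono mult_right_mono) auto
    moreover have "(\<Sum>k\<in>UNIV. lo * (\<mu> / 2 * (q k)\<^sup>2)) = lo * \<mu> / 2 * (\<Sum>k\<in>UNIV. (q k)\<^sup>2)"
      by (simp add: sum_distrib_left mult_ac)
    moreover have "lo * \<mu> / 2 * (\<Sum>k\<in>UNIV. (q k)\<^sup>2) \<ge> lo * \<mu> / 2 * (\<delta> / 2)"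
      using sq p(3) \<mu>0 by (intro mult_left_mono) auto
    moreover have "lo * \<mu> / 2 * (\<delta> / 2) > 3 / 2 * (CARD('n) * hi)"
      using \<mu>(2) by (simp add: mult_ac)
    moreover have "(\<Sum>k\<in>UNIV. p k * (t + 2 * C\<^sup>2 / \<mu>)) \<le> 3 / 2 * (CARD('n) * hi)"
    proof -
      have "t + 2 * C\<^sup>2 / \<mu> \<le> 3 / 2" using half t(2,3) by linarith
      then have "p k * (t + 2 * C\<^sup>2 / \<mu>) \<le> p k * (3 / 2)" for k using pk[of k] by (intro mult_left_mono) auto
      moreover have "p k * (3 / 2) \<le> hi * (3 / 2)" for k using p(2) by simp
      ultimately have "p k * (t + 2 * C\<^sup>2 / \<mu>) \<le> hi * (3 / 2)" for k using order_trans by blast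
      then have "(\<Sum>k\<in>(UNIV :: 'n set). p k * (t + 2 * C\<^sup>2 / \<mu>)) \<le> (\<Sum>k\<in>(UNIV :: 'n set). hi * (3 / 2))"
        by (intro sum_mono)
      then show ?thesis by (simp add: mult_ac)
    qed
    moreover have "(\<Sum>k\<in>UNIV. p k * (\<mu> / 2 * (q k)\<^sup>2 - t - 2 * C\<^sup>2 / \<mu>))
      = (\<Sum>k\<in>UNIV. p k * (\<mu> / 2 * (q k)\<^sup>2)) - (\<Sum>k\<in>UNIV. p k * (t + 2 * C\<^sup>2 / \<mu>))"
      unfolding sum_subtractf[symmetric] by (intro sum.cong refl) (simp add: algebra_simps)
    ultimately show ?thesis by linarith
  qed
  then show ?thesis using le by linarith
qed

section \<open>The inequality at a maximum point\<close>

text \<open>Solutions of the equation in the form needed for the maximum principle. \<open>P x\<close> is the gradient of the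
dual curvature function at the radii \<open>x\<close>. \<open>trace_ge\<close> combines the equation at \<open>z\<close> with the tangent plane
inequality at \<open>x\<close>, and \<open>trace_eq\<close> is Euler's identity at the radii of \<open>z\<close> itself.\<close>

locale support_solution = support_map Y T D3 D4
  for Y :: "'a::euclidean_space \<Rightarrow> 'a" and T D3 D4 +
  fixes P :: "real^'n::finite \<Rightarrow> 'n \<Rightarrow> real" and \<beta> :: real
  assumes dim: "DIM('a) = CARD('n) + 1" and card_ge_2: "CARD('n) \<ge> 2"
    and beta: "0 < \<beta>" "\<beta> < 1"
    and T_pos: "norm z = 1 \<Longrightarrow> v \<bullet> z = 0 \<Longrightarrow> v \<noteq> 0 \<Longrightarrow> T z v \<bullet> v > 0"
    and support_pos: "norm z = 1 \<Longrightarrow> Y z \<bullet> z > 0"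
    and P_pos: "x \<in> Gamma_plus \<Longrightarrow> P x i > 0"
    and P_cont: "continuous_on Gamma_plus (\<lambda>x. P x i)"
    and trace_ge: "norm z = 1 \<Longrightarrow> orthonormal_frame z w \<Longrightarrow> x \<in> Gamma_plus \<Longrightarrow>
        (Y z \<bullet> z) powr (-\<beta>) \<le> (\<Sum>i\<in>UNIV. P x i * (T z (w i) \<bullet> w i))"
    and trace_eq: "norm z = 1 \<Longrightarrow> orthonormal_frame z w \<Longrightarrow> (\<And>i. T z (w i) = x $ i *\<^sub>R w i) \<Longrightarrow>
        (Y z \<bullet> z) powr (-\<beta>) = (\<Sum>i\<in>UNIV. P x i * x $ i)"
begin

text \<open>The quantity of Choi and Daskalopoulos in terms of the support function: for an
eigenvector \<open>v\<close>, the first factor times the second is the support function times a radius of curvature.\<close>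

definition test_function :: "'a \<Rightarrow> 'a \<Rightarrow> real" where
  "test_function z v = (Y z \<bullet> z) * (T z v \<bullet> v) - (1 - \<beta>) / 2 * (Y z \<bullet> Y z)"

text \<open>A maximum point of the test function with the perturbation \<open>\<epsilon> * exp (\<mu> * (z \<bullet> q))\<close> added; the
choice \<open>\<epsilon> = 0\<close> gives the maximum points of the test function itself.\<close>

definition test_max :: "real \<Rightarrow> real \<Rightarrow> 'a \<Rightarrow> 'a \<Rightarrow> 'a \<Rightarrow> bool" where
  "test_max \<epsilon> \<mu> q z v \<longleftrightarrow> norm z = 1 \<and> norm v = 1 \<and> v \<bullet> z = 0 \<and>
    (\<forall>z' v'. norm z' = 1 \<longrightarrow> norm v' = 1 \<longrightarrow> v' \<bullet> z' = 0 \<longrightarrow>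
       test_function z' v' + \<epsilon> * exp (\<mu> * (z' \<bullet> q)) \<le> test_function z v + \<epsilon> * exp (\<mu> * (z \<bullet> q)))"

text \<open>The pair \<open>(z, v)\<close> is moved by a one-parameter group of rotations with generator \<open>S\<close>, which
keeps it admissible. The two claims are the vanishing of the first derivative and the sign of the
second.\<close>

lemma test_function_variation:
  fixes E y z v q :: 'a and \<epsilon> \<mu> :: real
  assumes E: "norm E = 1" "E \<bullet> y = 0" "y \<noteq> 0"
    and max: "test_max \<epsilon> \<mu> q z v"
  defines "S \<equiv> rotation_gen E y"
  shows "(Y z \<bullet> S z) * (T z v \<bullet> v) + (Y z \<bullet> z) * (D3 z v (S z) \<bullet> v + 2 * (T z v \<bullet> S v))
      - (1 - \<beta>) * (Y z \<bullet> T z (S z)) + \<epsilon> * (exp (\<mu> * (z \<bullet> q)) * (\<mu> * (S z \<bullet> q))) = 0" (is ?first)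
    and "(Y z \<bullet> S (S z) + T z (S z) \<bullet> S z) * (T z v \<bullet> v)
      + 2 * (Y z \<bullet> S z) * (D3 z v (S z) \<bullet> v + 2 * (T z v \<bullet> S v))
      + (Y z \<bullet> z) * (D4 z v (S z) (S z) \<bullet> v + 4 * (D3 z v (S z) \<bullet> S v) + D3 z v (S (S z)) \<bullet> v
          + 2 * (T z (S v) \<bullet> S v) + 2 * (T z v \<bullet> S (S v)))
      - (1 - \<beta>) * (Y z \<bullet> (D3 z (S z) (S z) + T z (S (S z))) + T z (S z) \<bullet> T z (S z))
      + \<epsilon> * (exp (\<mu> * (z \<bullet> q)) * (\<mu>\<^sup>2 * (S z \<bullet> q)\<^sup>2 + \<mu> * (S (S z) \<bullet> q))) \<le> 0" (is ?second)
proof -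
  have z: "norm z = 1" and v: "norm v = 1" "v \<bullet> z = 0" using max by (simp_all add: test_max_def)
  define Z where "Z t = rotation E y t z" for t
  define Zd where "Zd t = rotation_deriv E y t z" for t
  define V where "V t = rotation E y t v" for t
  define Vd where "Vd t = rotation_deriv E y t v" for t
  have Z: "(Z has_vector_derivative Zd t) (at t)" "(V has_vector_derivative Vd t) (at t)" for t
    unfolding Z_def[abs_def] Zd_def V_def[abs_def] Vd_def by (rule rotation_has_vector_derivative)+
  have Z2: "(Zd has_vector_derivative S (S z)) (at 0)" "(Vd has_vector_derivative S (S v)) (at 0)"
    unfolding Zd_def[abs_def] Vd_def[abs_def] S_def by (rule rotation_deriv_has_vector_derivative[OF E])+
  have at0: "Z 0 = z" "V 0 = v" "Zd 0 = S z" "Vd 0 = S v"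
    by (simp_all add: Z_def V_def Zd_def Vd_def rotation_0 rotation_deriv_0[OF E(3)] S_def)
  have unit: "norm (Z t) = 1" "norm (V t) = 1" "V t \<bullet> Z t = 0" for t
    using rotation_inner[OF E, of t] z v by (simp_all add: Z_def V_def norm_eq_1)
  have nz: "Z t \<noteq> 0" for t using unit(1)[of t] by force
  define w where "w t = (Y (Z t) \<bullet> Z t) * (T (Z t) (V t) \<bullet> V t) - (1 - \<beta>) / 2 * (Y (Z t) \<bullet> Y (Z t))
     + \<epsilon> * exp (\<mu> * (Z t \<bullet> q))" for t
  define w' where "w' t = (Y (Z t) \<bullet> Zd t) * (T (Z t) (V t) \<bullet> V t)
     + (Y (Z t) \<bullet> Z t) * (D3 (Z t) (V t) (Zd t) \<bullet> V t + 2 * (T (Z t) (V t) \<bullet> Vd t))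
     - (1 - \<beta>) * (Y (Z t) \<bullet> T (Z t) (Zd t)) + \<epsilon> * (exp (\<mu> * (Z t \<bullet> q)) * (\<mu> * (Zd t \<bullet> q)))" for t
  note sup = support_curve[OF Z(1) nz] and quad = quadratic_curve[OF Z(1) Z(2) nz]
    and Yc = Y_curve[OF Z(1) nz]
  have qc: "((\<lambda>t. Z t \<bullet> q) has_real_derivative Zd t \<bullet> q) (at t)" for t
    using inner_curve[OF Z(1) has_vector_derivative_const[of q]] by simp
  have qc2: "((\<lambda>t. Zd t \<bullet> q) has_real_derivative S (S z) \<bullet> q) (at 0)"
    using inner_curve[OF Z2(1) has_vector_derivative_const[of q]] by simp
  have dw: "(w has_real_derivative w' t) (at t)" for t
    unfolding w_def[abs_def] w'_def
    by (rule derivative_eq_intros sup quad inner_curve[OF Yc Yc] qc refl)+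
       (simp add: inner_commute algebra_simps diff_divide_distrib)
  have "(w' has_real_derivative
     (Y z \<bullet> S (S z) + T z (S z) \<bullet> S z) * (T z v \<bullet> v)
      + 2 * (Y z \<bullet> S z) * (D3 z v (S z) \<bullet> v + 2 * (T z v \<bullet> S v))
      + (Y z \<bullet> z) * (D4 z v (S z) (S z) \<bullet> v + 4 * (D3 z v (S z) \<bullet> S v) + D3 z v (S (S z)) \<bullet> v
          + 2 * (T z (S v) \<bullet> S v) + 2 * (T z v \<bullet> S (S v)))
      - (1 - \<beta>) * (Y z \<bullet> (D3 z (S z) (S z) + T z (S (S z))) + T z (S z) \<bullet> T z (S z))
      + \<epsilon> * (exp (\<mu> * (z \<bullet> q)) * (\<mu>\<^sup>2 * (S z \<bullet> q)\<^sup>2 + \<mu> * (S (S z) \<bullet> q)))) (at 0)"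
    unfolding w'_def[abs_def]
    by (rule derivative_eq_intros sup quad quadratic_curve2[OF Z(1) Z(2) Z2 nz] inner_curve[OF Yc Z2(1)]
         inner_curve[OF Yc T_curve[OF Z(1) Z2(1) nz]] qc qc2 refl)+
       (simp add: at0 power2_eq_square algebra_simps)
  moreover have "w t \<le> w 0" for t
    using max unit[of t] by (simp add: test_max_def w_def test_function_def at0)
  ultimately have "w' 0 = 0" "?second"
    using second_derivative_nonpos_at_max[OF dw] by blast+
  then show ?first ?second by (simp_all add: w'_def at0)
qed

text \<open>Moving a whole eigenframe by rotations keeps it orthonormal, so the trace inequality holds
along the motion, with equality at the start.\<close>

lemma trace_variation:
  fixes E y z :: 'a and e :: "'n \<Rightarrow> 'a"
  assumes E: "norm E = 1" "E \<bullet> y = 0" "y \<noteq> 0"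
    and z: "norm z = 1" and e: "orthonormal_frame z e" "\<And>i. T z (e i) = x $ i *\<^sub>R e i"
    and x: "x \<in> Gamma_plus"
  defines "S \<equiv> rotation_gen E y" and "u \<equiv> Y z \<bullet> z" and "\<phi> \<equiv> (Y z \<bullet> z) powr (-\<beta>)"
  shows "(\<Sum>i\<in>UNIV. P x i * (D3 z (e i) (S z) \<bullet> e i + 2 * (T z (e i) \<bullet> S (e i)))) + \<beta> * \<phi> / u * (Y z \<bullet> S z) = 0" (is ?first)
    and "(\<Sum>i\<in>UNIV. P x i * (D4 z (e i) (S z) (S z) \<bullet> e i + 4 * (D3 z (e i) (S z) \<bullet> S (e i)) + D3 z (e i) (S (S z)) \<bullet> e i
          + 2 * (T z (S (e i)) \<bullet> S (e i)) + 2 * (T z (e i) \<bullet> S (S (e i)))))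
      + \<beta> * \<phi> / u * (Y z \<bullet> S (S z) + T z (S z) \<bullet> S z) - \<beta> * (\<beta> + 1) * \<phi> / u\<^sup>2 * (Y z \<bullet> S z)\<^sup>2 \<ge> 0" (is ?second)
proof -
  define Z where "Z t = rotation E y t z" for t
  define Zd where "Zd t = rotation_deriv E y t z" for t
  define V where "V i t = rotation E y t (e i)" for i t
  define Vd where "Vd i t = rotation_deriv E y t (e i)" for i t
  have Z: "(Z has_vector_derivative Zd t) (at t)" "(V i has_vector_derivative Vd i t) (at t)" for t i
    unfolding Z_def[abs_def] Zd_def V_def[abs_def] Vd_def by (rule rotation_has_vector_derivative)+
  have Z2: "(Zd has_vector_derivative S (S z)) (at 0)" "(Vd i has_vector_derivative S (S (e i))) (at 0)" for i
    unfolding Zd_def[abs_def] Vd_def[abs_def] S_def by (rule rotation_deriv_has_vector_derivative[OF E])+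
  have at0: "Z 0 = z" "V i 0 = e i" "Zd 0 = S z" "Vd i 0 = S (e i)" for i
    by (simp_all add: Z_def V_def Zd_def Vd_def rotation_0 rotation_deriv_0[OF E(3)] S_def)
  have unit: "norm (Z t) = 1" for t
    using rotation_inner[OF E, of t] z by (simp add: Z_def norm_eq_1)
  have frame: "orthonormal_frame (Z t) (\<lambda>i. V i t)" for t
    using e(1) by (simp add: orthonormal_frame_def Z_def V_def rotation_inner[OF E])
  have nz: "Z t \<noteq> 0" for t using unit[of t] by force
  have pos: "Y (Z t) \<bullet> Z t > 0" for t using support_pos[OF unit] .
  define b where "b t = (Y (Z t) \<bullet> Z t) powr (-\<beta>) - (\<Sum>i\<in>UNIV. P x i * (T (Z t) (V i t) \<bullet> V i t))" for t
  define b' where "b' t = (-\<beta>) * (Y (Z t) \<bullet> Z t) powr (-\<beta> - 1) * (Y (Z t) \<bullet> Zd t)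
     - (\<Sum>i\<in>UNIV. P x i * (D3 (Z t) (V i t) (Zd t) \<bullet> V i t + 2 * (T (Z t) (V i t) \<bullet> Vd i t)))" for t
  note sup = support_curve[OF Z(1) nz] and quad = quadratic_curve[OF Z(1) Z(2) nz]
    and Yc = Y_curve[OF Z(1) nz]
  have pw: "((\<lambda>t. (Y (Z t) \<bullet> Z t) powr a) has_real_derivative a * (Y (Z t) \<bullet> Z t) powr (a - 1) * (Y (Z t) \<bullet> Zd t)) (at t)" for a t
    using DERIV_fun_powr[OF sup pos, of a t] by simp
  have db: "(b has_real_derivative b' t) (at t)" for t
    unfolding b_def[abs_def] b'_def
    by (intro DERIV_diff DERIV_sum DERIV_cmult pw quad)
  have "(b' has_real_derivative
     ((-\<beta>) * (Y z \<bullet> z) powr (-\<beta> - 1)) * (Y z \<bullet> S (S z) + T z (S z) \<bullet> S z)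
     + ((-\<beta>) * ((-\<beta> - 1) * (Y z \<bullet> z) powr (-\<beta> - 1 - 1) * (Y z \<bullet> S z))) * (Y z \<bullet> S z)
     - (\<Sum>i\<in>UNIV. P x i * (D4 z (e i) (S z) (S z) \<bullet> e i + 4 * (D3 z (e i) (S z) \<bullet> S (e i)) + D3 z (e i) (S (S z)) \<bullet> e i
          + 2 * (T z (S (e i)) \<bullet> S (e i)) + 2 * (T z (e i) \<bullet> S (S (e i)))))) (at 0)"
  proof -
    have 1: "((\<lambda>t. (-\<beta>) * (Y (Z t) \<bullet> Z t) powr (-\<beta> - 1) * (Y (Z t) \<bullet> Zd t)) has_real_derivative
       ((-\<beta>) * ((-\<beta> - 1) * (Y (Z 0) \<bullet> Z 0) powr (-\<beta> - 1 - 1) * (Y (Z 0) \<bullet> Zd 0))) * (Y (Z 0) \<bullet> Zd 0)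
        + (Y (Z 0) \<bullet> S (S z) + T (Z 0) (Zd 0) \<bullet> Zd 0) * ((-\<beta>) * (Y (Z 0) \<bullet> Z 0) powr (-\<beta> - 1))) (at 0)"
      by (intro DERIV_mult DERIV_cmult pw inner_curve[OF Yc Z2(1)])
    have 2: "((\<lambda>t. \<Sum>i\<in>UNIV. P x i * (D3 (Z t) (V i t) (Zd t) \<bullet> V i t + 2 * (T (Z t) (V i t) \<bullet> Vd i t))) has_real_derivative
       (\<Sum>i\<in>UNIV. P x i * (D4 (Z 0) (V i 0) (Zd 0) (Zd 0) \<bullet> V i 0 + 4 * (D3 (Z 0) (V i 0) (Zd 0) \<bullet> Vd i 0)
          + D3 (Z 0) (V i 0) (S (S z)) \<bullet> V i 0
          + 2 * (T (Z 0) (Vd i 0) \<bullet> Vd i 0) + 2 * (T (Z 0) (V i 0) \<bullet> S (S (e i)))))) (at 0)"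
      by (intro DERIV_sum DERIV_cmult quadratic_curve2[OF Z(1) Z(2) Z2 nz])
    show ?thesis using DERIV_diff[OF 1 2] unfolding b'_def[abs_def] by (simp add: at0 mult_ac add_ac)
  qed
  moreover have "b t \<le> b 0" for t
  proof -
    have "b t \<le> 0" using trace_ge[OF unit frame x] by (simp add: b_def)
    moreover have "b 0 = 0"
      using trace_eq[OF z e] e by (simp add: b_def at0 orthonormal_frame_def)
    ultimately show ?thesis by simp
  qed
  ultimately have "b' 0 = 0" and le: "((-\<beta>) * (Y z \<bullet> z) powr (-\<beta> - 1)) * (Y z \<bullet> S (S z) + T z (S z) \<bullet> S z)
     + ((-\<beta>) * ((-\<beta> - 1) * (Y z \<bullet> z) powr (-\<beta> - 1 - 1) * (Y z \<bullet> S z))) * (Y z \<bullet> S z)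
     - (\<Sum>i\<in>UNIV. P x i * (D4 z (e i) (S z) (S z) \<bullet> e i + 4 * (D3 z (e i) (S z) \<bullet> S (e i)) + D3 z (e i) (S (S z)) \<bullet> e i
          + 2 * (T z (S (e i)) \<bullet> S (e i)) + 2 * (T z (e i) \<bullet> S (S (e i))))) \<le> 0"
    using second_derivative_nonpos_at_max[OF db] by blast+
  have up: "u > 0" using support_pos[OF z] by (simp add: u_def)
  have pow1: "(Y z \<bullet> z) powr (-\<beta> - 1) = \<phi> / u"
    using up by (simp add: \<phi>_def u_def powr_diff)
  have pow2: "(Y z \<bullet> z) powr (-\<beta> - 1 - 1) = \<phi> / u\<^sup>2"
  proof -
    have "(Y z \<bullet> z) powr (-\<beta> - 1 - 1) = (Y z \<bullet> z) powr (-\<beta> - 1) / (Y z \<bullet> z) powr 1"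
      by (rule powr_diff)
    then show ?thesis using up unfolding pow1 by (simp add: u_def power2_eq_square)
  qed
  show ?first using \<open>b' 0 = 0\<close> unfolding b'_def at0 pow1 by (simp add: algebra_simps)
  have "\<beta> * (\<beta> + 1) * \<phi> / u\<^sup>2 * (Y z \<bullet> S z)\<^sup>2 = (-\<beta>) * ((-\<beta> - 1) * (\<phi> / u\<^sup>2) * (Y z \<bullet> S z)) * (Y z \<bullet> S z)"
    by (simp add: power2_eq_square algebra_simps)
  then show ?second using le unfolding pow1 pow2 by simp
qed

text \<open>The conditions of \<open>variation_algebra\<close> are verified with two kinds of rotation: the rotation
in the plane of \<open>z\<close> and \<open>e k\<close>, which transports \<open>e i0\<close> parallel for \<open>k \<noteq> i0\<close>, and for the direction \<open>e i0\<close> the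
rotation in the plane of \<open>e i0\<close> and \<open>z - sv\<close>. The latter moves \<open>z\<close> towards \<open>e i0\<close> and turns the frame
with the speeds \<open>s k\<close> at the same time.\<close>

lemma max_point_inequality:
  fixes z q :: 'a and e :: "'n \<Rightarrow> 'a" and \<epsilon> \<mu> :: real and i0 :: 'n
  assumes e: "orthonormal_frame z e" "\<And>i. T z (e i) = x $ i *\<^sub>R e i"
    and x: "x \<in> Gamma_plus" and max: "test_max \<epsilon> \<mu> q z (e i0)"
  defines "N \<equiv> - {i0}" and "u \<equiv> Y z \<bullet> z" and "\<phi> \<equiv> (Y z \<bullet> z) powr (-\<beta>)" and "p \<equiv> P x"
    and "U \<equiv> \<lambda>k. Y z \<bullet> e k"
    and "z1 \<equiv> \<lambda>k. exp (\<mu> * (z \<bullet> q)) * (\<mu> * (e k \<bullet> q))"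
    and "z2 \<equiv> \<lambda>k. exp (\<mu> * (z \<bullet> q)) * (\<mu>\<^sup>2 * (e k \<bullet> q)\<^sup>2 - \<mu> * (z \<bullet> q))"
  shows "(1 - \<beta>) * (\<Sum>k\<in>N. p k * x $ k * (x $ i0 - x $ k))
     + 2 * \<beta> / u * ((\<Sum>k\<in>N. p k * x $ k * (U k)\<^sup>2) + (U i0)\<^sup>2 * (\<Sum>k\<in>N. p k * x $ k))
     + (1 - \<beta>) * \<beta> * \<phi> / u * (\<Sum>k\<in>N. (U k)\<^sup>2)
     + \<epsilon> * (p i0 * z2 i0 + (\<Sum>k\<in>N. p k * z2 k) + 2 / u * ((\<Sum>k\<in>N. p k * z1 k * U k) - p i0 * z1 i0 * U i0)) \<le> 0"
proof -
  have z: "norm z = 1" using max by (simp add: test_max_def)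
  have z0: "z \<noteq> 0" using z by force
  have u: "u > 0" using support_pos[OF z] by (simp add: u_def)
  have p: "p k > 0" for k using P_pos[OF x] by (simp add: p_def)
  note linT = linear_T[OF z0] and lin3 = linear_D3[OF z0] and lin3' = linear_D3_left[OF z0]
  have zz: "z \<bullet> z = 1" using z by (simp add: norm_eq_1)
  have ee: "e i \<bullet> e j = (if i = j then 1 else 0)" "e i \<bullet> z = 0" "z \<bullet> e i = 0" for i j
    using e(1) by (simp_all add: orthonormal_frame_def inner_commute)
  have en: "norm (e i) = 1" for i using ee by (simp add: norm_eq_1)
  have Tz: "T z z = 0" by (rule T_radial[OF z0])
  have D3z: "D3 z z a = - T z a" "D3 z a z = - T z a" for a
    using D3_radial[OF z0] D3_commute[OF z0] by metis+
  have D3rot: "D3 z a b \<bullet> c = D3 z c b \<bullet> a" "D3 z a b = D3 z b a" for a b c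
    using D3_sym[OF z0] D3_commute[OF z0] by metis+
  define s where "s k = - U k / u" for k
  define sv where "sv = (\<Sum>k\<in>N. s k *\<^sub>R e k)"
  define A where "A k = D3 z (e i0) (e i0) \<bullet> e k" for k
  define B where "B k = D3 z (e k) sv \<bullet> e k" for k
  define D where "D k = D4 z (e i0) (e k) (e k) \<bullet> e i0" for k
  define X where "X k = D3 z (e k) (e k) \<bullet> Y z" for k
  define r where "r k = x $ k" for k
  have Te: "T z (e i) = r i *\<^sub>R e i" for i using e(2) by (simp add: r_def)
  have split: "(\<Sum>k\<in>UNIV. g k) = g i0 + (\<Sum>k\<in>N. g k)" for g :: "'n \<Rightarrow> real"
    using sum.remove[of UNIV i0 g] by (simp add: N_def Compl_eq_Diff_UNIV)
  have A_eq: "D3 z (e i0) (e k) \<bullet> e i0 = A k" "D3 z (e k) (e i0) \<bullet> e i0 = A k" for k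
    using D3rot by (metis A_def)+
  have svz: "sv \<bullet> z = 0" "z \<bullet> sv = 0" by (simp_all add: sv_def inner_sum_left ee inner_commute[of z])
  have sve: "e k \<bullet> sv = s k" "sv \<bullet> e k = s k" if "k \<in> N" for k
    using that by (simp_all add: sv_def inner_sum_left inner_sum_right ee if_distrib cong: if_cong)
  have sve0: "e i0 \<bullet> sv = 0" "sv \<bullet> e i0 = 0"
    by (auto simp add: sv_def inner_sum_left inner_sum_right ee N_def intro!: sum.neutral)
  have svsv: "sv \<bullet> sv = (\<Sum>k\<in>N. (s k)\<^sup>2)"
    by (subst (1) sv_def) (simp add: inner_sum_left sve power2_eq_square)
  have Ysv: "Y z \<bullet> sv = (\<Sum>k\<in>N. s k * U k)" by (simp add: sv_def inner_sum_right U_def)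
  have Tsv: "T z sv = (\<Sum>k\<in>N. (s k * r k) *\<^sub>R e k)"
    by (simp add: sv_def linear_sum[OF linT] linear_scale[OF linT] Te)
  have Tsvsv: "T z sv \<bullet> sv = (\<Sum>k\<in>N. (s k)\<^sup>2 * r k)"
    by (simp add: Tsv inner_sum_left sve power2_eq_square mult_ac)
  have Tsvz: "T z sv \<bullet> z = 0" by (simp add: Tsv inner_sum_left ee)
  have YTsv: "Y z \<bullet> T z sv = (\<Sum>k\<in>N. s k * (r k * U k))"
    by (simp add: Tsv inner_sum_right U_def mult_ac)
  have D3sv: "D3 z (e i0) (e i0) \<bullet> sv = (\<Sum>k\<in>N. s k * A k)"
    by (simp add: sv_def inner_sum_right A_def)
  have Bk: "B k = (\<Sum>j\<in>N. s j * (D3 z (e k) (e j) \<bullet> e k))" for k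
    by (simp add: B_def sv_def linear_sum[OF lin3] linear_scale[OF lin3] inner_sum_left)
  have B0: "B i0 = (\<Sum>k\<in>N. s k * A k)" unfolding Bk A_eq ..

  \<comment> \<open>First the rotations in the planes of \<open>z\<close> and \<open>e k\<close>.\<close>
  have Sz: "rotation_gen (e k) z z = e k" for k by (simp add: rotation_gen_def zz ee)
  have Se: "rotation_gen (e k) z (e i) = (if i = k then - z else 0)" for k i
    by (simp add: rotation_gen_def ee)
  have SSz: "rotation_gen (e k) z (- z) = - e k" "rotation_gen (e k) z 0 = 0" for k
    by (simp_all add: rotation_gen_def zz ee)
  have e0: "T z (e i0) \<bullet> e i0 = r i0" "T z (e k) \<bullet> e k = r k" "T z (e k) \<bullet> z = 0" "Y z \<bullet> T z (e k) = r k * U k" for k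
    by (simp_all add: Te ee U_def)
  have w1: "U k * r i0 + u * A k - (1 - \<beta>) * (r k * U k) + \<epsilon> * z1 k = 0" for k
  proof -
    have 1: "T z (e i0) \<bullet> (if i0 = k then - z else 0) = 0" by (simp add: e0)
    show ?thesis
      using test_function_variation(1)[where E = "e k" and y = z and z = z and v = "e i0" and q = q and \<epsilon> = \<epsilon> and \<mu> = \<mu>, OF en ee(2) z0 max, unfolded Sz Se]
      unfolding 1 e0 A_eq by (simp add: U_def u_def z1_def)
  qed
  have w2: "(r k - u) * r i0 + 2 * U k * A k + u * (D k + r i0)
        - (1 - \<beta>) * ((r k)\<^sup>2 + X k) + \<epsilon> * z2 k \<le> 0" if k: "k \<in> N" for k
  proof -
    have ne: "(i0 = k) = False" using k by (auto simp: N_def)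
    have 1: "D3 z (e i0) (- z) \<bullet> e i0 = r i0"
      by (simp add: linear_neg[OF lin3] D3z e0)
    have 2: "(if k = k then a else b) = a" for a b :: 'a by simp
    have 3: "Y z \<bullet> (- z) + T z (e k) \<bullet> e k = r k - u" by (simp add: e0 u_def)
    have 4: "Y z \<bullet> (D3 z (e k) (e k) + T z (- z)) + T z (e k) \<bullet> T z (e k) = (r k)\<^sup>2 + X k"
      by (simp add: linear_neg[OF linT] Tz X_def Te ee power2_eq_square inner_commute[of "Y z" "D3 z (e k) (e k)"])
    have 5: "D4 z (e i0) (e k) (e k) \<bullet> e i0 + 4 * (D3 z (e i0) (e k) \<bullet> 0) + D3 z (e i0) (- z) \<bullet> e i0
          + 2 * (T z 0 \<bullet> 0) + 2 * (T z (e i0) \<bullet> 0) = D k + r i0"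
      by (simp add: 1 D_def)
    have 6: "D3 z (e i0) (e k) \<bullet> e i0 + 2 * (T z (e i0) \<bullet> 0) = A k" by (simp add: A_eq)
    have 7: "exp (\<mu> * (z \<bullet> q)) * (\<mu>\<^sup>2 * (e k \<bullet> q)\<^sup>2 + \<mu> * (- z \<bullet> q)) = z2 k"
      by (simp add: z2_def)
    show ?thesis
      using test_function_variation(2)[where E = "e k" and y = z and z = z and v = "e i0" and q = q and \<epsilon> = \<epsilon> and \<mu> = \<mu>, OF en ee(2) z0 max, unfolded Sz Se]
      unfolding ne if_False SSz 2 3 4 5 6 7 e0(1) by (simp only: U_def u_def)
  qed
  have b1k: "(\<Sum>i\<in>UNIV. p i * (D3 z (e i) (e k) \<bullet> e i)) = - \<beta> * \<phi> / u * U k" for k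
  proof -
    have "(\<Sum>i\<in>UNIV. p i * (D3 z (e i) (e k) \<bullet> e i + 2 * (T z (e i) \<bullet> (if i = k then - z else 0)))) + \<beta> * \<phi> / u * U k = 0"
      using trace_variation(1)[where E = "e k" and y = z and z = z, OF en ee(2) z0 z e x]
      by (simp only: Sz Se u_def \<phi>_def U_def p_def)
    moreover have "T z (e i) \<bullet> (if i = k then - z else 0) = 0" for i by (simp add: Te ee)
    ultimately show ?thesis by simp
  qed
  have b1: "p i0 * (\<Sum>k\<in>N. s k * A k) + (\<Sum>k\<in>N. p k * B k) = - \<beta> * \<phi> / u * (\<Sum>k\<in>N. s k * U k)"
  proof -
    have "p i0 * (\<Sum>k\<in>N. s k * A k) + (\<Sum>k\<in>N. p k * B k) = (\<Sum>i\<in>UNIV. p i * B i)"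
      by (simp add: split B0)
    also have "\<dots> = (\<Sum>i\<in>UNIV. \<Sum>j\<in>N. s j * (p i * (D3 z (e i) (e j) \<bullet> e i)))"
      by (simp add: Bk sum_distrib_left mult_ac)
    also have "\<dots> = (\<Sum>j\<in>N. s j * (- \<beta> * \<phi> / u * U j))"
      by (subst sum.swap) (simp add: b1k sum_distrib_left[symmetric])
    finally show ?thesis by (simp add: sum_distrib_left mult_ac)
  qed
  have \<phi>: "\<phi> = p i0 * r i0 + (\<Sum>k\<in>N. p k * r k)"
    using trace_eq[OF z e] by (simp add: \<phi>_def p_def r_def split)
  have bX: "p i0 * X i0 + (\<Sum>k\<in>N. p k * X k) = - \<beta> * \<phi> / u * ((U i0)\<^sup>2 + (\<Sum>k\<in>N. (U k)\<^sup>2)) - u * \<phi>"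
  proof -
    have Xk: "X k = (\<Sum>j\<in>UNIV. U j * (D3 z (e k) (e j) \<bullet> e k)) - u * r k" for k
    proof -
      have "Y z = (Y z \<bullet> z) *\<^sub>R z + (\<Sum>i\<in>UNIV. (Y z \<bullet> e i) *\<^sub>R e i)"
        by (rule orthonormal_frame_expansion[OF dim z e(1)])
      then have "X k = D3 z (e k) (e k) \<bullet> ((Y z \<bullet> z) *\<^sub>R z + (\<Sum>i\<in>UNIV. (Y z \<bullet> e i) *\<^sub>R e i))"
        by (simp add: X_def)
      also have "\<dots> = u * (D3 z (e k) (e k) \<bullet> z) + (\<Sum>j\<in>UNIV. U j * (D3 z (e k) (e k) \<bullet> e j))"
        by (simp add: inner_add_right inner_sum_right u_def U_def)
      also have "D3 z (e k) (e k) \<bullet> z = - r k"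
        using D3rot(1)[of "e k" "e k" z] by (simp add: D3z Te ee)
      also have "(\<Sum>j\<in>UNIV. U j * (D3 z (e k) (e k) \<bullet> e j)) = (\<Sum>j\<in>UNIV. U j * (D3 z (e k) (e j) \<bullet> e k))"
      proof (intro sum.cong refl)
        fix j
        have "D3 z (e k) (e k) \<bullet> e j = D3 z (e j) (e k) \<bullet> e k" by (rule D3rot(1))
        also have "D3 z (e j) (e k) = D3 z (e k) (e j)" by (rule D3rot(2))
        finally show "U j * (D3 z (e k) (e k) \<bullet> e j) = U j * (D3 z (e k) (e j) \<bullet> e k)" by simp
      qed
      finally show ?thesis by simp
    qed
    have "p i0 * X i0 + (\<Sum>k\<in>N. p k * X k) = (\<Sum>k\<in>UNIV. p k * X k)" by (simp add: split)
    also have "\<dots> = (\<Sum>k\<in>UNIV. \<Sum>j\<in>UNIV. U j * (p k * (D3 z (e k) (e j) \<bullet> e k))) - u * (\<Sum>k\<in>UNIV. p k * r k)"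
      by (simp add: Xk sum_distrib_left sum_subtractf right_diff_distrib mult_ac)
    also have "(\<Sum>k\<in>UNIV. \<Sum>j\<in>UNIV. U j * (p k * (D3 z (e k) (e j) \<bullet> e k))) = (\<Sum>j\<in>UNIV. U j * (- \<beta> * \<phi> / u * U j))"
      by (subst sum.swap) (simp only: b1k sum_distrib_left[symmetric])
    also have "\<dots> = - \<beta> * \<phi> / u * (\<Sum>j\<in>UNIV. (U j)\<^sup>2)"
      by (simp add: sum_distrib_left power2_eq_square mult_ac)
    finally show ?thesis by (simp add: split \<phi>)
  qed

  \<comment> \<open>Now the rotation in the plane of \<open>e i0\<close> and \<open>z - sv\<close>, which has unit speed at \<open>z\<close>.\<close>
  define y where "y = z - sv"
  have y: "e i0 \<bullet> y = 0" "y \<noteq> 0" "y \<bullet> z = 1" "z \<bullet> y = 1" "y \<bullet> y = 1 + (\<Sum>k\<in>N. (s k)\<^sup>2)" "y \<bullet> e i0 = 0"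
  proof -
    show yz: "y \<bullet> z = 1" "z \<bullet> y = 1" by (simp_all add: y_def inner_diff_left inner_diff_right zz svz)
    show "e i0 \<bullet> y = 0" "y \<bullet> e i0 = 0" by (simp_all add: y_def inner_diff_left inner_diff_right ee sve0)
    show "y \<noteq> 0" using yz by force
    show "y \<bullet> y = 1 + (\<Sum>k\<in>N. (s k)\<^sup>2)"
      by (simp add: y_def inner_diff_left inner_diff_right svz zz svsv)
  qed
  let ?S = "rotation_gen (e i0) y"
  define s2 where "s2 = (\<Sum>k\<in>N. (s k)\<^sup>2)"
  have S: "?S z = e i0" "?S (e i0) = - y" "?S (- y) = - (1 + s2) *\<^sub>R e i0"
    by (simp_all add: rotation_gen_def y ee s2_def)
  have Sk: "?S (e k) = - s k *\<^sub>R e i0" "?S (- s k *\<^sub>R e i0) = s k *\<^sub>R y" if "k \<in> N" for k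
  proof -
    have "k \<noteq> i0" using that by (simp add: N_def)
    then show "?S (e k) = - s k *\<^sub>R e i0" using that
      by (simp add: rotation_gen_def y_def inner_diff_right ee sve)
    show "?S (- s k *\<^sub>R e i0) = s k *\<^sub>R y" by (simp add: rotation_gen_def y ee)
  qed
  have Ty: "T z y = - T z sv" by (simp add: y_def linear_diff[OF linT] Tz)
  have D3y: "D3 z a y = - T z a - D3 z a sv" for a by (simp add: y_def linear_diff[OF lin3] D3z)
  have Yy: "Y z \<bullet> y = u - (\<Sum>k\<in>N. s k * U k)" by (simp add: y_def inner_diff_right Ysv u_def)
  have p1: "D3 z (e i0) (e i0) \<bullet> y = - r i0 - (\<Sum>k\<in>N. s k * A k)"
    using D3rot(1)[of "e i0" "e i0" z] by (simp add: y_def inner_diff_right D3sv D3z Te ee)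
  have p2: "D3 z (e i0) y \<bullet> e i0 = - r i0 - (\<Sum>k\<in>N. s k * A k)"
    using B0 by (simp add: D3y inner_diff_left Te ee B_def)
  have p3: "T z y \<bullet> y = (\<Sum>k\<in>N. (s k)\<^sup>2 * r k)"
    by (simp add: Ty) (simp add: y_def inner_diff_right Tsvz Tsvsv)
  have a2: "D4 z (e i0) (e i0) (e i0) \<bullet> e i0 + 4 * (D3 z (e i0) (e i0) \<bullet> (- y)) + D3 z (e i0) (- y) \<bullet> e i0
       + 2 * (T z (- y) \<bullet> (- y)) + 2 * (T z (e i0) \<bullet> (- (1 + s2) *\<^sub>R e i0))
     = D i0 + 3 * r i0 + 5 * (\<Sum>k\<in>N. s k * A k) + 2 * (\<Sum>k\<in>N. (s k)\<^sup>2 * r k) - 2 * r i0 * (\<Sum>k\<in>N. (s k)\<^sup>2)"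
    by (simp add: linear_neg[OF lin3] linear_neg[OF linT] p1 p2 p3 e0 D_def s2_def algebra_simps)
  have a2k: "D4 z (e k) (e i0) (e i0) \<bullet> e k + 4 * (D3 z (e k) (e i0) \<bullet> (- s k *\<^sub>R e i0)) + D3 z (e k) (- y) \<bullet> e k
       + 2 * (T z (- s k *\<^sub>R e i0) \<bullet> (- s k *\<^sub>R e i0)) + 2 * (T z (e k) \<bullet> (s k *\<^sub>R y))
     = D k + r k + B k - 4 * s k * A k + 2 * (s k)\<^sup>2 * r i0 - 2 * (s k)\<^sup>2 * r k" if k: "k \<in> N" for k
  proof -
    have "D4 z (e k) (e i0) (e i0) \<bullet> e k = D k" unfolding D_def by (rule D4_exchange[OF z0])
    moreover have "D3 z (e k) (- y) \<bullet> e k = r k + B k"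
      by (simp add: linear_neg[OF lin3] D3y inner_diff_left inner_add_left Te ee B_def)
    moreover have "T z (e k) \<bullet> y = - (s k * r k)"
      by (simp add: Te y_def inner_diff_right ee sve[OF k])
    moreover have "T z (- s k *\<^sub>R e i0) \<bullet> (- s k *\<^sub>R e i0) = (s k)\<^sup>2 * r i0"
      by (simp only: linear_scale[OF linT] Te inner_scaleR_left inner_scaleR_right ee power2_eq_square) simp
    ultimately show ?thesis by (simp only: inner_scaleR_right A_eq) (simp add: power2_eq_square algebra_simps)
  qed
  have w20: "(r i0 - u + (\<Sum>k\<in>N. s k * U k)) * r i0 + 2 * U i0 * A i0
        + u * (D i0 + 3 * r i0 + 5 * (\<Sum>k\<in>N. s k * A k) + 2 * (\<Sum>k\<in>N. (s k)\<^sup>2 * r k) - 2 * r i0 * (\<Sum>k\<in>N. (s k)\<^sup>2))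
        - (1 - \<beta>) * ((r i0)\<^sup>2 + X i0 + (\<Sum>k\<in>N. s k * (r k * U k)))
        + \<epsilon> * (z2 i0 + (\<Sum>k\<in>N. s k * z1 k)) \<le> 0"
  proof -
    have 1: "Y z \<bullet> (- y) + T z (e i0) \<bullet> e i0 = r i0 - u + (\<Sum>k\<in>N. s k * U k)"
      by (simp add: Yy e0)
    have 2: "D3 z (e i0) (e i0) \<bullet> e i0 + 2 * (T z (e i0) \<bullet> (- y)) = A i0"
      by (simp add: Te y A_def)
    have 3: "Y z \<bullet> (D3 z (e i0) (e i0) + T z (- y)) + T z (e i0) \<bullet> T z (e i0)
        = (r i0)\<^sup>2 + X i0 + (\<Sum>k\<in>N. s k * (r k * U k))"
      by (simp add: inner_add_right linear_neg[OF linT] Ty YTsv Te ee X_def power2_eq_square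
          inner_commute[of "Y z" "D3 z (e i0) (e i0)"])
    define EE T0 where "EE = exp (\<mu> * (z \<bullet> q))" and "T0 = (\<Sum>k\<in>N. s k * (e k \<bullet> q))"
    have yq: "- y \<bullet> q = T0 - z \<bullet> q"
      by (simp add: y_def sv_def inner_diff_left inner_sum_left T0_def)
    have zs: "(\<Sum>k\<in>N. s k * z1 k) = EE * (\<mu> * T0)"
      unfolding z1_def EE_def[symmetric] T0_def by (simp add: sum_distrib_left mult_ac)
    have 4: "exp (\<mu> * (z \<bullet> q)) * (\<mu>\<^sup>2 * (e i0 \<bullet> q)\<^sup>2 + \<mu> * (- y \<bullet> q)) = z2 i0 + (\<Sum>k\<in>N. s k * z1 k)"
      unfolding yq zs z2_def EE_def[symmetric] by (simp add: algebra_simps)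
    show ?thesis
      using test_function_variation(2)[where E = "e i0" and y = y and z = z and v = "e i0" and q = q and \<epsilon> = \<epsilon> and \<mu> = \<mu>, OF en y(1,2) max, unfolded S a2 1 2 3 4]
      unfolding e0(1) by (simp only: U_def u_def)
  qed
  have b2: "p i0 * (D i0 + 3 * r i0 + 5 * (\<Sum>k\<in>N. s k * A k) + 2 * (\<Sum>k\<in>N. (s k)\<^sup>2 * r k) - 2 * r i0 * (\<Sum>k\<in>N. (s k)\<^sup>2))
        + (\<Sum>k\<in>N. p k * (D k + r k + B k - 4 * s k * A k + 2 * (s k)\<^sup>2 * r i0 - 2 * (s k)\<^sup>2 * r k))
        + \<beta> * \<phi> / u * (r i0 - u + (\<Sum>k\<in>N. s k * U k)) - \<beta> * (\<beta> + 1) * \<phi> / u\<^sup>2 * (U i0)\<^sup>2 \<ge> 0"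
  proof -
    have 1: "Y z \<bullet> (- y) + T z (e i0) \<bullet> e i0 = r i0 - u + (\<Sum>k\<in>N. s k * U k)"
      by (simp add: Yy e0)
    have 2: "(\<Sum>k\<in>N. p k * (D4 z (e k) (e i0) (e i0) \<bullet> e k + 4 * (D3 z (e k) (e i0) \<bullet> ?S (e k)) + D3 z (e k) (- y) \<bullet> e k
       + 2 * (T z (?S (e k)) \<bullet> ?S (e k)) + 2 * (T z (e k) \<bullet> ?S (?S (e k)))))
      = (\<Sum>k\<in>N. p k * (D k + r k + B k - 4 * s k * A k + 2 * (s k)\<^sup>2 * r i0 - 2 * (s k)\<^sup>2 * r k))"
      by (intro sum.cong refl) (simp only: Sk a2k)
    show ?thesis
      using trace_variation(2)[where E = "e i0" and y = y and z = z, OF en y(1,2) z e x, unfolded S split 1 a2]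
      unfolding p_def[symmetric] 2 u_def[symmetric] \<phi>_def[symmetric] U_def[symmetric] by (simp add: \<phi>_def U_def u_def)
  qed
  show ?thesis
    using variation_algebra[of u p i0 s U r A \<beta> \<epsilon> z1 D X z2 B \<phi>, OF u p s_def w1, folded N_def, OF w2 w20 b2 b1 bX \<phi>]
    by (simp add: r_def)
qed

section \<open>The strong maximum principle\<close>

definition unit_tangents :: "('a \<times> 'a) set" where
  "unit_tangents = {(z, v). norm z = 1 \<and> norm v = 1 \<and> v \<bullet> z = 0}"

lemma eigenframe_exists:
  assumes z: "norm z = 1"
  obtains e :: "'n \<Rightarrow> 'a" and x where "orthonormal_frame z e" "\<And>i. T z (e i) = x $ i *\<^sub>R e i" "x \<in> Gamma_plus"
proof -
  obtain e :: "'n \<Rightarrow> 'a" and x where e: "orthonormal_frame z e" "\<And>i. T z (e i) = x $ i *\<^sub>R e i"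
    using eigenframe[OF dim z] by blast
  have "x $ i > 0" for i
  proof -
    have "e i \<bullet> e i = 1" "e i \<bullet> z = 0" using e(1) by (simp_all add: orthonormal_frame_def)
    then have "T z (e i) \<bullet> e i > 0" by (intro T_pos[OF z]) auto
    then show ?thesis using e(2) \<open>e i \<bullet> e i = 1\<close> by simp
  qed
  then have "x \<in> Gamma_plus" by (simp add: Gamma_plus_def)
  then show ?thesis using that[of e x] e by simp
qed

text \<open>At a maximum point \<open>v\<close> may be replaced by an eigenvector for the largest radius of
curvature, as this can only increase the test function.\<close>

lemma max_point_eigenframe:
  assumes max: "test_max \<epsilon> \<mu> q z v"
  shows "\<exists>(e :: 'n \<Rightarrow> 'a) x i0. orthonormal_frame z e \<and> (\<forall>i. T z (e i) = x $ i *\<^sub>R e i) \<and> x \<in> Gamma_plus \<and>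
    (\<forall>k. x $ k \<le> x $ i0) \<and> test_max \<epsilon> \<mu> q z (e i0)"
proof -
  have z: "norm z = 1" and v: "norm v = 1" "v \<bullet> z = 0" using max by (simp_all add: test_max_def)
  obtain e :: "'n \<Rightarrow> 'a" and x where e: "orthonormal_frame z e" "\<And>i. T z (e i) = x $ i *\<^sub>R e i" "x \<in> Gamma_plus"
    using eigenframe_exists[OF z] by blast
  have "Max (range (\<lambda>k. x $ k)) \<in> range (\<lambda>k. x $ k)" by (intro Max_in) auto
  then obtain i0 where "Max (range (\<lambda>k. x $ k)) = x $ i0" by blast
  then have i0: "x $ k \<le> x $ i0" for k
    using Max_ge[of "range (\<lambda>k. x $ k)" "x $ k"] by simp
  have "T z v \<bullet> v = (\<Sum>i\<in>UNIV. x $ i * (v \<bullet> e i)\<^sup>2)" by (rule quadratic_form_eigenframe(1)[OF dim z e(1,2) v(2)])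
  also have "\<dots> \<le> (\<Sum>i\<in>UNIV. x $ i0 * (v \<bullet> e i)\<^sup>2)" by (intro sum_mono mult_right_mono i0) simp
  also have "\<dots> = x $ i0 * (v \<bullet> v)"
    unfolding quadratic_form_eigenframe(2)[OF dim z e(1,2) v(2)] by (simp add: sum_distrib_left)
  also have "\<dots> = T z (e i0) \<bullet> e i0" using v(1) e(1) by (simp add: norm_eq_1 e(2) orthonormal_frame_def)
  finally have "test_function z v \<le> test_function z (e i0)"
    using support_pos[OF z] by (simp add: test_function_def mult_left_mono)
  moreover have "norm (e i0) = 1" "e i0 \<bullet> z = 0" using e(1) by (simp_all add: orthonormal_frame_def norm_eq_1)
  ultimately have "test_max \<epsilon> \<mu> q z (e i0)" using max unfolding test_max_def by (smt (verit))
  then show ?thesis using e i0 by blast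
qed

text \<open>All terms of \<open>max_point_inequality\<close> are non-negative when \<open>\<epsilon> = 0\<close>, so they vanish. The component
of \<open>Y z\<close> along \<open>e i0\<close> is multiplied by the sum over the other directions, which is positive because there is
at least one other direction.\<close>

lemma tangential_part_vanishes_at_max:
  assumes max: "test_max 0 0 0 z v"
  shows "Y z = (Y z \<bullet> z) *\<^sub>R z"
proof -
  have z: "norm z = 1" using max by (simp add: test_max_def)
  obtain e :: "'n \<Rightarrow> 'a" and x i0 where e: "orthonormal_frame z e" "\<And>i. T z (e i) = x $ i *\<^sub>R e i" "x \<in> Gamma_plus"
    "\<And>k. x $ k \<le> x $ i0" and m: "test_max 0 0 0 z (e i0)"
    using max_point_eigenframe[OF max] by blast
  define N where "N = - {i0}"
  define u where "u = Y z \<bullet> z"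
  define U where "U k = Y z \<bullet> e k" for k
  have u: "u > 0" using support_pos[OF z] by (simp add: u_def)
  have xp: "x $ k > 0" for k using e(3) by (simp add: Gamma_plus_def)
  have px: "P x k * x $ k > 0" for k using P_pos[OF e(3)] xp by simp
  have nn: "0 \<le> P x k" "0 \<le> x $ k" "0 \<le> x $ i0 - x $ k" for k
    using P_pos[OF e(3), of k] xp[of k] e(4)[of k] by simp_all
  have "(1 - \<beta>) * (\<Sum>k\<in>N. P x k * x $ k * (x $ i0 - x $ k))
     + 2 * \<beta> / u * ((\<Sum>k\<in>N. P x k * x $ k * (U k)\<^sup>2) + (U i0)\<^sup>2 * (\<Sum>k\<in>N. P x k * x $ k))
     + (1 - \<beta>) * \<beta> * u powr (-\<beta>) / u * (\<Sum>k\<in>N. (U k)\<^sup>2) \<le> 0"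
    using max_point_inequality[OF e(1,2,3) m] by (simp add: N_def u_def U_def)
  moreover have "(1 - \<beta>) * (\<Sum>k\<in>N. P x k * x $ k * (x $ i0 - x $ k)) \<ge> 0"
    using beta by (intro mult_nonneg_nonneg sum_nonneg nn) simp
  moreover have "(1 - \<beta>) * \<beta> * u powr (-\<beta>) / u * (\<Sum>k\<in>N. (U k)\<^sup>2) \<ge> 0"
    using beta u by (intro mult_nonneg_nonneg divide_nonneg_nonneg sum_nonneg) auto
  moreover have a: "(\<Sum>k\<in>N. P x k * x $ k * (U k)\<^sup>2) \<ge> 0"
    by (intro sum_nonneg mult_nonneg_nonneg nn) simp
  moreover have spos: "(\<Sum>k\<in>N. P x k * x $ k) > 0"
  proof (rule sum_pos)
    have "N \<noteq> {}"
    proof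
      assume "N = {}"
      then have "(UNIV :: 'n set) = {i0}" by (auto simp: N_def)
      then have "CARD('n) = card {i0}" by (rule arg_cong)
      then show False using card_ge_2 by simp
    qed
    then show "N \<noteq> {}" .
  qed (use px in auto)
  moreover have b: "(U i0)\<^sup>2 * (\<Sum>k\<in>N. P x k * x $ k) \<ge> 0" using spos by simp
  ultimately have "2 * \<beta> / u * ((\<Sum>k\<in>N. P x k * x $ k * (U k)\<^sup>2) + (U i0)\<^sup>2 * (\<Sum>k\<in>N. P x k * x $ k)) \<le> 0"
    by linarith
  then have "(\<Sum>k\<in>N. P x k * x $ k * (U k)\<^sup>2) + (U i0)\<^sup>2 * (\<Sum>k\<in>N. P x k * x $ k) \<le> 0"
    using beta u by (simp add: mult_le_0_iff zero_le_divide_iff divide_le_0_iff)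
  then have N1: "(\<Sum>k\<in>N. P x k * x $ k * (U k)\<^sup>2) = 0" and N2: "(U i0)\<^sup>2 * (\<Sum>k\<in>N. P x k * x $ k) = 0"
    using a b by linarith+
  have U0: "U i0 = 0" using N2 spos by (metis less_irrefl mult_eq_0_iff power_eq_0_iff)
  have N0: "\<forall>k\<in>N. P x k * x $ k * (U k)\<^sup>2 = 0"
    using N1 by (subst (asm) sum_nonneg_eq_0_iff) (use px in \<open>simp_all add: less_imp_le\<close>)
  have "U k = 0" for k
  proof (cases "k = i0")
    case False
    then have "P x k * x $ k * (U k)\<^sup>2 = 0" using N0 by (simp add: N_def)
    then show ?thesis using px[of k] by auto
  qed (use U0 in simp)
  then have "(\<Sum>i\<in>UNIV. (Y z \<bullet> e i) *\<^sub>R e i) = 0" by (simp add: U_def)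
  then show ?thesis using orthonormal_frame_expansion[OF dim z e(1), of "Y z"] by simp
qed

lemma continuous_T: "continuous_on {p. fst p \<noteq> 0} (\<lambda>p. T (fst p) (snd p))"
proof -
  have Tc: "continuous_on (- {0}) (\<lambda>z. T z b)" for b
    by (intro continuous_at_imp_continuous_on ballI has_derivative_continuous[OF dT]) simp
  have "continuous_on {p. fst p \<noteq> 0} (\<lambda>p. \<Sum>b\<in>Basis. (snd p \<bullet> b) *\<^sub>R T (fst p) b)"
    by (intro continuous_intros continuous_on_compose2[OF Tc]) auto
  then show ?thesis
    by (rule continuous_on_eq) (use linear_expand_Basis[OF linear_T] in auto)
qed

lemma continuous_Y: "continuous_on (- {0}) Y"
  by (intro continuous_at_imp_continuous_on ballI has_derivative_continuous[OF dY]) simp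

lemma compact_unit_tangents: "compact unit_tangents"
proof -
  have eq: "unit_tangents = (sphere 0 1 \<times> sphere 0 1) \<inter> {p. snd p \<bullet> fst p = 0}"
    by (auto simp: unit_tangents_def)
  have "closed {p :: 'a \<times> 'a. snd p \<bullet> fst p = 0}"
    by (intro closed_Collect_eq continuous_intros)
  then show ?thesis unfolding eq by (intro compact_Int_closed compact_Times compact_sphere)
qed

lemma unit_tangents_nonzero: "unit_tangents \<subseteq> {p. fst p \<noteq> 0}"
  by (auto simp: unit_tangents_def)

lemma unit_tangent_exists:
  assumes "norm z = 1" shows "\<exists>v. (z, v) \<in> unit_tangents"
proof -
  obtain e :: "'n \<Rightarrow> 'a" and x where "orthonormal_frame z e" "\<And>i. T z (e i) = x $ i *\<^sub>R e i" "x \<in> Gamma_plus"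
    using eigenframe_exists[OF assms] by blast
  then show ?thesis using assms
    by (intro exI[of _ "e undefined"]) (auto simp: unit_tangents_def orthonormal_frame_def norm_eq_1)
qed

lemma continuous_quadratic: "continuous_on unit_tangents (\<lambda>p. T (fst p) (snd p) \<bullet> snd p)"
  by (intro continuous_intros continuous_on_subset[OF continuous_T unit_tangents_nonzero])

lemma continuous_Y_fst: "continuous_on unit_tangents (\<lambda>p. Y (fst p))"
  by (rule continuous_on_compose2[OF continuous_Y]) (use unit_tangents_nonzero in \<open>auto intro!: continuous_intros\<close>)

lemma continuous_test_function: "continuous_on unit_tangents (\<lambda>p. test_function (fst p) (snd p))"
  unfolding test_function_def by (intro continuous_intros continuous_quadratic continuous_Y_fst)

lemma unit_tangents_nonempty: "unit_tangents \<noteq> {}"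
proof -
  obtain z :: 'a where "norm z = 1" using vector_choose_size[of 1] by auto
  then show ?thesis using unit_tangent_exists by blast
qed

text \<open>By compactness the radii of curvature lie in a compact box of positive vectors, on which
the continuous positive functions \<open>P _ k\<close> are bounded away from zero and infinity.\<close>

lemma gradient_bounds:
  "\<exists>lo hi. lo > 0 \<and> (\<forall>z (e :: 'n \<Rightarrow> 'a) x k. norm z = 1 \<longrightarrow> orthonormal_frame z e \<longrightarrow> (\<forall>i. T z (e i) = x $ i *\<^sub>R e i) \<longrightarrow> lo \<le> P x k \<and> P x k \<le> hi)"
proof -
  obtain p1 where p1: "p1 \<in> unit_tangents" "\<And>p. p \<in> unit_tangents \<Longrightarrow> T (fst p1) (snd p1) \<bullet> snd p1 \<le> T (fst p) (snd p) \<bullet> snd p"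
    using continuous_attains_inf[OF compact_unit_tangents unit_tangents_nonempty continuous_quadratic] by blast
  obtain p2 where p2: "p2 \<in> unit_tangents" "\<And>p. p \<in> unit_tangents \<Longrightarrow> T (fst p) (snd p) \<bullet> snd p \<le> T (fst p2) (snd p2) \<bullet> snd p2"
    using continuous_attains_sup[OF compact_unit_tangents unit_tangents_nonempty continuous_quadratic] by blast
  define a b where "a = T (fst p1) (snd p1) \<bullet> snd p1" and "b = T (fst p2) (snd p2) \<bullet> snd p2"
  have a: "a > 0"
  proof -
    have "norm (fst p1) = 1" "norm (snd p1) = 1" "snd p1 \<bullet> fst p1 = 0" using p1(1) by (auto simp: unit_tangents_def)
    moreover from this have "snd p1 \<noteq> 0" by force
    ultimately show ?thesis unfolding a_def by (intro T_pos)
  qed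
  define Box :: "(real^'n) set" where "Box = cbox (\<chi> i. a) (\<chi> i. b)"
  have Box: "x \<in> Box \<longleftrightarrow> (\<forall>i. a \<le> x $ i \<and> x $ i \<le> b)" for x
    by (auto simp: Box_def mem_box_cart)
  have inBox: "x \<in> Box" if z: "norm z = 1" and e: "orthonormal_frame z e" "\<And>i. T z (e i) = x $ i *\<^sub>R e i"
    for z and e :: "'n \<Rightarrow> 'a" and x
  proof -
    have "(z, e i) \<in> unit_tangents" for i using z e(1) by (auto simp: unit_tangents_def orthonormal_frame_def norm_eq_1)
    from p1(2)[OF this] p2(2)[OF this] show ?thesis
      using e by (auto simp: Box a_def b_def orthonormal_frame_def)
  qed
  have BG: "Box \<subseteq> Gamma_plus" using Box less_le_trans[OF a] by (auto simp: Gamma_plus_def)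
  have Bc: "compact Box" by (simp add: Box_def)
  have Bne: "Box \<noteq> {}"
  proof -
    obtain z :: 'a where z: "norm z = 1" using vector_choose_size[of 1] by auto
    then obtain e :: "'n \<Rightarrow> 'a" and x where "orthonormal_frame z e" "\<And>i. T z (e i) = x $ i *\<^sub>R e i" "x \<in> Gamma_plus"
      using eigenframe_exists[OF z] by blast
    then show ?thesis using inBox[OF z] by blast
  qed
  have Pc: "continuous_on Box (\<lambda>x. P x i)" for i by (rule continuous_on_subset[OF P_cont BG])
  have "\<forall>i. \<exists>l>0. \<forall>x\<in>Box. l \<le> P x i"
  proof
    fix i
    obtain y where "y \<in> Box" "\<forall>x\<in>Box. P y i \<le> P x i" using continuous_attains_inf[OF Bc Bne Pc] by blast
    then show "\<exists>l>0. \<forall>x\<in>Box. l \<le> P x i" using P_pos BG by blast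
  qed
  then obtain l where l: "\<And>i. l i > 0" "\<And>i x. x \<in> Box \<Longrightarrow> l i \<le> P x i" by metis
  have "\<forall>i. \<exists>h. \<forall>x\<in>Box. P x i \<le> h"
    using continuous_attains_sup[OF Bc Bne Pc] by blast
  then obtain h where h: "\<And>i x. x \<in> Box \<Longrightarrow> P x i \<le> h i" by metis
  show ?thesis
  proof (rule exI[of _ "Min (range l)"], rule exI[of _ "Max (range h)"], intro conjI allI impI)
    show "Min (range l) > 0" using l(1) by (subst Min_gr_iff) auto
    fix z :: 'a and e :: "'n \<Rightarrow> 'a" and x k
    assume "norm z = 1" "orthonormal_frame z e" "\<forall>i. T z (e i) = x $ i *\<^sub>R e i"
    then have x: "x \<in> Box" using inBox by blast
    have "Min (range l) \<le> l k" "h k \<le> Max (range h)" by (auto intro!: Min_le Max_ge)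
    then show "Min (range l) \<le> P x k" "P x k \<le> Max (range h)" using l(2)[OF x, of k] h[OF x, of k] by linarith+
  qed
qed

lemma support_ratio_bound:
  "\<exists>C\<ge>0. \<forall>z v. norm z = 1 \<longrightarrow> norm v = 1 \<longrightarrow> \<bar>(Y z \<bullet> v) / (Y z \<bullet> z)\<bar> \<le> C"
proof -
  have c: "continuous_on (sphere 0 1) Y" by (rule continuous_on_subset[OF continuous_Y]) auto
  have "continuous_on (sphere 0 1) (\<lambda>z. norm (Y z) / (Y z \<bullet> z))"
    by (intro continuous_intros c) (use support_pos in force)
  then have "bounded ((\<lambda>z. norm (Y z) / (Y z \<bullet> z)) ` sphere 0 1)"
    using compact_continuous_image compact_imp_bounded compact_sphere by blast
  then obtain C where bd: "\<forall>x\<in>(\<lambda>z. norm (Y z) / (Y z \<bullet> z)) ` sphere 0 1. norm x \<le> C"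
    unfolding bounded_iff by blast
  have C: "\<bar>norm (Y z) / (Y z \<bullet> z)\<bar> \<le> C" if "norm z = 1" for z
    using bd that by (simp only: ball_simps real_norm_def mem_sphere_0 Set.ball_simps)
  show ?thesis
  proof (intro exI[of _ "\<bar>C\<bar>"] conjI allI impI)
    fix z v :: 'a assume z: "norm z = 1" and v: "norm v = 1"
    have "\<bar>Y z \<bullet> v\<bar> \<le> norm (Y z)" using Cauchy_Schwarz_ineq2[of "Y z" v] v by simp
    then have "\<bar>(Y z \<bullet> v) / (Y z \<bullet> z)\<bar> \<le> norm (Y z) / (Y z \<bullet> z)"
      using support_pos[OF z] by (simp add: abs_divide divide_right_mono)
    also have "\<dots> \<le> \<bar>C\<bar>" using C[OF z] by linarith
    finally show "\<bar>(Y z \<bullet> v) / (Y z \<bullet> z)\<bar> \<le> \<bar>C\<bar>" .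
  qed simp
qed

text \<open>Away from \<open>q\<close> the perturbation contributes a positive amount to \<open>max_point_inequality\<close>, whose
other terms are non-negative.\<close>

lemma no_perturbed_max:
  fixes lo hi C \<mu> \<delta> \<epsilon> :: real and z v q :: 'a
  assumes c: "lo > 0" "\<forall>z (e :: 'n \<Rightarrow> 'a) x k. norm z = 1 \<longrightarrow> orthonormal_frame z e \<longrightarrow> (\<forall>i. T z (e i) = x $ i *\<^sub>R e i) \<longrightarrow> lo \<le> P x k \<and> P x k \<le> hi"
    and C: "C \<ge> 0" "\<forall>z v. norm z = 1 \<longrightarrow> norm v = 1 \<longrightarrow> \<bar>(Y z \<bullet> v) / (Y z \<bullet> z)\<bar> \<le> C"
    and \<mu>: "\<mu> \<ge> 4 * C\<^sup>2 + 1" "\<mu> * lo * \<delta> > 6 * CARD('n) * hi"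
    and \<delta>: "\<delta> > 0" and \<epsilon>: "\<epsilon> > 0" and q: "norm q = 1"
    and far: "z \<bullet> q \<le> 1 - \<delta>" and max: "test_max \<epsilon> \<mu> q z v"
  shows False
proof -
  have z: "norm z = 1" using max by (simp add: test_max_def)
  obtain e :: "'n \<Rightarrow> 'a" and x i0 where e: "orthonormal_frame z e" "\<And>i. T z (e i) = x $ i *\<^sub>R e i" "x \<in> Gamma_plus"
    "\<And>k. x $ k \<le> x $ i0" and m: "test_max \<epsilon> \<mu> q z (e i0)"
    using max_point_eigenframe[OF max] by blast
  define N where "N = - {i0}"
  define u where "u = Y z \<bullet> z"
  define U where "U k = Y z \<bullet> e k" for k
  define p where "p = P x"
  define t where "t = z \<bullet> q"
  define E where "E = exp (\<mu> * t)"
  define Q where "Q k = e k \<bullet> q" for k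
  have u: "u > 0" using support_pos[OF z] by (simp add: u_def)
  have E: "E > 0" by (simp add: E_def)
  have \<mu>0: "\<mu> > 0" using \<mu>(1) zero_le_power2[of C] by linarith
  have xp: "x $ k > 0" for k using e(3) by (simp add: Gamma_plus_def)
  have pp: "p k > 0" for k using P_pos[OF e(3)] by (simp add: p_def)
  have nn: "0 \<le> p k" "0 \<le> x $ k" "0 \<le> x $ i0 - x $ k" for k
    using pp[of k] xp[of k] e(4)[of k] by simp_all
  have ineq: "(1 - \<beta>) * (\<Sum>k\<in>N. p k * x $ k * (x $ i0 - x $ k))
     + 2 * \<beta> / u * ((\<Sum>k\<in>N. p k * x $ k * (U k)\<^sup>2) + (U i0)\<^sup>2 * (\<Sum>k\<in>N. p k * x $ k))
     + (1 - \<beta>) * \<beta> * u powr (-\<beta>) / u * (\<Sum>k\<in>N. (U k)\<^sup>2)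
     + \<epsilon> * (p i0 * (E * (\<mu>\<^sup>2 * (Q i0)\<^sup>2 - \<mu> * t)) + (\<Sum>k\<in>N. p k * (E * (\<mu>\<^sup>2 * (Q k)\<^sup>2 - \<mu> * t)))
       + 2 / u * ((\<Sum>k\<in>N. p k * (E * (\<mu> * Q k)) * U k) - p i0 * (E * (\<mu> * Q i0)) * U i0)) \<le> 0"
    using max_point_inequality[OF e(1,2,3) m]
    unfolding N_def[symmetric] u_def[symmetric] U_def[symmetric] p_def[symmetric] t_def[symmetric] E_def[symmetric] Q_def[symmetric] .
  moreover have "(1 - \<beta>) * (\<Sum>k\<in>N. p k * x $ k * (x $ i0 - x $ k)) \<ge> 0"
    using beta by (intro mult_nonneg_nonneg sum_nonneg nn) simp
  moreover have "(1 - \<beta>) * \<beta> * u powr (-\<beta>) / u * (\<Sum>k\<in>N. (U k)\<^sup>2) \<ge> 0"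
    using beta u by (intro mult_nonneg_nonneg divide_nonneg_nonneg sum_nonneg) auto
  moreover have "2 * \<beta> / u * ((\<Sum>k\<in>N. p k * x $ k * (U k)\<^sup>2) + (U i0)\<^sup>2 * (\<Sum>k\<in>N. p k * x $ k)) \<ge> 0"
    using beta u by (intro mult_nonneg_nonneg divide_nonneg_nonneg add_nonneg_nonneg sum_nonneg nn) auto
  ultimately have "\<epsilon> * (p i0 * (E * (\<mu>\<^sup>2 * (Q i0)\<^sup>2 - \<mu> * t)) + (\<Sum>k\<in>N. p k * (E * (\<mu>\<^sup>2 * (Q k)\<^sup>2 - \<mu> * t)))
       + 2 / u * ((\<Sum>k\<in>N. p k * (E * (\<mu> * Q k)) * U k) - p i0 * (E * (\<mu> * Q i0)) * U i0)) \<le> 0"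
    by linarith
  then have le0: "p i0 * (E * (\<mu>\<^sup>2 * (Q i0)\<^sup>2 - \<mu> * t)) + (\<Sum>k\<in>N. p k * (E * (\<mu>\<^sup>2 * (Q k)\<^sup>2 - \<mu> * t)))
       + 2 / u * ((\<Sum>k\<in>N. p k * (E * (\<mu> * Q k)) * U k) - p i0 * (E * (\<mu> * Q i0)) * U i0) \<le> 0"
    using \<epsilon> by (simp add: mult_le_0_iff)
  have split: "(\<Sum>k\<in>UNIV. g k) = g i0 + (\<Sum>k\<in>N. g k)" for g :: "'n \<Rightarrow> real"
    using sum.remove[of UNIV i0 g] by (simp add: N_def Compl_eq_Diff_UNIV)
  \<comment> \<open>The two signs in front of the gradient terms differ between \<open>i0\<close> and the other directions.\<close>
  define sg where "sg k = (if k = i0 then -1 else 1 :: real)" for k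
  have "p i0 * (E * (\<mu>\<^sup>2 * (Q i0)\<^sup>2 - \<mu> * t)) + (\<Sum>k\<in>N. p k * (E * (\<mu>\<^sup>2 * (Q k)\<^sup>2 - \<mu> * t)))
       + 2 / u * ((\<Sum>k\<in>N. p k * (E * (\<mu> * Q k)) * U k) - p i0 * (E * (\<mu> * Q i0)) * U i0)
     = (E * \<mu>) * (\<Sum>k\<in>UNIV. p k * (\<mu> * (Q k)\<^sup>2 - t + 2 * sg k * Q k * (U k / u)))"
  proof -
    have "(\<Sum>k\<in>N. p k * (E * (\<mu> * Q k)) * U k) = (\<Sum>k\<in>N. sg k * (p k * (E * (\<mu> * Q k)) * U k))"
      by (intro sum.cong refl) (auto simp: sg_def N_def)
    then have "(\<Sum>k\<in>N. p k * (E * (\<mu> * Q k)) * U k) - p i0 * (E * (\<mu> * Q i0)) * U i0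
        = (\<Sum>k\<in>UNIV. sg k * (p k * (E * (\<mu> * Q k)) * U k))"
      by (simp add: split sg_def)
    moreover have "p i0 * (E * (\<mu>\<^sup>2 * (Q i0)\<^sup>2 - \<mu> * t)) + (\<Sum>k\<in>N. p k * (E * (\<mu>\<^sup>2 * (Q k)\<^sup>2 - \<mu> * t)))
       = (\<Sum>k\<in>UNIV. p k * (E * (\<mu>\<^sup>2 * (Q k)\<^sup>2 - \<mu> * t)))" by (simp add: split)
    ultimately have "p i0 * (E * (\<mu>\<^sup>2 * (Q i0)\<^sup>2 - \<mu> * t)) + (\<Sum>k\<in>N. p k * (E * (\<mu>\<^sup>2 * (Q k)\<^sup>2 - \<mu> * t)))
       + 2 / u * ((\<Sum>k\<in>N. p k * (E * (\<mu> * Q k)) * U k) - p i0 * (E * (\<mu> * Q i0)) * U i0)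
      = (\<Sum>k\<in>UNIV. p k * (E * (\<mu>\<^sup>2 * (Q k)\<^sup>2 - \<mu> * t)) + 2 / u * (sg k * (p k * (E * (\<mu> * Q k)) * U k)))"
      by (simp add: sum.distrib sum_distrib_left)
    also have "\<dots> = (E * \<mu>) * (\<Sum>k\<in>UNIV. p k * (\<mu> * (Q k)\<^sup>2 - t + 2 * sg k * Q k * (U k / u)))"
      unfolding sum_distrib_left using u by (intro sum.cong refl) (simp add: field_simps power2_eq_square)
    finally show ?thesis .
  qed
  then have le1: "(\<Sum>k\<in>UNIV. p k * (\<mu> * (Q k)\<^sup>2 - t + 2 * sg k * Q k * (U k / u))) \<le> 0"
    using le0 E \<mu>0 by (simp add: mult_le_0_iff)
  have "(\<Sum>k\<in>UNIV. p k * (\<mu> * (Q k)\<^sup>2 - t - 2 * \<bar>Q k\<bar> * \<bar>U k / u\<bar>))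
     \<le> (\<Sum>k\<in>UNIV. p k * (\<mu> * (Q k)\<^sup>2 - t + 2 * sg k * Q k * (U k / u)))"
  proof (intro sum_mono mult_left_mono)
    fix k
    have "\<bar>2 * sg k * Q k * (U k / u)\<bar> = 2 * \<bar>Q k\<bar> * \<bar>U k / u\<bar>" by (simp add: abs_mult sg_def)
    then show "\<mu> * (Q k)\<^sup>2 - t - 2 * \<bar>Q k\<bar> * \<bar>U k / u\<bar> \<le> \<mu> * (Q k)\<^sup>2 - t + 2 * sg k * Q k * (U k / u)" by linarith
  qed (use pp in \<open>simp add: less_imp_le\<close>)
  moreover have "(\<Sum>k\<in>UNIV. p k * (\<mu> * (Q k)\<^sup>2 - t - 2 * \<bar>Q k\<bar> * \<bar>U k / u\<bar>)) > 0"
  proof (rule hopf_barrier_positive[where lo = lo and hi = hi and \<delta> = \<delta> and C = C])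
    show "lo \<le> p k" "p k \<le> hi" for k using c(2) z e(1,2) by (auto simp: p_def)
    have "q = (q \<bullet> z) *\<^sub>R z + (\<Sum>i\<in>UNIV. (q \<bullet> e i) *\<^sub>R e i)"
      by (rule orthonormal_frame_expansion[OF dim z e(1)])
    from arg_cong[OF this, of "\<lambda>w. w \<bullet> q"]
    have "q \<bullet> q = ((q \<bullet> z) *\<^sub>R z + (\<Sum>i\<in>UNIV. (q \<bullet> e i) *\<^sub>R e i)) \<bullet> q" .
    then have "1 = t\<^sup>2 + (\<Sum>k\<in>UNIV. (Q k)\<^sup>2)"
      using q by (simp add: norm_eq_1 inner_add_left inner_sum_left inner_add_right inner_sum_right t_def Q_def power2_eq_square inner_commute)
    then show "(\<Sum>k\<in>UNIV. (Q k)\<^sup>2) = 1 - t\<^sup>2" by simp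
    show "t \<le> 1 - \<delta>" using far by (simp add: t_def)
    show "\<bar>U k / u\<bar> \<le> C" for k
    proof -
      have "norm (e k) = 1" using e(1) by (simp add: norm_eq_1 orthonormal_frame_def)
      then show ?thesis using C(2) z by (simp add: U_def u_def)
    qed
  qed (use c C \<mu> \<delta> in auto)
  ultimately show False using le1 by linarith
qed

text \<open>If no maximum point lies over \<open>q\<close>, the maximum points stay at a positive distance from \<open>q\<close>.
Near \<open>q\<close> the test function is below its maximum by a definite amount, which a small perturbation
cannot make up for, while at the maximum points the perturbation is positive. So the perturbed
function has its maximum away from \<open>q\<close>.\<close>

lemma tangential_part_vanishes:
  assumes q: "norm q = 1"
  shows "Y q = (Y q \<bullet> q) *\<^sub>R q"
proof -
  obtain lo hi where c: "lo > 0"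
    "\<forall>z (e :: 'n \<Rightarrow> 'a) x k. norm z = 1 \<longrightarrow> orthonormal_frame z e \<longrightarrow> (\<forall>i. T z (e i) = x $ i *\<^sub>R e i) \<longrightarrow> lo \<le> P x k \<and> P x k \<le> hi"
    using gradient_bounds by blast
  obtain C where C: "C \<ge> 0" "\<forall>z v. norm z = 1 \<longrightarrow> norm v = 1 \<longrightarrow> \<bar>(Y z \<bullet> v) / (Y z \<bullet> z)\<bar> \<le> C"
    using support_ratio_bound by blast
  obtain p0 where p0: "p0 \<in> unit_tangents" "\<And>p. p \<in> unit_tangents \<Longrightarrow> test_function (fst p) (snd p) \<le> test_function (fst p0) (snd p0)"
    using continuous_attains_sup[OF compact_unit_tangents unit_tangents_nonempty continuous_test_function] by blast
  define m where "m = test_function (fst p0) (snd p0)"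
  show ?thesis
  proof (cases "\<exists>v. (q, v) \<in> unit_tangents \<and> test_function q v = m")
    case True
    then obtain v where v: "(q, v) \<in> unit_tangents" "test_function q v = m" by blast
    show ?thesis
    proof (rule tangential_part_vanishes_at_max)
      show "test_max 0 0 0 q v"
        using p0(2) v by (force simp: test_max_def unit_tangents_def m_def)
    qed
  next
    case False
    define K0 where "K0 = {p \<in> unit_tangents. test_function (fst p) (snd p) = m}"
    have "closedin (top_of_set unit_tangents) K0"
      unfolding K0_def by (rule continuous_closedin_preimage_constant[OF continuous_test_function])
    then have K0c: "compact K0" using compact_unit_tangents closedin_compact by blast
    have "p0 \<in> K0" using p0(1) by (simp add: K0_def m_def)
    then have K0ne: "K0 \<noteq> {}" by blast
    obtain p1 where p1: "p1 \<in> K0" "\<And>p. p \<in> K0 \<Longrightarrow> fst p \<bullet> q \<le> fst p1 \<bullet> q"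
    proof -
      have "continuous_on K0 (\<lambda>p. fst p \<bullet> q)" by (intro continuous_intros)
      from continuous_attains_sup[OF K0c K0ne this] show ?thesis using that by blast
    qed
    have p1n: "norm (fst p1) = 1" using p1(1) by (auto simp: K0_def unit_tangents_def)
    have lt1: "fst p1 \<bullet> q < 1"
    proof -
      have "fst p1 \<bullet> q \<le> 1" using norm_cauchy_schwarz[of "fst p1" q] p1n q by simp
      moreover have "fst p1 \<bullet> q \<noteq> 1"
      proof
        assume "fst p1 \<bullet> q = 1"
        then have "(fst p1 - q) \<bullet> (fst p1 - q) = 0"
          using p1n q by (simp add: inner_diff_left inner_diff_right norm_eq_1 inner_commute)
        then have "fst p1 = q" by simp
        then show False using False p1(1) by (cases p1) (auto simp: K0_def)
      qed
      ultimately show ?thesis by simp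
    qed
    \<comment> \<open>No maximum point lies in the set \<open>F\<close> of pairs over the cap \<open>z \<bullet> q \<ge> 1 - \<delta>\<close>.\<close>
    define \<delta> where "\<delta> = (1 - fst p1 \<bullet> q) / 2"
    have \<delta>: "\<delta> > 0" using lt1 by (simp add: \<delta>_def)
    define F where "F = {p \<in> unit_tangents. fst p \<bullet> q \<ge> 1 - \<delta>}"
    have "F = unit_tangents \<inter> {p. 1 - \<delta> \<le> fst p \<bullet> q}" by (auto simp: F_def)
    moreover have "closed {p :: 'a \<times> 'a. 1 - \<delta> \<le> fst p \<bullet> q}" by (intro closed_Collect_le continuous_intros)
    ultimately have Fc: "compact F" using compact_unit_tangents by (simp add: compact_Int_closed)
    obtain v where "(q, v) \<in> unit_tangents" using unit_tangent_exists[OF q] by blast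
    then have Fne: "F \<noteq> {}" using q \<delta> by (auto simp: F_def norm_eq_1)
    have "continuous_on F (\<lambda>p. test_function (fst p) (snd p))"
      by (rule continuous_on_subset[OF continuous_test_function]) (auto simp: F_def)
    then obtain p2 where p2: "p2 \<in> F" "\<And>p. p \<in> F \<Longrightarrow> test_function (fst p) (snd p) \<le> test_function (fst p2) (snd p2)"
      using continuous_attains_sup[OF Fc Fne] by blast
    have "p2 \<notin> K0" using p1(2)[of p2] p2(1) \<delta> lt1 by (auto simp: F_def \<delta>_def field_simps)
    then have p2m: "test_function (fst p2) (snd p2) < m"
      using p0(2)[of p2] p2(1) by (auto simp: K0_def F_def m_def)
    define \<mu> where "\<mu> = 4 * C\<^sup>2 + 1 + 6 * CARD('n) * \<bar>hi\<bar> / (lo * \<delta>)"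
    have \<mu>1: "\<mu> \<ge> 4 * C\<^sup>2 + 1" using c(1) \<delta> by (simp add: \<mu>_def)
    have \<mu>2: "\<mu> * lo * \<delta> > 6 * CARD('n) * hi"
    proof -
      have "\<mu> * lo * \<delta> = (4 * C\<^sup>2 + 1) * (lo * \<delta>) + 6 * CARD('n) * \<bar>hi\<bar>"
        using c(1) \<delta> by (simp add: \<mu>_def field_simps)
      moreover have "(4 * C\<^sup>2 + 1) * (lo * \<delta>) > 0" using c(1) \<delta> by (intro mult_pos_pos add_nonneg_pos) auto
      moreover have "6 * real CARD('n) * hi \<le> 6 * real CARD('n) * \<bar>hi\<bar>" by (intro mult_left_mono) auto
      ultimately show ?thesis unfolding of_nat_mult of_nat_numeral by linarith
    qed
    have \<mu>0: "\<mu> > 0" using \<mu>1 zero_le_power2[of C] by linarith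
    \<comment> \<open>The perturbation is at most \<open>exp \<mu>\<close>, so on \<open>F\<close> this \<open>\<epsilon>\<close> closes only half of the gap below \<open>m\<close>.\<close>
    define \<epsilon> where "\<epsilon> = (m - test_function (fst p2) (snd p2)) / (2 * exp \<mu>)"
    have \<epsilon>: "\<epsilon> > 0" using p2m by (simp add: \<epsilon>_def)
    define Wp where "Wp p = test_function (fst p) (snd p) + \<epsilon> * exp (\<mu> * (fst p \<bullet> q))" for p
    have "continuous_on unit_tangents Wp"
      unfolding Wp_def[abs_def] by (intro continuous_intros continuous_test_function)
    then obtain p3 where p3: "p3 \<in> unit_tangents" "\<And>p. p \<in> unit_tangents \<Longrightarrow> Wp p \<le> Wp p3"
      using continuous_attains_sup[OF compact_unit_tangents unit_tangents_nonempty] by blast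
    have "Wp p3 > m" 
    proof -
      have "\<epsilon> * exp (\<mu> * (fst p0 \<bullet> q)) > 0" using \<epsilon> by simp
      then have "m < Wp p0" by (simp add: Wp_def m_def)
      then show ?thesis using p3(2)[OF p0(1)] by linarith
    qed
    have "p3 \<notin> F"
    proof
      assume F: "p3 \<in> F"
      have "fst p3 \<bullet> q \<le> 1"
        using norm_cauchy_schwarz[of "fst p3" q] p3(1) q by (auto simp: unit_tangents_def)
      then have "exp (\<mu> * (fst p3 \<bullet> q)) \<le> exp \<mu>" using \<mu>0 by simp
      then have "\<epsilon> * exp (\<mu> * (fst p3 \<bullet> q)) \<le> \<epsilon> * exp \<mu>" using \<epsilon> by simp
      also have "\<dots> = (m - test_function (fst p2) (snd p2)) / 2" by (simp add: \<epsilon>_def)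
      finally have "Wp p3 \<le> test_function (fst p2) (snd p2) + (m - test_function (fst p2) (snd p2)) / 2"
        using p2(2)[OF F] unfolding Wp_def by linarith
      moreover have "b < m \<Longrightarrow> m < a \<Longrightarrow> \<not> a \<le> b + (m - b) / 2" for a b m :: real by (simp add: field_simps)
      ultimately show False using \<open>Wp p3 > m\<close> p2m by blast
    qed
    then have "fst p3 \<bullet> q \<le> 1 - \<delta>" using p3(1) by (auto simp: F_def)
    moreover have "test_max \<epsilon> \<mu> q (fst p3) (snd p3)"
      using p3 by (force simp: test_max_def Wp_def unit_tangents_def)
    ultimately have False
      using no_perturbed_max[OF c C \<mu>1 \<mu>2 \<delta> \<epsilon> q] by blast
    then show ?thesis ..
  qed
qed

text \<open>When \<open>Y\<close> is radial, \<open>z \<mapsto> H z / norm z\<close> has derivative zero on the connected complement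
of the origin.\<close>

lemma support_map_is_homothety:
  assumes hom: "\<And>z. z \<noteq> 0 \<Longrightarrow> Y z = Y ((1 / norm z) *\<^sub>R z)"
  shows "\<exists>\<rho>>0. \<forall>z. norm z = 1 \<longrightarrow> Y z = \<rho> *\<^sub>R z"
proof -
  define c where "c z = (Y z \<bullet> z) / (norm z)\<^sup>2" for z
  have rad: "Y z = c z *\<^sub>R z" if z: "z \<noteq> 0" for z
  proof -
    have "norm ((1 / norm z) *\<^sub>R z) = 1" using z by simp
    from tangential_part_vanishes[OF this] have "Y z = (Y z \<bullet> ((1 / norm z) *\<^sub>R z)) *\<^sub>R ((1 / norm z) *\<^sub>R z)"
      using hom[OF z] by simp
    then show ?thesis by (simp add: c_def power2_eq_square)
  qed
  define g where "g z = (Y z \<bullet> z) / norm z" for z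
  have dg: "(g has_derivative (\<lambda>v. 0)) (at z)" if z: "z \<noteq> 0" for z
  proof -
    have nz: "norm z \<noteq> 0" using z by simp
    have "((\<lambda>z. Y z \<bullet> z) has_derivative (\<lambda>v. Y z \<bullet> v)) (at z)"
    proof -
      have "((\<lambda>z. Y z \<bullet> z) has_derivative (\<lambda>v. Y z \<bullet> v + T z v \<bullet> z)) (at z)"
        by (rule has_derivative_inner[OF dY[OF z] has_derivative_ident])
      then show ?thesis using T_sym[OF z, of _ z] T_radial[OF z] by simp
    qed
    from has_derivative_divide'[OF this has_derivative_norm[OF z] nz]
    have "(g has_derivative (\<lambda>v. ((Y z \<bullet> v) * norm z - (Y z \<bullet> z) * (v \<bullet> sgn z)) / (norm z * norm z))) (at z)"
      by (simp add: g_def[abs_def] inner_commute)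
    moreover have "((Y z \<bullet> v) * norm z - (Y z \<bullet> z) * (v \<bullet> sgn z)) / (norm z * norm z) = 0" for v
    proof -
      have "z \<bullet> z = norm z * norm z" by (simp add: dot_square_norm power2_eq_square)
      then show ?thesis using nz
        by (subst (1 2) rad[OF z]) (simp add: sgn_div_norm inner_commute field_simps)
    qed
    ultimately show ?thesis by simp
  qed
  have "connected (- {0 :: 'a})" by (rule connected_punctured_universe) (use dim card_ge_2 in simp)
  then have gconst: "g x = g y" if "x \<noteq> 0" "y \<noteq> 0" for x y
    by (rule has_derivative_zero_unique_connected[OF open_nonzero]) (use dg that in auto)
  obtain z1 :: 'a where z1: "norm z1 = 1" using vector_choose_size[of 1] by auto
  define \<rho> where "\<rho> = g z1"
  have \<rho>: "g z = \<rho>" if "z \<noteq> 0" for z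
    unfolding \<rho>_def using z1 that by (intro gconst) auto
  have eq: "Y z = \<rho> *\<^sub>R z" if z: "norm z = 1" for z
  proof -
    have "z \<noteq> 0" using z by force
    then show ?thesis using tangential_part_vanishes[OF z] \<rho>[of z] z by (simp add: g_def)
  qed
  have "\<rho> > 0" using support_pos[OF z1] eq[OF z1] z1 by (simp add: norm_eq_1)
  then show ?thesis using eq by blast
qed

end

section \<open>Convex hypersurfaces in a chart\<close>

lemma frechet_derivative_expand:
  fixes g :: "real^'n::finite \<Rightarrow> 'b::real_normed_vector"
  assumes "g differentiable at y"
  shows "frechet_derivative g (at y) v = (\<Sum>i\<in>UNIV. v $ i *\<^sub>R partial_deriv i g y)"
proof -
  have lin: "linear (frechet_derivative g (at y))" by (rule linear_frechet_derivative[OF assms])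
  have "v = (\<Sum>i\<in>UNIV. v $ i *\<^sub>R axis i 1)"
    using basis_expansion[of v] by (simp add: scalar_mult_eq_scaleR)
  then have "frechet_derivative g (at y) v = frechet_derivative g (at y) (\<Sum>i\<in>UNIV. v $ i *\<^sub>R axis i 1)"
    by (rule arg_cong)
  then show ?thesis using lin by (simp add: linear_sum linear_scale partial_deriv_def)
qed

lemma vector_matrix_mult_assoc: "(x v* A) v* B = x v* ((A :: real^'n^'m) ** (B :: real^'k^'n))"
  by (simp add: vector_matrix_mul_assoc)

lemma det_neq_0_left_kernel:
  fixes A :: "real^'n::finite^'n"
  assumes "det A \<noteq> 0" "x v* A = 0" shows "x = 0"
proof -
  obtain B where "A ** B = mat 1" using assms(1) invertible_det_nz[of A] by (auto simp: invertible_def)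
  then have "(x v* A) v* B = x" by (simp add: vector_matrix_mult_assoc vector_matrix_mul_rid)
  then show ?thesis using assms(2) by (simp add: vector_matrix_mult_0)
qed

text \<open>The rows of \<open>C\<close> are left eigenvectors of \<open>W\<close>, so \<open>C\<close> conjugates \<open>W\<close> to a diagonal matrix.\<close>

lemma det_similar_to_diagonal:
  fixes W C :: "real^'n::finite^'n"
  assumes C: "\<And>i. row i C v* W = c i *\<^sub>R row i C" and inj: "\<And>a. a v* C = 0 \<Longrightarrow> a = 0"
  shows "det (mat t - W) = (\<Prod>i\<in>UNIV. t - c i)"
proof -
  have dC: "det C \<noteq> 0"
  proof
    assume "det C = 0"
    then have "\<not> invertible (transpose C)" by (simp add: invertible_det_nz)
    then obtain a where "a \<noteq> 0" "transpose C *v a = 0"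
      using matrix_left_invertible_ker[of "transpose C"] invertible_left_inverse[of "transpose C"] by blast
    then show False using inj[of a] by simp
  qed
  define D where "D = (\<chi> i j. if i = j then t - c i else (0::real))"
  have "C ** (mat t - W) = D ** C"
  proof -
    have "(C ** (mat t - W)) $ i $ j = (D ** C) $ i $ j" for i j
    proof -
      have "(row i C v* W) $ j = (c i *\<^sub>R row i C) $ j" using C by simp
      then have "(\<Sum>k\<in>UNIV. C $ i $ k * W $ k $ j) = c i * C $ i $ j"
        by (simp add: vector_matrix_mult_def row_def mult.commute)
      then show ?thesis
        by (simp add: matrix_matrix_mult_def D_def mat_def right_diff_distrib sum_subtractf left_diff_distrib
            if_distrib[of "\<lambda>x. _ * x"] if_distrib[of "\<lambda>x. x * _"] cong: if_cong)
    qed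
    then show ?thesis by (simp add: vec_eq_iff)
  qed
  then have "det C * det (mat t - W) = det D * det C" by (metis det_mul)
  then have "det (mat t - W) = det D" using dC by simp
  also have "\<dots> = (\<Prod>i\<in>UNIV. t - c i)" by (subst det_diagonal) (auto simp: D_def)
  finally show ?thesis .
qed

lemma injective_range_orthogonal_complement:
  fixes L :: "real^'n::finite \<Rightarrow> 'a::euclidean_space"
  assumes dim: "DIM('a) = CARD('n) + 1" and n: "norm n = 1" and lin: "linear L" and inj: "inj L"
    and orth: "\<And>\<xi>. L \<xi> \<bullet> n = 0" and w: "w \<bullet> n = 0"
  shows "\<exists>\<zeta>. w = L \<zeta>"
proof -
  have dimr: "dim (range L) = CARD('n)"
    using dim_image_eq[OF lin, of UNIV] inj by (simp add: inj_on_def inj_def)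
  have "subspace (range L)" using lin by (simp add: linear_subspace_image)
  moreover have "subspace {v. v \<bullet> n = 0}" by (auto simp: subspace_def inner_left_distrib)
  moreover have "range L \<subseteq> {v. v \<bullet> n = 0}" using orth by blast
  moreover have "dim {v. v \<bullet> n = 0} \<le> dim (range L)"
    using dimr dim_orthogonal_complement_unit[OF n] dim by simp
  ultimately have "range L = {v. v \<bullet> n = 0}" using subspace_dim_equal by blast
  then show ?thesis using w by blast
qed

locale convex_hypersurface =
  fixes M :: "'m::t2_space set"
    and A :: "('m, 'n::finite) atlas"
    and X \<nu> :: "'m \<Rightarrow> 'a::euclidean_space"
    and \<kappa> :: "'m \<Rightarrow> real^'n"
  assumes n_ge_2: "CARD('n) \<ge> 2"
    and ambient: "DIM('a) = CARD('n) + 1"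
    and manifold: "closed_manifold M A"
    and immersion: "smooth_immersion A X"
    and normal: "outward_unit_normal M A X \<nu>"
    and curvatures: "principal_curvatures A X \<nu> \<kappa>"
    and strictly_convex: "\<forall>p\<in>M. \<kappa> p \<in> Gamma_plus"
begin

lemma chart:
  assumes "(V, \<psi>) \<in> A"
  shows "open V" "openin (top_of_set M) (\<psi> ` V)" "\<exists>\<phi>. homeomorphism V (\<psi> ` V) \<psi> \<phi>" "\<psi> ` V \<subseteq> M"
    "smooth_on V (X \<circ> \<psi>)" "smooth_on V (\<nu> \<circ> \<psi>)"
    "\<And>y. y \<in> V \<Longrightarrow> inj (frechet_derivative (X \<circ> \<psi>) (at y))"
    "\<And>y i. y \<in> V \<Longrightarrow> partial_deriv i (X \<circ> \<psi>) y \<bullet> \<nu> (\<psi> y) = 0"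
    "\<And>y. y \<in> V \<Longrightarrow> eigenvalue_vector (weingarten_matrix X \<nu> \<psi> y) (\<kappa> (\<psi> y))"
proof -
  have sa: "smooth_atlas M A" using manifold by (simp add: closed_manifold_def)
  have "case (V, \<psi>) of (V, \<psi>) \<Rightarrow> open V \<and> openin (top_of_set M) (\<psi> ` V) \<and> (\<exists>\<phi>. homeomorphism V (\<psi> ` V) \<psi> \<phi>)"
    using sa assms unfolding smooth_atlas_def by blast
  then show "open V" "openin (top_of_set M) (\<psi> ` V)" "\<exists>\<phi>. homeomorphism V (\<psi> ` V) \<psi> \<phi>" by simp_all
  then show "\<psi> ` V \<subseteq> M" using openin_imp_subset by blast
  show "smooth_on V (X \<circ> \<psi>)" "\<And>y. y \<in> V \<Longrightarrow> inj (frechet_derivative (X \<circ> \<psi>) (at y))"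
    using immersion assms unfolding smooth_immersion_def smooth_map_def by fast+
  show "smooth_on V (\<nu> \<circ> \<psi>)" "\<And>y i. y \<in> V \<Longrightarrow> partial_deriv i (X \<circ> \<psi>) y \<bullet> \<nu> (\<psi> y) = 0"
    using normal assms unfolding outward_unit_normal_def smooth_map_def by fast+
  show "\<And>y. y \<in> V \<Longrightarrow> eigenvalue_vector (weingarten_matrix X \<nu> \<psi> y) (\<kappa> (\<psi> y))"
    using curvatures assms unfolding principal_curvatures_def by fast
qed

lemma norm_normal: "p \<in> M \<Longrightarrow> norm (\<nu> p) = 1"
  using normal by (simp add: outward_unit_normal_def)

lemma chart_exists:
  assumes "p \<in> M" obtains V \<psi> y where "(V, \<psi>) \<in> A" "y \<in> V" "\<psi> y = p"
proof -
  have "(\<Union>(V, \<psi>)\<in>A. \<psi> ` V) = M" using manifold by (simp add: closed_manifold_def smooth_atlas_def)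
  then show ?thesis using assms that by blast
qed

lemma M_facts: "compact M" "connected M" "M \<noteq> {}"
  using manifold by (simp_all add: closed_manifold_def)

context
  fixes V \<psi> assumes ch: "(V, \<psi>) \<in> A"
begin

lemma chart_derivatives:
  assumes y: "y \<in> V"
  shows "((X \<circ> \<psi>) has_derivative frechet_derivative (X \<circ> \<psi>) (at y)) (at y)"
    "((\<nu> \<circ> \<psi>) has_derivative frechet_derivative (\<nu> \<circ> \<psi>) (at y)) (at y)"
    "\<And>i. (partial_deriv i (X \<circ> \<psi>) has_derivative frechet_derivative (partial_deriv i (X \<circ> \<psi>)) (at y)) (at y)"
    "\<And>i j. partial_deriv i (partial_deriv j (X \<circ> \<psi>)) y = partial_deriv j (partial_deriv i (X \<circ> \<psi>)) y"
proof -
  have k: "Ck_on k V (X \<circ> \<psi>)" "Ck_on k V (\<nu> \<circ> \<psi>)" for k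
    using chart(5,6)[OF ch] by (simp_all add: smooth_on_def)
  show "((X \<circ> \<psi>) has_derivative frechet_derivative (X \<circ> \<psi>) (at y)) (at y)"
    by (rule Ck_on_has_derivative[OF k(1) y])
  show "((\<nu> \<circ> \<psi>) has_derivative frechet_derivative (\<nu> \<circ> \<psi>) (at y)) (at y)"
    by (rule Ck_on_has_derivative[OF k(2) y])
  have "Ck_on (Suc 0) V (partial_deriv i (X \<circ> \<psi>))" for i
    using k(1)[of "Suc (Suc 0)"] unfolding partial_deriv_def[abs_def] Ck_on.simps(2)[of "Suc 0"] by blast
  then show "(partial_deriv i (X \<circ> \<psi>) has_derivative frechet_derivative (partial_deriv i (X \<circ> \<psi>)) (at y)) (at y)" for i
    by (rule Ck_on_has_derivative[OF _ y])
  show "partial_deriv i (partial_deriv j (X \<circ> \<psi>)) y = partial_deriv j (partial_deriv i (X \<circ> \<psi>)) y" for i j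
    unfolding partial_deriv_def[abs_def]
    by (rule Ck_on_second_derivative_commute[OF chart(1)[OF ch] y k(1)])
qed

text \<open>The third claim is the symmetry of second derivatives; the first two come from
differentiating \<open>\<nu> \<bullet> \<nu> = 1\<close> and the orthogonality of \<open>\<nu>\<close> to the tangent vectors.\<close>

lemma weingarten_equation:
  assumes y: "y \<in> V"
  shows "partial_deriv i (\<nu> \<circ> \<psi>) y \<bullet> \<nu> (\<psi> y) = 0"
    and "partial_deriv i (\<nu> \<circ> \<psi>) y \<bullet> partial_deriv j (X \<circ> \<psi>) y = second_fundamental_form X \<nu> \<psi> y $ i $ j"
    and "second_fundamental_form X \<nu> \<psi> y $ i $ j = second_fundamental_form X \<nu> \<psi> y $ j $ i"
proof -
  let ?N = "frechet_derivative (\<nu> \<circ> \<psi>) (at y)"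
  have dN: "((\<lambda>y. \<nu> (\<psi> y)) has_derivative ?N) (at y)"
    using chart_derivatives(2)[OF y] by (simp add: o_def)
  have unit: "\<nu> (\<psi> w) \<bullet> \<nu> (\<psi> w) = 1" if "w \<in> V" for w
    using norm_normal chart(4)[OF ch] that by (auto simp: norm_eq_1)
  have "((\<lambda>w. \<nu> (\<psi> w) \<bullet> \<nu> (\<psi> w)) has_derivative (\<lambda>v. \<nu> (\<psi> y) \<bullet> ?N v + ?N v \<bullet> \<nu> (\<psi> y))) (at y)"
    by (rule has_derivative_inner[OF dN dN])
  moreover have "((\<lambda>w. \<nu> (\<psi> w) \<bullet> \<nu> (\<psi> w)) has_derivative (\<lambda>v. 0)) (at y)"
    by (rule has_derivative_transform_within_open[OF has_derivative_const[of 1] chart(1)[OF ch] y]) (simp add: unit)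
  ultimately have "(\<lambda>v. \<nu> (\<psi> y) \<bullet> ?N v + ?N v \<bullet> \<nu> (\<psi> y)) = (\<lambda>v. 0)" by (rule has_derivative_unique)
  from fun_cong[OF this] show "partial_deriv i (\<nu> \<circ> \<psi>) y \<bullet> \<nu> (\<psi> y) = 0"
    by (simp add: partial_deriv_def inner_commute)
  have "((\<lambda>w. partial_deriv j (X \<circ> \<psi>) w \<bullet> \<nu> (\<psi> w)) has_derivative (\<lambda>v. partial_deriv j (X \<circ> \<psi>) y \<bullet> ?N v
      + frechet_derivative (partial_deriv j (X \<circ> \<psi>)) (at y) v \<bullet> \<nu> (\<psi> y))) (at y)"
    by (rule has_derivative_inner[OF chart_derivatives(3)[OF y] dN])
  moreover have "((\<lambda>w. partial_deriv j (X \<circ> \<psi>) w \<bullet> \<nu> (\<psi> w)) has_derivative (\<lambda>v. 0)) (at y)"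
    by (rule has_derivative_transform_within_open[OF has_derivative_const[of 0] chart(1)[OF ch] y])
       (simp add: chart(8)[OF ch])
  ultimately have "(\<lambda>v. partial_deriv j (X \<circ> \<psi>) y \<bullet> ?N v
      + frechet_derivative (partial_deriv j (X \<circ> \<psi>)) (at y) v \<bullet> \<nu> (\<psi> y)) = (\<lambda>v. 0)" by (rule has_derivative_unique)
  from fun_cong[OF this, of "axis i 1"]
  have "partial_deriv j (X \<circ> \<psi>) y \<bullet> partial_deriv i (\<nu> \<circ> \<psi>) y = - (partial_deriv i (partial_deriv j (X \<circ> \<psi>)) y \<bullet> \<nu> (\<psi> y))"
    by (simp add: partial_deriv_def[of i])
  then show "partial_deriv i (\<nu> \<circ> \<psi>) y \<bullet> partial_deriv j (X \<circ> \<psi>) y = second_fundamental_form X \<nu> \<psi> y $ i $ j"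
    by (simp add: second_fundamental_form_def inner_commute)
  show "second_fundamental_form X \<nu> \<psi> y $ i $ j = second_fundamental_form X \<nu> \<psi> y $ j $ i"
    by (simp add: second_fundamental_form_def chart_derivatives(4)[OF y, of i j])
qed

text \<open>The determinant of the Weingarten matrix is up to sign the product of the principal
curvatures, which are positive.\<close>

lemma weingarten_nonsingular:
  assumes y: "y \<in> V" and x: "x v* second_fundamental_form X \<nu> \<psi> y = 0"
  shows "x = 0"
proof (rule det_neq_0_left_kernel)
  let ?W = "weingarten_matrix X \<nu> \<psi> y"
  have kp: "\<kappa> (\<psi> y) $ i > 0" for i
    using strictly_convex chart(4)[OF ch] y by (auto simp: Gamma_plus_def)
  have "det (mat 0 - ?W) = (\<Prod>i\<in>UNIV. 0 - \<kappa> (\<psi> y) $ i)"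
    using chart(9)[OF ch y] unfolding eigenvalue_vector_def by blast
  then show "det (mat 0 - ?W) \<noteq> 0" using kp by (simp add: less_imp_neq[symmetric] prod_zero_iff)
  have "x v* ?W = 0"
    unfolding weingarten_matrix_def using x by (simp add: vector_matrix_mult_assoc[symmetric] vector_matrix_mult_0)
  then show "x v* (mat 0 - ?W) = 0"
    by (simp add: vector_matrix_mult_def vec_eq_iff mat_def sum_negf)
qed

lemma tangent_derivative_X:
  assumes "y \<in> V"
  shows "frechet_derivative (X \<circ> \<psi>) (at y) \<xi> = (\<Sum>i\<in>UNIV. \<xi> $ i *\<^sub>R partial_deriv i (X \<circ> \<psi>) y)"
  by (rule frechet_derivative_expand) (use chart_derivatives(1)[OF assms] in \<open>auto simp: differentiable_def\<close>)

lemma tangent_derivative_normal: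
  assumes "y \<in> V"
  shows "frechet_derivative (\<nu> \<circ> \<psi>) (at y) \<xi> = (\<Sum>i\<in>UNIV. \<xi> $ i *\<^sub>R partial_deriv i (\<nu> \<circ> \<psi>) y)"
  by (rule frechet_derivative_expand) (use chart_derivatives(2)[OF assms] in \<open>auto simp: differentiable_def\<close>)

lemma normal_derivative_orthogonal:
  assumes "y \<in> V" shows "frechet_derivative (\<nu> \<circ> \<psi>) (at y) \<xi> \<bullet> \<nu> (\<psi> y) = 0"
  by (simp add: tangent_derivative_normal[OF assms] inner_sum_left weingarten_equation(1)[OF assms])

lemma X_derivative_orthogonal:
  assumes "y \<in> V" shows "frechet_derivative (X \<circ> \<psi>) (at y) \<xi> \<bullet> \<nu> (\<psi> y) = 0"
  by (simp add: tangent_derivative_X[OF assms] inner_sum_left chart(8)[OF ch assms])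

lemma normal_derivative_X_derivative:
  assumes "y \<in> V"
  shows "frechet_derivative (\<nu> \<circ> \<psi>) (at y) \<xi> \<bullet> frechet_derivative (X \<circ> \<psi>) (at y) \<eta>
    = frechet_derivative (\<nu> \<circ> \<psi>) (at y) \<eta> \<bullet> frechet_derivative (X \<circ> \<psi>) (at y) \<xi>"
proof -
  have F: "frechet_derivative (\<nu> \<circ> \<psi>) (at y) \<xi> \<bullet> frechet_derivative (X \<circ> \<psi>) (at y) \<eta>
     = (\<Sum>i\<in>UNIV. \<Sum>j\<in>UNIV. \<xi> $ i * \<eta> $ j * second_fundamental_form X \<nu> \<psi> y $ i $ j)" for \<xi> \<eta>
    unfolding tangent_derivative_normal[OF assms] tangent_derivative_X[OF assms]
    by (simp add: inner_sum_left inner_sum_right weingarten_equation(2)[OF assms] sum_distrib_left mult_ac)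
       (rule sum.swap)
  have "frechet_derivative (\<nu> \<circ> \<psi>) (at y) \<xi> \<bullet> frechet_derivative (X \<circ> \<psi>) (at y) \<eta>
     = (\<Sum>i\<in>UNIV. \<Sum>j\<in>UNIV. \<xi> $ i * \<eta> $ j * second_fundamental_form X \<nu> \<psi> y $ i $ j)" by (rule F)
  also have "\<dots> = (\<Sum>j\<in>UNIV. \<Sum>i\<in>UNIV. \<xi> $ i * \<eta> $ j * second_fundamental_form X \<nu> \<psi> y $ i $ j)"
    by (rule sum.swap)
  also have "\<dots> = (\<Sum>j\<in>UNIV. \<Sum>i\<in>UNIV. \<eta> $ j * \<xi> $ i * second_fundamental_form X \<nu> \<psi> y $ j $ i)"
  proof (intro sum.cong refl)
    fix i j show "\<xi> $ i * \<eta> $ j * second_fundamental_form X \<nu> \<psi> y $ i $ j = \<eta> $ j * \<xi> $ i * second_fundamental_form X \<nu> \<psi> y $ j $ i"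
      using weingarten_equation(3)[OF assms, of i j] by simp
  qed
  also have "\<dots> = frechet_derivative (\<nu> \<circ> \<psi>) (at y) \<eta> \<bullet> frechet_derivative (X \<circ> \<psi>) (at y) \<xi>"
    by (rule F[symmetric])
  finally show ?thesis .
qed

lemma normal_derivative_inj:
  assumes y: "y \<in> V" and 0: "frechet_derivative (\<nu> \<circ> \<psi>) (at y) \<xi> = 0"
  shows "\<xi> = 0"
proof (rule weingarten_nonsingular[OF y])
  have "(\<Sum>i\<in>UNIV. \<xi> $ i * second_fundamental_form X \<nu> \<psi> y $ i $ j) = 0" for j
  proof -
    have "(\<Sum>i\<in>UNIV. \<xi> $ i * second_fundamental_form X \<nu> \<psi> y $ i $ j) = frechet_derivative (\<nu> \<circ> \<psi>) (at y) \<xi> \<bullet> partial_deriv j (X \<circ> \<psi>) y"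
      by (simp add: tangent_derivative_normal[OF y] inner_sum_left weingarten_equation(2)[OF y])
    then show ?thesis using 0 by simp
  qed
  then show "\<xi> v* second_fundamental_form X \<nu> \<psi> y = 0" by (simp add: vector_matrix_mult_def vec_eq_iff mult.commute)
qed

text \<open>Both sides are tangent vectors with the same inner products with all tangent vectors,
by the definition of the Weingarten matrix as \<open>h\<close> times the inverse of \<open>g\<close>.\<close>

lemma normal_derivative_weingarten:
  assumes y: "y \<in> V"
  shows "frechet_derivative (\<nu> \<circ> \<psi>) (at y) \<xi> = frechet_derivative (X \<circ> \<psi>) (at y) (\<xi> v* weingarten_matrix X \<nu> \<psi> y)"
proof -
  let ?DX = "frechet_derivative (X \<circ> \<psi>) (at y)" and ?DN = "frechet_derivative (\<nu> \<circ> \<psi>) (at y)"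
  let ?g = "first_fundamental_form X \<psi> y"
  have linX: "linear ?DX" using chart_derivatives(1)[OF y] has_derivative_linear by blast
  have linN: "linear ?DN" using chart_derivatives(2)[OF y] has_derivative_linear by blast
  have n: "norm (\<nu> (\<psi> y)) = 1" using norm_normal chart(4)[OF ch] y by blast
  have gX: "(\<xi> v* ?g) $ j = ?DX \<xi> \<bullet> partial_deriv j (X \<circ> \<psi>) y" for \<xi> j
    by (simp add: tangent_derivative_X[OF y] inner_sum_left vector_matrix_mult_def first_fundamental_form_def mult.commute)
  have gne: "\<xi> = 0" if "\<xi> v* ?g = 0" for \<xi>
  proof -
    have "?DX \<xi> \<bullet> partial_deriv j (X \<circ> \<psi>) y = 0" for j using gX[of \<xi> j] that by simp
    then have "?DX \<xi> \<bullet> ?DX \<xi> = 0"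
      by (subst (2) tangent_derivative_X[OF y]) (simp add: inner_sum_right)
    then have "?DX \<xi> = ?DX 0" using linX by (simp add: linear_0)
    then show ?thesis using chart(7)[OF ch y] by (simp add: inj_def)
  qed
  have ginv: "matrix_inv ?g ** ?g = mat 1"
  proof -
    have "det ?g \<noteq> 0"
    proof
      assume "det ?g = 0"
      then have "\<not> invertible (transpose ?g)" by (simp add: invertible_det_nz)
      then obtain a where "a \<noteq> 0" "transpose ?g *v a = 0"
        using matrix_left_invertible_ker[of "transpose ?g"] invertible_left_inverse[of "transpose ?g"] by blast
      then show False using gne[of a] by simp
    qed
    then have "invertible ?g" by (simp add: invertible_det_nz)
    then show ?thesis unfolding matrix_inv_def invertible_def by (rule someI2_ex) simp
  qed
  define \<eta> where "\<eta> = \<xi> v* weingarten_matrix X \<nu> \<psi> y"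
  have "\<eta> v* ?g = \<xi> v* second_fundamental_form X \<nu> \<psi> y"
    by (simp add: \<eta>_def weingarten_matrix_def vector_matrix_mult_assoc matrix_mul_assoc[symmetric] ginv)
  then have "?DX \<eta> \<bullet> partial_deriv j (X \<circ> \<psi>) y = ?DN \<xi> \<bullet> partial_deriv j (X \<circ> \<psi>) y" for j
    by (simp add: gX[symmetric] tangent_derivative_normal[OF y] inner_sum_left weingarten_equation(2)[OF y]
        vector_matrix_mult_def mult.commute)
  then have o1: "(?DX \<eta> - ?DN \<xi>) \<bullet> ?DX \<zeta> = 0" for \<zeta>
    by (subst (2) tangent_derivative_X[OF y]) (simp add: inner_sum_right inner_diff_left)
  have o2: "(?DX \<eta> - ?DN \<xi>) \<bullet> \<nu> (\<psi> y) = 0"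
    by (simp add: inner_diff_left X_derivative_orthogonal[OF y] normal_derivative_orthogonal[OF y])
  obtain \<zeta> where "?DX \<eta> - ?DN \<xi> = ?DX \<zeta>"
    using injective_range_orthogonal_complement[OF ambient n linX chart(7)[OF ch y] X_derivative_orthogonal[OF y] o2] by blast
  then have "(?DX \<eta> - ?DN \<xi>) \<bullet> (?DX \<eta> - ?DN \<xi>) = 0" using o1[of \<zeta>] by simp
  then show ?thesis by (simp add: \<eta>_def)
qed

end

section \<open>The Gauss map and the support function\<close>

text \<open>The map \<open>(y, s) \<mapsto> s *\<^sub>R \<nu> (\<psi> y)\<close> is polar coordinates adapted to the Gauss map; its derivative
is injective since the derivative of \<open>\<nu>\<close> is injective and orthogonal to \<open>\<nu>\<close>. The map \<open>k\<close> is the first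
component of its local inverse, and \<open>B\<close> is the slice \<open>s = s0\<close> of the neighbourhood on which it is inverted.\<close>

lemma chart_inverse:
  assumes ch: "(V, \<psi>) \<in> A" and y0: "y0 \<in> V" and s0: "s0 > 0"
  shows "\<exists>V' (k :: 'a \<Rightarrow> real^'n) B. open V' \<and> s0 *\<^sub>R \<nu> (\<psi> y0) \<in> V' \<and> smooth_on V' k \<and>
    (\<forall>w\<in>V'. w \<noteq> 0 \<and> k w \<in> V \<and> w = norm w *\<^sub>R \<nu> (\<psi> (k w))) \<and> open B \<and> y0 \<in> B \<and> B \<subseteq> V \<and>
    (\<forall>y\<in>B. s0 *\<^sub>R \<nu> (\<psi> y) \<in> V' \<and> k (s0 *\<^sub>R \<nu> (\<psi> y)) = y) \<and> (\<forall>w\<in>V'. norm w = s0 \<longrightarrow> k w \<in> B)"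
proof -
  have dimeq: "DIM('a) = DIM((real^'n) \<times> real)" using ambient by simp
  have "\<exists>(J :: 'a \<Rightarrow> (real^'n) \<times> real) J'. linear J \<and> linear J' \<and> (\<forall>x. norm (J x) = norm x) \<and> (\<forall>x. J' (J x) = x) \<and> (\<forall>y. J (J' y) = y)"
  proof (rule isomorphisms_UNIV_UNIV[OF dimeq])
    fix f :: "'a \<Rightarrow> (real^'n) \<times> real" and g
    assume "linear f" "linear g" "\<And>x. norm (f x) = norm x" "\<And>y. norm (g y) = norm y" "\<And>x. g (f x) = x" "\<And>y. f (g y) = y"
    then show ?thesis by (intro exI[of _ f] exI[of _ g]) simp
  qed
  then obtain J :: "'a \<Rightarrow> (real^'n) \<times> real" and J' where J: "linear J" "linear J'"
      "\<And>x. norm (J x) = norm x" "\<And>x. J' (J x) = x" "\<And>y. J (J' y) = y"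
    by blast
  have bJ: "bounded_linear J" "bounded_linear J'" using J linear_conv_bounded_linear by blast+
  have Jc: "continuous_on UNIV J" "continuous_on UNIV J'" using bJ linear_continuous_on by blast+
  have bf: "bounded_linear (\<lambda>a. fst (J a))" "bounded_linear (\<lambda>a. snd (J a))"
    by (intro bounded_linear_compose[OF bounded_linear_fst bJ(1)] bounded_linear_compose[OF bounded_linear_snd bJ(1)])+
  define U where "U = J -` (V \<times> {0<..})"
  have Vo: "open V" by (rule chart(1)[OF ch])
  have Uo: "open U" unfolding U_def by (intro open_vimage open_Times Vo open_greaterThan Jc)
  define g where "g a = snd (J a) *\<^sub>R (\<nu> \<circ> \<psi>) (fst (J a))" for a
  have unit: "norm (\<nu> (\<psi> y)) = 1" if "y \<in> V" for y using norm_normal chart(4)[OF ch] that by blast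
  have norm_g: "norm (g a) = snd (J a)" if "a \<in> U" for a
    using that unit by (auto simp: g_def U_def)
  have gs: "smooth_on U g"
    unfolding smooth_on_def
  proof
    fix k
    have c: "Ck_on k V (\<nu> \<circ> \<psi>)" using chart(6)[OF ch] by (simp add: smooth_on_def)
    have img: "(\<lambda>a. fst (J a)) ` U \<subseteq> V" by (auto simp: U_def)
    show "Ck_on k U g" unfolding g_def[abs_def]
      by (rule Ck_on_bilinear[OF Uo bounded_bilinear_scaleR Ck_on_linear[OF bf(2)]
            Ck_on_compose[OF Uo Vo img c Ck_on_linear[OF bf(1)]]])
  qed
  define a0 where "a0 = J' (y0, s0)"
  have Ja0: "J a0 = (y0, s0)" by (simp add: a0_def J)
  have a0: "a0 \<in> U" using y0 s0 by (simp add: U_def Ja0)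
  let ?DN = "frechet_derivative (\<nu> \<circ> \<psi>) (at y0)"
  have dN: "((\<nu> \<circ> \<psi>) has_derivative ?DN) (at (fst (J a0)))"
    using chart_derivatives(2)[OF ch y0] by (simp add: Ja0)
  have dg: "(g has_derivative (\<lambda>w. s0 *\<^sub>R ?DN (fst (J w)) + snd (J w) *\<^sub>R \<nu> (\<psi> y0))) (at a0)"
    using has_derivative_scaleR[OF bounded_linear_imp_has_derivative[OF bf(2)]
        has_derivative_compose[OF bounded_linear_imp_has_derivative[OF bf(1)] dN]]
    by (simp add: g_def[abs_def] Ja0)
  have Deq: "frechet_derivative g (at a0) = (\<lambda>w. s0 *\<^sub>R ?DN (fst (J w)) + snd (J w) *\<^sub>R \<nu> (\<psi> y0))"
    using frechet_derivative_at[OF dg] by simp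
  have inj: "inj (frechet_derivative g (at a0))"
  proof -
    have "linear (frechet_derivative g (at a0))" unfolding Deq using dg has_derivative_linear by blast
    moreover have "w = 0" if w: "frechet_derivative g (at a0) w = 0" for w
    proof -
      have e: "s0 *\<^sub>R ?DN (fst (J w)) + snd (J w) *\<^sub>R \<nu> (\<psi> y0) = 0" using w by (simp add: Deq)
      then have "(s0 *\<^sub>R ?DN (fst (J w)) + snd (J w) *\<^sub>R \<nu> (\<psi> y0)) \<bullet> \<nu> (\<psi> y0) = 0" by simp
      moreover have "\<nu> (\<psi> y0) \<bullet> \<nu> (\<psi> y0) = 1" using unit[OF y0] by (simp add: norm_eq_1)
      ultimately have s: "snd (J w) = 0"
        by (simp add: inner_add_left normal_derivative_orthogonal[OF ch y0])
      then have "?DN (fst (J w)) = 0" using e s0 by simp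
      then have "fst (J w) = 0" by (rule normal_derivative_inj[OF ch y0])
      then have "norm (J w) = 0" using s by (simp add: prod_eq_iff)
      then show "w = 0" using J(3) by simp
    qed
    ultimately show ?thesis using linear_injective_0 by blast
  qed
  obtain U' V' hh where U': "open U'" "U' \<subseteq> U" "a0 \<in> U'" "open V'" "homeomorphism U' V' g hh" "smooth_on V' hh"
    by (rule smooth_local_inverse[OF Uo a0 gs inj])
  have hhU: "hh w \<in> U'" "g (hh w) = w" if "w \<in> V'" for w
    using U'(5) that by (auto simp: homeomorphism_def)
  have ghh: "g a \<in> V'" "hh (g a) = a" if "a \<in> U'" for a
    using U'(5) that by (auto simp: homeomorphism_def)
  define k where "k w = fst (J (hh w))" for w
  define B where "B = V \<inter> (\<lambda>y. J' (y, s0)) -` U'"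
  have gJ: "g (J' (y, s)) = s *\<^sub>R \<nu> (\<psi> y)" for y s by (simp add: g_def J)
  have nw: "norm w = snd (J (hh w))" if "w \<in> V'" for w
    using norm_g[of "hh w"] hhU[OF that] U'(2) by auto
  show ?thesis
  proof (intro exI[of _ V'] exI[of _ k] exI[of _ B] conjI ballI impI)
    show "open V'" by (rule U'(4))
    show "s0 *\<^sub>R \<nu> (\<psi> y0) \<in> V'" using ghh(1)[OF U'(3)] by (simp add: a0_def gJ)
    show "smooth_on V' k"
      unfolding smooth_on_def k_def[abs_def]
      using U'(6) Ck_on_linear_compose[OF U'(4) bf(1)] by (auto simp: smooth_on_def)
    fix w assume w: "w \<in> V'"
    have hU: "hh w \<in> U" using hhU[OF w] U'(2) by blast
    then show "k w \<in> V" by (auto simp: k_def U_def)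
    show "w = norm w *\<^sub>R \<nu> (\<psi> (k w))" using hhU(2)[OF w] by (simp add: nw[OF w] k_def g_def)
    show "w \<noteq> 0" using nw[OF w] hU by (auto simp: U_def)
  next
    show "open B" unfolding B_def
      by (intro open_Int Vo open_vimage U'(1) continuous_on_compose2[OF Jc(2)] continuous_intros) auto
    show "y0 \<in> B" using U'(3) y0 by (simp add: B_def a0_def)
    show "B \<subseteq> V" by (auto simp: B_def)
    fix y assume "y \<in> B"
    then have "J' (y, s0) \<in> U'" by (simp add: B_def)
    from ghh[OF this] show "s0 *\<^sub>R \<nu> (\<psi> y) \<in> V'" "k (s0 *\<^sub>R \<nu> (\<psi> y)) = y"
      by (simp_all add: gJ k_def J)
  next
    fix w assume w: "w \<in> V'" "norm w = s0"
    have "J (hh w) = (k w, s0)" using nw[OF w(1)] w(2) by (simp add: k_def prod_eq_iff)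
    then have "J' (k w, s0) = hh w" using J(4) by metis
    then show "k w \<in> B" using hhU[OF w(1)] U'(2) by (auto simp: B_def k_def U_def)
  qed
qed

lemma gauss_map_local_homeomorphism: "local_homeomorphism_on M \<nu> (sphere 0 1)"
  unfolding local_homeomorphism_on_def
proof
  fix p assume "p \<in> M"
  then obtain V \<psi> y0 where ch: "(V, \<psi>) \<in> A" "y0 \<in> V" "\<psi> y0 = p" by (rule chart_exists)
  obtain V' and k :: "'a \<Rightarrow> real^'n" and B where k: "open V'" "1 *\<^sub>R \<nu> (\<psi> y0) \<in> V'" "smooth_on V' k"
    "\<forall>w\<in>V'. w \<noteq> 0 \<and> k w \<in> V \<and> w = norm w *\<^sub>R \<nu> (\<psi> (k w))" "open B" "y0 \<in> B" "B \<subseteq> V"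
    "\<forall>y\<in>B. 1 *\<^sub>R \<nu> (\<psi> y) \<in> V' \<and> k (1 *\<^sub>R \<nu> (\<psi> y)) = y" "\<forall>w\<in>V'. norm w = 1 \<longrightarrow> k w \<in> B"
    using chart_inverse[OF ch(1,2), of 1] by auto
  obtain \<phi> where \<phi>: "homeomorphism V (\<psi> ` V) \<psi> \<phi>" using chart(3)[OF ch(1)] by blast
  have unit: "norm (\<nu> (\<psi> y)) = 1" if "y \<in> V" for y using norm_normal chart(4)[OF ch(1)] that by blast
  have img: "\<nu> ` \<psi> ` B = sphere 0 1 \<inter> V'"
  proof (intro equalityI subsetI)
    fix w assume "w \<in> \<nu> ` \<psi> ` B"
    then show "w \<in> sphere 0 1 \<inter> V'" using k(7,8) unit by auto
  next
    fix w assume "w \<in> sphere 0 1 \<inter> V'"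
    then have w: "norm w = 1" "w \<in> V'" by auto
    then have "w = \<nu> (\<psi> (k w))" "k w \<in> B" using k(4,9) by fastforce+
    then show "w \<in> \<nu> ` \<psi> ` B" by blast
  qed
  have "openin (top_of_set V) B" using k(5,7) by (simp add: open_subset)
  from homeomorphism_imp_open_map[OF \<phi> this] have o1: "openin (top_of_set M) (\<psi> ` B)"
    using chart(2)[OF ch(1)] openin_trans by blast
  have Ck: "continuous_on V' k" "continuous_on V (\<nu> \<circ> \<psi>)"
    using k(3) chart(6)[OF ch(1)] Ck_on.simps(1)[of V' k] Ck_on.simps(1)[of V "\<nu> \<circ> \<psi>"]
    unfolding smooth_on_def by blast+
  have c1: "continuous_on (\<psi> ` B) \<nu>"
  proof -
    have "continuous_on (\<psi> ` B) (\<lambda>p. (\<nu> \<circ> \<psi>) (\<phi> p))"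
    proof (rule continuous_on_compose2[OF Ck(2)])
      have "continuous_on (\<psi> ` V) \<phi>" using \<phi> by (simp add: homeomorphism_def)
      then show "continuous_on (\<psi> ` B) \<phi>" by (rule continuous_on_subset) (use k(7) in blast)
      show "\<phi> ` \<psi> ` B \<subseteq> V" using \<phi> k(7) by (auto simp: homeomorphism_def)
    qed
    then show ?thesis by (rule continuous_on_eq) (use \<phi> k(7) in \<open>auto simp: homeomorphism_def subset_iff\<close>)
  qed
  have c\<psi>: "continuous_on V \<psi>" using \<phi> by (simp add: homeomorphism_def)
  have c2: "continuous_on (sphere 0 1 \<inter> V') (\<lambda>w. \<psi> (k w))"
    by (rule continuous_on_compose2[OF c\<psi> continuous_on_subset[OF Ck(1)]]) (use k(4) in auto)
  have "homeomorphism (\<psi> ` B) (\<nu> ` \<psi> ` B) \<nu> (\<lambda>w. \<psi> (k w))"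
  proof (rule homeomorphismI)
    show "continuous_on (\<psi> ` B) \<nu>" by (rule c1)
    show "continuous_on (\<nu> ` \<psi> ` B) (\<lambda>w. \<psi> (k w))" unfolding img by (rule c2)
    show "\<nu> ` \<psi> ` B \<subseteq> \<nu> ` \<psi> ` B" by simp
    show "(\<lambda>w. \<psi> (k w)) ` \<nu> ` \<psi> ` B \<subseteq> \<psi> ` B" using k(8) by auto
    show "\<psi> (k (\<nu> x)) = x" if "x \<in> \<psi> ` B" for x using that k(8) by auto
    show "\<nu> (\<psi> (k w)) = w" if "w \<in> \<nu> ` \<psi> ` B" for w using that k(8) by auto
  qed
  moreover have "openin (top_of_set (sphere 0 1)) (\<nu> ` \<psi> ` B)" unfolding img using k(1) by (simp add: openin_open_Int)
  moreover have "p \<in> \<psi> ` B" using ch(3) k(6) by blast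
  ultimately show "\<exists>U q. p \<in> U \<and> openin (top_of_set M) U \<and> openin (top_of_set (sphere 0 1)) (\<nu> ` U) \<and> homeomorphism U (\<nu> ` U) \<nu> q"
    using o1 by blast
qed

lemma continuous_gauss_map: "continuous_on M \<nu>"
proof -
  have "openin (top_of_set M) (M \<inter> \<nu> -` B)" if B: "open B" for B
  proof (subst openin_subopen, intro ballI)
    fix p assume p: "p \<in> M \<inter> \<nu> -` B"
    then have "p \<in> M" by blast
    then obtain U q where U: "p \<in> U" "openin (top_of_set M) U" "homeomorphism U (\<nu> ` U) \<nu> q"
      using gauss_map_local_homeomorphism unfolding local_homeomorphism_on_def by blast
    have "continuous_on U \<nu>" using U(3) by (simp add: homeomorphism_def)
    then have "openin (top_of_set U) (U \<inter> \<nu> -` B)" using B by (rule continuous_openin_preimage_gen)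
    then have "openin (top_of_set M) (U \<inter> \<nu> -` B)" using U(2) openin_trans by blast
    moreover have "U \<subseteq> M" using U(2) openin_imp_subset by blast
    ultimately show "\<exists>T. openin (top_of_set M) T \<and> p \<in> T \<and> T \<subseteq> M \<inter> \<nu> -` B" using p U(1) by blast
  qed
  then show ?thesis by (subst continuous_on_open_gen[of _ _ UNIV]) auto
qed

lemma gauss_map_onto: "\<nu> ` M = sphere 0 1"
proof -
  let ?S = "sphere 0 1 :: 'a set"
  have sub: "\<nu> ` M \<subseteq> ?S" using norm_normal by auto
  have "openin (top_of_set ?S) (\<nu> ` M)"
  proof (subst openin_subopen, intro ballI)
    fix w assume "w \<in> \<nu> ` M"
    then obtain p where p: "p \<in> M" "w = \<nu> p" by blast
    obtain U where U: "p \<in> U" "openin (top_of_set M) U" "openin (top_of_set ?S) (\<nu> ` U)"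
      using gauss_map_local_homeomorphism p(1) unfolding local_homeomorphism_on_def by blast
    have "U \<subseteq> M" using U(2) openin_imp_subset by blast
    then show "\<exists>T. openin (top_of_set ?S) T \<and> w \<in> T \<and> T \<subseteq> \<nu> ` M" using U p by blast
  qed
  moreover have "closedin (top_of_set ?S) (\<nu> ` M)"
    using sub compact_continuous_image[OF continuous_gauss_map M_facts(1)] by (simp add: closed_subset compact_imp_closed)
  moreover have "connected ?S" by (rule connected_sphere) (use ambient n_ge_2 in simp)
  ultimately show ?thesis using connected_clopen M_facts(3) by blast
qed

text \<open>This is where \<open>n \<ge> 2\<close> enters the topology: the sphere is then simply connected.\<close>

lemma gauss_map_inj: "inj_on \<nu> M"
proof (rule compact_local_homeomorphism_simply_connected_inj[OF M_facts continuous_gauss_map gauss_map_onto gauss_map_local_homeomorphism])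
  show "simply_connected (sphere (0::'a) 1)" by (rule simply_connected_sphere) (use ambient n_ge_2 in simp)
  show "locally path_connected (sphere (0::'a) 1)" by (rule locally_path_connected_sphere)
qed

text \<open>The point with outward normal in the direction \<open>z\<close>; it is the gradient of the support
function at \<open>z\<close>.\<close>

definition support_gradient :: "'a \<Rightarrow> 'a" where
  "support_gradient z = X (inv_into M \<nu> ((1 / norm z) *\<^sub>R z))"

lemma support_gradient_normal: "p \<in> M \<Longrightarrow> s > 0 \<Longrightarrow> support_gradient (s *\<^sub>R \<nu> p) = X p"
  using gauss_map_inj norm_normal by (simp add: support_gradient_def)

lemma polar:
  assumes "z \<noteq> 0" obtains V \<psi> y where "(V, \<psi>) \<in> A" "y \<in> V" "z = norm z *\<^sub>R \<nu> (\<psi> y)"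
proof -
  have "(1 / norm z) *\<^sub>R z \<in> \<nu> ` M" unfolding gauss_map_onto using assms by simp
  then obtain p where p: "p \<in> M" "(1 / norm z) *\<^sub>R z = \<nu> p" by (metis imageE)
  obtain V \<psi> y where ch: "(V, \<psi>) \<in> A" "y \<in> V" "\<psi> y = p" by (rule chart_exists[OF p(1)])
  have "norm z *\<^sub>R \<nu> (\<psi> y) = z" using p(2)[symmetric] ch(3) assms by simp
  then show ?thesis using that[OF ch(1,2)] by simp
qed

lemma support_gradient_smooth: "Ck_on j (- {0}) support_gradient"
proof (rule Ck_on_local)
  fix z :: 'a assume "z \<in> - {0}"
  then have z: "z \<noteq> 0" by simp
  obtain V \<psi> y where ch: "(V, \<psi>) \<in> A" "y \<in> V" "z = norm z *\<^sub>R \<nu> (\<psi> y)" by (rule polar[OF z])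
  obtain V' and k :: "'a \<Rightarrow> real^'n" where k: "open V'" "norm z *\<^sub>R \<nu> (\<psi> y) \<in> V'" "smooth_on V' k"
    "\<forall>w\<in>V'. w \<noteq> 0 \<and> k w \<in> V \<and> w = norm w *\<^sub>R \<nu> (\<psi> (k w))"
    using chart_inverse[OF ch(1,2), of "norm z"] z by auto
  have sm: "Ck_on j V (X \<circ> \<psi>)" "Ck_on j V' k" using chart(5)[OF ch(1)] k(3) by (simp_all add: smooth_on_def)
  have kV: "k ` V' \<subseteq> V" using k(4) by blast
  have sX: "Ck_on j V' (\<lambda>w. (X \<circ> \<psi>) (k w))"
    by (rule Ck_on_compose[OF k(1) chart(1)[OF ch(1)] kV sm])
  have eq: "\<forall>w\<in>V'. (X \<circ> \<psi>) (k w) = support_gradient w"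
  proof
    fix w assume w: "w \<in> V'"
    have kw: "w \<noteq> 0" "k w \<in> V" and wk: "w = norm w *\<^sub>R \<nu> (\<psi> (k w))" using k(4) w by blast+
    have "\<psi> (k w) \<in> M" using kw chart(4)[OF ch(1)] by blast
    then have "support_gradient (norm w *\<^sub>R \<nu> (\<psi> (k w))) = X (\<psi> (k w))" using kw(1) by (intro support_gradient_normal) simp_all
    then show "(X \<circ> \<psi>) (k w) = support_gradient w" unfolding wk[symmetric] by simp
  qed
  have "Ck_on j V' support_gradient" by (rule Ck_on_cong[OF k(1) eq sX])
  moreover have "z \<in> V'" using k(2) by (subst ch(3))
  ultimately show "\<exists>U. open U \<and> z \<in> U \<and> Ck_on j U support_gradient" using k(1) by blast
qed

definition "support_hessian z = frechet_derivative support_gradient (at z)"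
definition "support_third z a = frechet_derivative (\<lambda>z. support_hessian z a) (at z)"
definition "support_fourth z a b = frechet_derivative (\<lambda>z. support_third z a b) (at z)"

lemma support_hessian_smooth: "Ck_on j (- {0}) (\<lambda>z. support_hessian z a)" "Ck_on j (- {0}) (\<lambda>z. support_third z a b)"
proof -
  have 1: "Ck_on j (- {0}) (\<lambda>z. support_hessian z a)" for j a
    using support_gradient_smooth[of "Suc j"] unfolding support_hessian_def Ck_on.simps by blast
  then show "Ck_on j (- {0}) (\<lambda>z. support_hessian z a)" .
  show "Ck_on j (- {0}) (\<lambda>z. support_third z a b)"
    using 1[of "Suc j" a] unfolding support_third_def Ck_on.simps by blast
qed

lemma support_has_derivative:
  assumes "z \<noteq> 0"
  shows "(support_gradient has_derivative support_hessian z) (at z)" "((\<lambda>z. support_hessian z a) has_derivative support_third z a) (at z)"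
    "((\<lambda>z. support_third z a b) has_derivative support_fourth z a b) (at z)"
  using Ck_on_has_derivative[OF support_gradient_smooth[of "Suc 0"]] Ck_on_has_derivative[OF support_hessian_smooth(1)[of "Suc 0"]]
    Ck_on_has_derivative[OF support_hessian_smooth(2)[of "Suc 0"]] assms
  unfolding support_hessian_def support_third_def support_fourth_def by auto

lemma support_third_commute: "z \<noteq> 0 \<Longrightarrow> support_third z a b = support_third z b a"
  unfolding support_third_def support_hessian_def
  by (rule Ck_on_second_derivative_commute[OF _ _ support_gradient_smooth]) (auto simp: open_Compl)

lemma support_fourth_commute: "z \<noteq> 0 \<Longrightarrow> support_fourth z a b c = support_fourth z a c b"
  unfolding support_fourth_def support_third_def
  by (rule Ck_on_second_derivative_commute[OF _ _ support_hessian_smooth(1)]) (auto simp: open_Compl)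

lemma support_hessian_radial:
  assumes z: "z \<noteq> 0" shows "support_hessian z z = 0"
proof -
  have "((\<lambda>c. c *\<^sub>R z) has_derivative (\<lambda>h. h *\<^sub>R z)) (at (1::real))"
    by (auto intro!: derivative_eq_intros)
  from has_derivative_compose[OF this, of support_gradient "support_hessian z"] support_has_derivative(1)[OF z]
  have 1: "((\<lambda>c. support_gradient (c *\<^sub>R z)) has_derivative (\<lambda>h. support_hessian z (h *\<^sub>R z))) (at 1)" by simp
  have "((\<lambda>c. support_gradient (c *\<^sub>R z)) has_derivative (\<lambda>h. 0)) (at 1)"
    by (rule has_derivative_transform_within_open[OF has_derivative_const[of "support_gradient z"] open_greaterThan[of 0]])
       (simp_all add: support_gradient_def)
  from fun_cong[OF has_derivative_unique[OF 1 this], of 1] show ?thesis by simp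
qed

text \<open>Differentiate \<open>support_gradient (s *\<^sub>R \<nu> (\<psi> y)) = X (\<psi> y)\<close>: the Hessian of the support function is
the inverse of the Weingarten map.\<close>

lemma support_hessian_chart:
  assumes ch: "(V, \<psi>) \<in> A" "y \<in> V" and s: "s > 0"
  shows "support_hessian (s *\<^sub>R \<nu> (\<psi> y)) (frechet_derivative (\<nu> \<circ> \<psi>) (at y) \<xi>) = (1 / s) *\<^sub>R frechet_derivative (X \<circ> \<psi>) (at y) \<xi>"
proof -
  let ?DN = "frechet_derivative (\<nu> \<circ> \<psi>) (at y)" and ?DX = "frechet_derivative (X \<circ> \<psi>) (at y)"
  have nz: "s *\<^sub>R \<nu> (\<psi> y) \<noteq> 0" using s norm_normal chart(4)[OF ch(1)] ch(2) by force
  have lin: "linear (support_hessian (s *\<^sub>R \<nu> (\<psi> y)))" using support_has_derivative(1)[OF nz] has_derivative_linear by blast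
  have "((\<lambda>y. s *\<^sub>R \<nu> (\<psi> y)) has_derivative (\<lambda>\<xi>. s *\<^sub>R ?DN \<xi>)) (at y)"
    using has_derivative_scaleR_right[OF chart_derivatives(2)[OF ch], of s] by simp
  from has_derivative_compose[OF this support_has_derivative(1)[OF nz]]
  have 1: "((\<lambda>y. support_gradient (s *\<^sub>R \<nu> (\<psi> y))) has_derivative (\<lambda>\<xi>. support_hessian (s *\<^sub>R \<nu> (\<psi> y)) (s *\<^sub>R ?DN \<xi>))) (at y)" .
  have 2: "((\<lambda>y. support_gradient (s *\<^sub>R \<nu> (\<psi> y))) has_derivative ?DX) (at y)"
    by (rule has_derivative_transform_within_open[OF chart_derivatives(1)[OF ch] chart(1)[OF ch(1)] ch(2)])
       (use chart(4)[OF ch(1)] s in \<open>simp add: support_gradient_normal image_subset_iff\<close>)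
  have "support_hessian (s *\<^sub>R \<nu> (\<psi> y)) (s *\<^sub>R ?DN \<xi>) = ?DX \<xi>"
    using fun_cong[OF has_derivative_unique[OF 1 2], of \<xi>] .
  then have "s *\<^sub>R support_hessian (s *\<^sub>R \<nu> (\<psi> y)) (?DN \<xi>) = ?DX \<xi>" using lin by (simp add: linear_scale)
  then have "(1 / s) *\<^sub>R (s *\<^sub>R support_hessian (s *\<^sub>R \<nu> (\<psi> y)) (?DN \<xi>)) = (1 / s) *\<^sub>R ?DX \<xi>" by simp
  then show ?thesis using s by simp
qed

lemma tangent_vector_chart:
  assumes ch: "(V, \<psi>) \<in> A" "y \<in> V" and w: "w \<bullet> \<nu> (\<psi> y) = 0"
  shows "\<exists>\<xi>. w = frechet_derivative (\<nu> \<circ> \<psi>) (at y) \<xi>"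
proof (rule injective_range_orthogonal_complement[OF ambient _ _ _ normal_derivative_orthogonal[OF ch] w])
  show "norm (\<nu> (\<psi> y)) = 1" using norm_normal chart(4)[OF ch(1)] ch(2) by blast
  show l: "linear (frechet_derivative (\<nu> \<circ> \<psi>) (at y))" using chart_derivatives(2)[OF ch] has_derivative_linear by blast
  show "inj (frechet_derivative (\<nu> \<circ> \<psi>) (at y))"
    using l linear_injective_0 normal_derivative_inj[OF ch] by blast
qed

text \<open>In the basis formed by the normal and the derivatives of \<open>\<nu>\<close>, the matrix of the bilinear
form is zero in the normal row and the second fundamental form, up to a factor, elsewhere.\<close>

lemma support_hessian_sym:
  assumes z: "z \<noteq> 0" shows "support_hessian z a \<bullet> b = a \<bullet> support_hessian z b"
proof -
  obtain V \<psi> y where ch: "(V, \<psi>) \<in> A" "y \<in> V" and zy: "z = norm z *\<^sub>R \<nu> (\<psi> y)" by (rule polar[OF z])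
  let ?n = "\<nu> (\<psi> y)" and ?DN = "frechet_derivative (\<nu> \<circ> \<psi>) (at y)" and ?DX = "frechet_derivative (X \<circ> \<psi>) (at y)"
  have n: "norm ?n = 1" using norm_normal chart(4)[OF ch(1)] ch(2) by blast
  have lin: "linear (support_hessian z)" using support_has_derivative(1)[OF z] has_derivative_linear by blast
  have DYn: "support_hessian z ?n = 0"
  proof -
    have "support_hessian z z = support_hessian z (norm z *\<^sub>R ?n)" by (rule arg_cong[OF zy])
    then have "norm z *\<^sub>R support_hessian z ?n = support_hessian z z" using linear_scale[OF lin, of "norm z" ?n] by simp
    then show ?thesis using support_hessian_radial[OF z] z by simp
  qed
  have DYN: "support_hessian z (?DN \<xi>) = (1 / norm z) *\<^sub>R ?DX \<xi>" for \<xi>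
    using support_hessian_chart[OF ch, of "norm z" \<xi>] z unfolding zy[symmetric] by simp
  have dec: "\<exists>\<xi>. a = (a \<bullet> ?n) *\<^sub>R ?n + ?DN \<xi>" for a
  proof -
    have "(a - (a \<bullet> ?n) *\<^sub>R ?n) \<bullet> ?n = 0" using n by (simp add: inner_diff_left norm_eq_1)
    from tangent_vector_chart[OF ch this] obtain \<xi> where "a - (a \<bullet> ?n) *\<^sub>R ?n = ?DN \<xi>" by blast
    then have "a = (a \<bullet> ?n) *\<^sub>R ?n + ?DN \<xi>" by (simp add: algebra_simps)
    then show ?thesis by blast
  qed
  obtain \<xi> \<eta> where a: "a = (a \<bullet> ?n) *\<^sub>R ?n + ?DN \<xi>" and b: "b = (b \<bullet> ?n) *\<^sub>R ?n + ?DN \<eta>"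
    using dec by blast
  have DYa: "support_hessian z a = (1 / norm z) *\<^sub>R ?DX \<xi>"
    by (subst a) (simp add: linear_add[OF lin] linear_scale[OF lin] DYn DYN)
  have DYb: "support_hessian z b = (1 / norm z) *\<^sub>R ?DX \<eta>"
    by (subst b) (simp add: linear_add[OF lin] linear_scale[OF lin] DYn DYN)
  have 1: "?DX \<xi> \<bullet> b = ?DX \<xi> \<bullet> ?DN \<eta>"
    by (subst b) (simp add: inner_add_right X_derivative_orthogonal[OF ch])
  have 2: "a \<bullet> ?DX \<eta> = ?DN \<xi> \<bullet> ?DX \<eta>"
  proof -
    have "?n \<bullet> ?DX \<eta> = 0" using X_derivative_orthogonal[OF ch, of \<eta>] by (simp add: inner_commute)
    then show ?thesis by (subst a) (simp add: inner_add_left)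
  qed
  show ?thesis
    unfolding DYa DYb using 1 2 normal_derivative_X_derivative[OF ch, of \<xi> \<eta>] by (simp add: inner_commute)
qed

lemma support_map_gauss: "support_map support_gradient support_hessian support_third support_fourth"
  by unfold_locales (rule support_has_derivative support_third_commute support_fourth_commute support_hessian_sym support_hessian_radial, assumption)+

text \<open>Pulling an eigenframe of the Hessian back to the chart diagonalises the Weingarten matrix
with eigenvalues \<open>1 / r\<close>. Comparison of characteristic polynomials identifies them with the principal
curvatures up to a permutation, and in particular shows that the radii are positive.\<close>

lemma eigenframe_curvatures:
  assumes p: "p \<in> M" and e: "orthonormal_frame (\<nu> p) (e :: 'n \<Rightarrow> 'a)" "\<And>i. support_hessian (\<nu> p) (e i) = r $ i *\<^sub>R e i"
  shows "r \<in> Gamma_plus" "\<exists>\<sigma>. \<sigma> permutes UNIV \<and> (\<forall>i. \<kappa> p $ \<sigma> i = 1 / r $ i)"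
proof -
  obtain V \<psi> y where ch: "(V, \<psi>) \<in> A" "y \<in> V" "\<psi> y = p" by (rule chart_exists[OF p])
  let ?DN = "frechet_derivative (\<nu> \<circ> \<psi>) (at y)" and ?DX = "frechet_derivative (X \<circ> \<psi>) (at y)"
  let ?W = "weingarten_matrix X \<nu> \<psi> y"
  have linN: "linear ?DN" using chart_derivatives(2)[OF ch(1,2)] has_derivative_linear by blast
  have linX: "linear ?DX" using chart_derivatives(1)[OF ch(1,2)] has_derivative_linear by blast
  have injX: "?DX a = ?DX b \<Longrightarrow> a = b" for a b using chart(7)[OF ch(1,2)] by (simp add: inj_def)
  have ee: "e i \<bullet> e j = (if i = j then 1 else 0)" "e i \<bullet> \<nu> p = 0" for i j
    using e(1) by (simp_all add: orthonormal_frame_def)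
  have "\<forall>i. \<exists>\<xi>. e i = ?DN \<xi>"
    using tangent_vector_chart[OF ch(1,2)] ee(2) ch(3) by simp
  then obtain \<xi> where \<xi>: "\<And>i. e i = ?DN (\<xi> i)" by metis
  have key: "\<xi> i = r $ i *\<^sub>R (\<xi> i v* ?W)" for i
  proof -
    have "?DX (\<xi> i) = support_hessian (\<nu> p) (e i)"
      using support_hessian_chart[OF ch(1,2), of 1 "\<xi> i"] \<xi>[of i] ch(3) by simp
    also have "\<dots> = r $ i *\<^sub>R ?DN (\<xi> i)" using e(2) \<xi> by simp
    also have "\<dots> = ?DX (r $ i *\<^sub>R (\<xi> i v* ?W))"
      by (simp add: normal_derivative_weingarten[OF ch(1,2)] linear_scale[OF linX])
    finally show ?thesis by (rule injX)
  qed
  have \<xi>0: "\<xi> i \<noteq> 0" for i using ee(1)[of i i] \<xi>[of i] linear_0[OF linN] by auto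
  have r0: "r $ i \<noteq> 0" for i using key[of i] \<xi>0[of i] by auto
  define C :: "real^'n^'n" where "C = (\<chi> i. \<xi> i)"
  have rowC: "row i C = \<xi> i" for i by (simp add: C_def row_def vec_eq_iff)
  have "det (mat t - ?W) = (\<Prod>i\<in>UNIV. t - 1 / r $ i)" for t
  proof (rule det_similar_to_diagonal)
    fix i
    have "(1 / r $ i) *\<^sub>R \<xi> i = (1 / r $ i) *\<^sub>R (r $ i *\<^sub>R (\<xi> i v* ?W))" using key[of i] by simp
    then show "row i C v* ?W = (1 / r $ i) *\<^sub>R row i C" using r0[of i] by (simp add: rowC)
  next
    fix a :: "real^'n" assume a: "a v* C = 0"
    have "(\<Sum>i\<in>UNIV. a $ i *\<^sub>R \<xi> i) = 0"
      using a by (simp add: vector_matrix_mult_def vec_eq_iff C_def mult.commute)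
    then have "?DN (\<Sum>i\<in>UNIV. a $ i *\<^sub>R \<xi> i) = 0" using linN by (simp add: linear_0)
    then have s: "(\<Sum>i\<in>UNIV. a $ i *\<^sub>R e i) = 0" by (simp add: linear_sum[OF linN] linear_scale[OF linN] \<xi>)
    have "a $ j = (\<Sum>i\<in>UNIV. a $ i *\<^sub>R e i) \<bullet> e j" for j
      by (simp add: inner_sum_left ee if_distrib cong: if_cong)
    then show "a = 0" using s by (simp add: vec_eq_iff)
  qed
  moreover have "det (mat t - ?W) = (\<Prod>i\<in>UNIV. t - \<kappa> p $ i)" for t
    using chart(9)[OF ch(1,2)] ch(3) by (simp add: eigenvalue_vector_def)
  ultimately have "(\<Prod>i\<in>UNIV. t - 1 / r $ i) = (\<Prod>i\<in>UNIV. t - \<kappa> p $ i)" for t by simp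
  from equal_linear_products_permutes[OF this]
  obtain \<sigma> where \<sigma>: "\<sigma> permutes UNIV" "\<forall>i. \<kappa> p $ \<sigma> i = 1 / r $ i" by blast
  then show "\<exists>\<sigma>. \<sigma> permutes UNIV \<and> (\<forall>i. \<kappa> p $ \<sigma> i = 1 / r $ i)" by blast
  have "r $ i > 0" for i
  proof -
    have "\<kappa> p $ \<sigma> i > 0" using strictly_convex p by (auto simp: Gamma_plus_def)
    then have "1 / r $ i > 0" using \<sigma>(2) by simp
    then show ?thesis by simp
  qed
  then show "r \<in> Gamma_plus" by (simp add: Gamma_plus_def)
qed

end

section \<open>Rigidity of self-similar solutions\<close>

theorem theorem1p6:
  fixes M :: "'m::t2_space set"
    and A :: "('m, 'n::finite) atlas"
    and X \<nu> :: "'m \<Rightarrow> 'a::euclidean_space"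
    and \<kappa> :: "'m \<Rightarrow> real^'n"
    and f :: "real^'n \<Rightarrow> real"
    and \<alpha> :: real
  assumes n_ge_2: "CARD('n) \<ge> 2"
    and ambient: "DIM('a) = CARD('n) + 1"
    and manifold: "closed_manifold M A"
    and immersion: "smooth_immersion A X"
    and normal: "outward_unit_normal M A X \<nu>"
    and curvatures: "principal_curvatures A X \<nu> \<kappa>"
    and strictly_convex: "\<forall>p\<in>M. \<kappa> p \<in> Gamma_plus"
    and f_smooth: "smooth_on Gamma_plus f"
    and f_symmetric: "symmetric_on_Gamma_plus f"
    and f_pos: "\<forall>k\<in>Gamma_plus. f k > 0"
    and f_increasing: "\<forall>k\<in>Gamma_plus. \<forall>i. partial_deriv i f k > 0"
    and f_homogeneous: "\<forall>c>0. \<forall>k\<in>Gamma_plus. f (c *\<^sub>R k) = c * f k"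
    and f_inverse_concave: "inverse_concave f"
    and self_similar: "\<forall>p\<in>M. f (\<kappa> p) powr \<alpha> = X p \<bullet> \<nu> p"
    and alpha: "\<alpha> > 1"
  shows "\<exists>c r. r > 0 \<and> X ` M = sphere c r \<and> inj_on X M"
proof -
  interpret convex_hypersurface M A X \<nu> \<kappa>
    by (unfold_locales; fact)
  interpret curvature_function f
    by (unfold_locales; fact)
  interpret support_map support_gradient support_hessian support_third support_fourth by (rule support_map_gauss)
  define \<beta> where "\<beta> = 1 / \<alpha>"
  have beta: "0 < \<beta>" "\<beta> < 1" using alpha by (simp_all add: \<beta>_def)
  have point: "\<exists>p\<in>M. z = \<nu> p \<and> support_gradient z = X p" if "norm z = 1" for z
  proof -
    have "z \<in> \<nu> ` M" unfolding gauss_map_onto using that by simp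
    then obtain p where p: "p \<in> M" "z = \<nu> p" by blast
    then show ?thesis using support_gradient_normal[of p 1] by auto
  qed
  have f_kappa: "f (\<kappa> p) > 0" if "p \<in> M" for p using f_pos strictly_convex that by blast
  have support: "support_gradient z \<bullet> z > 0" if z: "norm z = 1" for z
  proof -
    obtain p where p: "p \<in> M" "z = \<nu> p" "support_gradient z = X p" using point[OF z] by blast
    have "f (\<kappa> p) powr \<alpha> = X p \<bullet> \<nu> p" using self_similar p(1) by blast
    moreover have "f (\<kappa> p) powr \<alpha> > 0" using f_kappa[OF p(1)] by simp
    ultimately show ?thesis using p by simp
  qed
  have equation: "r \<in> Gamma_plus \<and> (support_gradient z \<bullet> z) powr (-\<beta>) = dual_fun f r"
    if z: "norm z = 1" and e: "orthonormal_frame z (e :: 'n \<Rightarrow> 'a)" "\<And>i. support_hessian z (e i) = r $ i *\<^sub>R e i" for z e r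
  proof -
    obtain p where p: "p \<in> M" "z = \<nu> p" "support_gradient z = X p" using point[OF z] by blast
    have r: "r \<in> Gamma_plus" "\<exists>\<sigma>. \<sigma> permutes UNIV \<and> (\<forall>i. \<kappa> p $ \<sigma> i = 1 / r $ i)"
      using eigenframe_curvatures[OF p(1), of e r] e p(2) by auto
    then obtain \<sigma> where \<sigma>: "\<sigma> permutes UNIV" "\<And>i. \<kappa> p $ \<sigma> i = 1 / r $ i" by blast
    have "f (\<chi> i. \<kappa> p $ \<sigma> i) = f (\<kappa> p)"
      using f_symmetric \<sigma>(1) strictly_convex p(1) unfolding symmetric_on_Gamma_plus_def by blast
    then have fk: "f (\<chi> i. 1 / r $ i) = f (\<kappa> p)" by (simp add: \<sigma>(2))
    have "(support_gradient z \<bullet> z) powr (-\<beta>) = (f (\<kappa> p) powr \<alpha>) powr (-\<beta>)" using self_similar p by simp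
    also have "\<dots> = f (\<kappa> p) powr (-1)" using alpha by (simp add: powr_powr \<beta>_def)
    also have "\<dots> = 1 / f (\<kappa> p)" using f_kappa[OF p(1)] by (simp add: powr_minus_divide)
    also have "\<dots> = dual_fun f r" by (simp add: dual_fun_def fk)
    finally show ?thesis using r(1) by simp
  qed
  note frame = eigenframe[OF ambient] and quadratic = quadratic_form_eigenframe[OF ambient]
  interpret support_solution support_gradient support_hessian support_third support_fourth "dual_grad f" \<beta>
  proof unfold_locales
    fix z v :: 'a assume z: "norm z = 1" and v: "v \<bullet> z = 0" "v \<noteq> 0"
    obtain e :: "'n \<Rightarrow> 'a" and r where e: "orthonormal_frame z e" "\<And>i. support_hessian z (e i) = r $ i *\<^sub>R e i"
      using frame[OF z] by blast
    have r: "r $ i > 0" for i using equation[OF z e] by (simp add: Gamma_plus_def)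
    have "(\<Sum>i\<in>UNIV. (v \<bullet> e i)\<^sup>2) \<noteq> 0" using quadratic(2)[OF z e v(1)] v(2) by auto
    then obtain i where "(v \<bullet> e i)\<^sup>2 \<noteq> 0" by (metis (mono_tags, lifting) sum.neutral)
    then have "r $ i * (v \<bullet> e i)\<^sup>2 > 0" using r by simp
    then have "(\<Sum>i\<in>UNIV. r $ i * (v \<bullet> e i)\<^sup>2) > 0"
      by (intro sum_pos2[of UNIV i]) (use r in \<open>auto simp: less_imp_le\<close>)
    then show "0 < support_hessian z v \<bullet> v" using quadratic(1)[OF z e v(1)] by simp
  next
    fix z :: 'a and w :: "'n \<Rightarrow> 'a" and x :: "real^'n"
    assume z: "norm z = 1" and w: "orthonormal_frame z w" and x: "x \<in> Gamma_plus"
    obtain e :: "'n \<Rightarrow> 'a" and r where e: "orthonormal_frame z e" "\<And>i. support_hessian z (e i) = r $ i *\<^sub>R e i"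
      using frame[OF z] by blast
    have r: "r \<in> Gamma_plus" "(support_gradient z \<bullet> z) powr (-\<beta>) = dual_fun f r" using equation[OF z e] by auto
    have ww: "w i \<bullet> w i = 1" "w i \<bullet> z = 0" for i using w by (simp_all add: orthonormal_frame_def)
    have e1: "e j \<bullet> e j = 1" "e j \<bullet> z = 0" for j using e(1) by (simp_all add: orthonormal_frame_def)
    have row: "(\<Sum>j\<in>UNIV. (w i \<bullet> e j)\<^sup>2) = 1" for i
      using quadratic(2)[OF z e ww(2)] ww(1) by simp
    have col: "(\<Sum>i\<in>UNIV. (w i \<bullet> e j)\<^sup>2) = 1" for j
    proof -
      have "e j = (\<Sum>i\<in>UNIV. (e j \<bullet> w i) *\<^sub>R w i)"
        using orthonormal_frame_expansion[OF ambient z w, of "e j"] e1(2) by simp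
      from arg_cong[OF this, of "\<lambda>x. x \<bullet> e j"]
      have "e j \<bullet> e j = (\<Sum>i\<in>UNIV. (e j \<bullet> w i) *\<^sub>R w i) \<bullet> e j" .
      then show ?thesis unfolding e1(1) by (simp add: inner_sum_left inner_sum_right inner_commute power2_eq_square)
    qed
    \<comment> \<open>The diagonal of the Hessian in the frame \<open>w\<close> is a doubly stochastic average of its eigenvalues.\<close>
    obtain \<sigma> where \<sigma>: "bij_betw \<sigma> (UNIV :: 'n set) UNIV"
      "(\<Sum>i\<in>UNIV. dual_grad f x i * r $ \<sigma> i) \<le> (\<Sum>i\<in>UNIV. \<Sum>j\<in>UNIV. dual_grad f x i * (w i \<bullet> e j)\<^sup>2 * r $ j)"
      using doubly_stochastic_assignment[of "UNIV :: 'n set" "UNIV :: 'n set" "\<lambda>i j. (w i \<bullet> e j)\<^sup>2" "dual_grad f x" "\<lambda>j. r $ j"]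
        row col by auto
    have perm: "\<sigma> permutes UNIV" using \<sigma>(1) by (metis UNIV_I bij_imp_permutes)
    have r': "(\<chi> i. r $ \<sigma> i) \<in> Gamma_plus" using r(1) by (simp add: Gamma_plus_def)
    have "(support_gradient z \<bullet> z) powr (-\<beta>) = dual_fun f (\<chi> i. r $ \<sigma> i)"
      using dual_fun_symmetric[OF perm r(1)] r(2) by simp
    also have "\<dots> \<le> (\<Sum>i\<in>UNIV. dual_grad f x i * r $ \<sigma> i)"
      using dual_fun_le_gradient[OF x r'] by simp
    also have "\<dots> \<le> (\<Sum>i\<in>UNIV. \<Sum>j\<in>UNIV. dual_grad f x i * (w i \<bullet> e j)\<^sup>2 * r $ j)" by (rule \<sigma>(2))
    also have "\<dots> = (\<Sum>i\<in>UNIV. dual_grad f x i * (support_hessian z (w i) \<bullet> w i))"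
      by (simp add: quadratic(1)[OF z e ww(2)] sum_distrib_left mult_ac)
    finally show "(support_gradient z \<bullet> z) powr (-\<beta>) \<le> (\<Sum>i\<in>UNIV. dual_grad f x i * (support_hessian z (w i) \<bullet> w i))" .
  next
    fix z :: 'a and w :: "'n \<Rightarrow> 'a" and x :: "real^'n"
    assume z: "norm z = 1" and w: "orthonormal_frame z w" "\<And>i. support_hessian z (w i) = x $ i *\<^sub>R w i"
    show "(support_gradient z \<bullet> z) powr (-\<beta>) = (\<Sum>i\<in>UNIV. dual_grad f x i * x $ i)"
      using equation[OF z w] dual_grad_euler by simp
  qed (use ambient n_ge_2 beta support dual_grad_pos continuous_on_dual_grad in auto)
  have "support_gradient z = support_gradient ((1 / norm z) *\<^sub>R z)" if "z \<noteq> 0" for z using that by (simp add: support_gradient_def)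
  then obtain \<rho> where \<rho>: "\<rho> > 0" "\<And>z. norm z = 1 \<Longrightarrow> support_gradient z = \<rho> *\<^sub>R z"
    using support_map_is_homothety by blast
  have X: "X p = \<rho> *\<^sub>R \<nu> p" if "p \<in> M" for p
    using \<rho>(2)[OF norm_normal[OF that]] support_gradient_normal[OF that, of 1] by simp
  have "X ` M = (\<lambda>z. \<rho> *\<^sub>R z) ` (\<nu> ` M)" using X by (force simp: image_image)
  also have "\<dots> = sphere 0 \<rho>" unfolding gauss_map_onto using \<rho>(1) sphere_scale[of \<rho> 0 1] by simp
  finally have "X ` M = sphere 0 \<rho>" .
  moreover have "inj_on X M"
    using gauss_map_inj X \<rho>(1) by (simp add: inj_on_def)
  ultimately show ?thesis using \<rho>(1) by blast
qed

end
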